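(* Let $a,b\in[0,1]$ and let $(X_n)_{n\ge 0}$ be a homogeneous Markov chain with state space the two-letter ordered alphabet $\{\alpha_1<\alpha_2\}$ and transition probabilities $\mathbb{P}(X_{n+1}=\alpha_2\mid X_n=\alpha_1)=a$ and $\mathbb{P}(X_{n+1}=\alpha_1\mid X_n=\alpha_2)=b$. Let the law of $X_0$ be the invariant distribution $(\pi_1,\pi_2)=\left(\frac{b}{a+b},\frac{a}{a+b}\right)$ if $0<a+b\le 2$, and $(\pi_1,\pi_2)=(1,0)$ if $a=b=0$ (where $\pi_i=\mathbb{P}(X_0=\alpha_i)$). Let $LI_n$ be the length of the longest weakly increasing subsequence of $X_1,\dots,X_n$. Then, as $n\to\infty$: (i) If $a=b>0$, then $$\frac{LI_n-n/2}{\sqrt{n}}\Rightarrow \sqrt{\frac{1-a}{a}}\left(-\frac12 B(1)+\max_{0\le t\le 1}B(t)\right),$$ where $(B(t))_{0\le t\le 1}$ is a standard Brownian motion. (ii) If $a\ne b$ or $a=b=0$, then $$\frac{LI_n-n\pi_{max}}{\sqrt{n}}\Rightarrow N(0,\tilde\sigma^2/4),$$ where $\pi_{max}=\max\{\pi_1,\pi_2\}$ and $N(0,\tilde\sigma^2/4)$ is a centered normal random variable with variance $\tilde\sigma^2/4=ab(2-a-b)/(a+b)^3$ for $a\ne b$, and $\tilde\sigma^2=0$ for $a=b=0$. If $a=b=1$ in (i), or if $\tilde\sigma^2=0$ in (ii), the limiting distribution is understood to be degenerate at the origin.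
   Context: The symbol $\Rightarrow$ denotes weak convergence (convergence in distribution). $LI_n$ is the largest $k$ such that there exist indices $1\le i_1<\dots<i_k\le n$ with $X_{i_1}\le X_{i_2}\le\dots\le X_{i_k}$ in the order $\alpha_1<\alpha_2$. *)

theory Defs
  imports "HOL-Probability.Probability"
begin

datatype letter = Alpha1 | Alpha2

instantiation letter :: linorder
begin

definition less_eq_letter :: "letter \<Rightarrow> letter \<Rightarrow> bool" where
  "x \<le> y \<longleftrightarrow> x = Alpha1 \<or> y = Alpha2"

definition less_letter :: "letter \<Rightarrow> letter \<Rightarrow> bool" where
  "x < y \<longleftrightarrow> x = Alpha1 \<and> y = Alpha2"

instance
proof
  fix x y z :: letter
  show "x < y \<longleftrightarrow> x \<le> y \<and> \<not> y \<le> x"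
    by (cases x; cases y) (simp_all add: less_eq_letter_def less_letter_def)
  show "x \<le> x"
    by (cases x) (simp_all add: less_eq_letter_def)
  show "x \<le> y \<Longrightarrow> y \<le> z \<Longrightarrow> x \<le> z"
    by (cases x; cases y; cases z) (simp_all add: less_eq_letter_def)
  show "x \<le> y \<Longrightarrow> y \<le> x \<Longrightarrow> x = y"
    by (cases x; cases y) (simp_all add: less_eq_letter_def)
  show "x \<le> y \<or> y \<le> x"
    by (cases x; cases y) (simp_all add: less_eq_letter_def)
qed

end

text \<open>
  The transition probabilities \<open>P\<close> are part of the data: they constrain the conditional
  probabilities only on histories of positive probability, so a state that is never visited
  imposes no condition.
\<close>

locale homogeneous_markov_chain = prob_space M
  for M :: "'w measure" +
  fixes X :: "nat \<Rightarrow> 'w \<Rightarrow> 's"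
    and P :: "'s \<Rightarrow> 's \<Rightarrow> real"
  assumes measurable_state: "\<And>n. X n \<in> M \<rightarrow>\<^sub>M count_space UNIV"
    and markov: "\<And>n x y. \<P>(\<omega> in M. \<forall>i\<le>n. X i \<omega> = x i) > 0 \<Longrightarrow>
      \<P>(\<omega> in M. X (Suc n) \<omega> = y \<bar> \<forall>i\<le>n. X i \<omega> = x i) = P (x n) y"

fun two_state_trans :: "real \<Rightarrow> real \<Rightarrow> letter \<Rightarrow> letter \<Rightarrow> real" where
  "two_state_trans a b Alpha1 Alpha1 = 1 - a"
| "two_state_trans a b Alpha1 Alpha2 = a"
| "two_state_trans a b Alpha2 Alpha1 = b"
| "two_state_trans a b Alpha2 Alpha2 = 1 - b"

text \<open>For \<open>a = b = 0\<close> every distribution is invariant; the point mass at \<open>Alpha1\<close> is chosen.\<close>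

fun invariant_dist :: "real \<Rightarrow> real \<Rightarrow> letter \<Rightarrow> real" where
  "invariant_dist a b Alpha1 = (if a = 0 \<and> b = 0 then 1 else b / (a + b))"
| "invariant_dist a b Alpha2 = (if a = 0 \<and> b = 0 then 0 else a / (a + b))"

text \<open>
  Length of the longest weakly increasing subsequence of \<open>x 1, \<dots>, x n\<close>; the term \<open>x 0\<close>
  is not used.
\<close>

definition LI :: "(nat \<Rightarrow> 'a::linorder) \<Rightarrow> nat \<Rightarrow> nat" where
  "LI x n = Max {k. \<exists>i::nat \<Rightarrow> nat. strict_mono_on {1..k} i \<and> i ` {1..k} \<subseteq> {1..n} \<and>
                      mono_on {1..k} (\<lambda>j. x (i j))}"

lemma LI_lengths_finite_nonempty:
  fixes x :: "nat \<Rightarrow> 'a::linorder" and n :: nat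
  defines "S \<equiv> {k. \<exists>i::nat \<Rightarrow> nat. strict_mono_on {1..k} i \<and> i ` {1..k} \<subseteq> {1..n} \<and>
                      mono_on {1..k} (\<lambda>j. x (i j))}"
  shows "finite S" and "S \<noteq> {}"
proof -
  have "k \<le> n" if "k \<in> S" for k
  proof -
    from that obtain i :: "nat \<Rightarrow> nat"
      where "strict_mono_on {1..k} i" and "i ` {1..k} \<subseteq> {1..n}"
      unfolding S_def by blast
    then show ?thesis
      using card_inj_on_le[of i "{1..k}" "{1..n}"] strict_mono_on_imp_inj_on by auto
  qed
  then show "finite S"
    by (meson finite_nat_set_iff_bounded_le)
  have "0 \<in> S"
    by (auto simp: S_def strict_mono_on_def mono_on_def)
  then show "S \<noteq> {}"
    by blast
qed

locale standard_brownian_motion = prob_space M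
  for M :: "'w measure" +
  fixes B :: "real \<Rightarrow> 'w \<Rightarrow> real"
  assumes random_variable_B: "\<And>t. t \<in> {0..1} \<Longrightarrow> random_variable borel (B t)"
    and start_zero: "AE \<omega> in M. B 0 \<omega> = 0"
    and continuous_paths: "\<And>\<omega>. \<omega> \<in> space M \<Longrightarrow> continuous_on {0..1} (\<lambda>t. B t \<omega>)"
    and gaussian_increments: "\<And>s t. 0 \<le> s \<Longrightarrow> s < t \<Longrightarrow> t \<le> 1 \<Longrightarrow>
      distributed M lborel (\<lambda>\<omega>. B t \<omega> - B s \<omega>) (normal_density 0 (sqrt (t - s)))"
    and independent_increments: "\<And>(\<tau> :: nat \<Rightarrow> real) k.
      0 \<le> \<tau> 0 \<Longrightarrow> (\<And>i. i < k \<Longrightarrow> \<tau> i < \<tau> (Suc i)) \<Longrightarrow> \<tau> k \<le> 1 \<Longrightarrow>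
      indep_vars (\<lambda>_. borel) (\<lambda>i \<omega>. B (\<tau> (Suc i)) \<omega> - B (\<tau> i) \<omega>) {..<k}"

text \<open>
  The second argument is the variance, whereas \<open>normal_density\<close> takes the standard deviation.
  Variance zero gives the point mass at the mean.
\<close>

definition normal_law :: "real \<Rightarrow> real \<Rightarrow> real measure" where
  "normal_law \<mu> v = (if v = 0 then return borel \<mu> else density lborel (normal_density \<mu> (sqrt v)))"

definition sigma_tilde_sq :: "real \<Rightarrow> real \<Rightarrow> real" where
  "sigma_tilde_sq a b =
     (if a = 0 \<and> b = 0 then 0 else 4 * (a * b * (2 - a - b) / (a + b) ^ 3))"

end

theory Submission
  imports Defs
begin

text \<open>
  Over two letters a weakly increasing subsequence takes \<open>Alpha1\<close>s from an initial segment and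
  \<open>Alpha2\<close>s from the rest. Hence \<open>LI x n\<close> is the maximum over \<open>k \<le> n\<close> of the number of \<open>Alpha1\<close>s
  among \<open>x 1, \<dots>, x k\<close> plus the number of \<open>Alpha2\<close>s among \<open>x (k + 1), \<dots>, x n\<close>. If \<open>S k\<close> is the
  walk that goes up at each \<open>Alpha1\<close> and down at each \<open>Alpha2\<close>, this maximum is
  \<open>n / 2 - S n / 2 + max S\<close> (\<open>LI_eq_walk_max\<close>), so everything is a statement about \<open>S\<close>.

  If \<open>a \<noteq> b\<close>, the walk has a drift and its maximum sits near one end of \<open>{0..n}\<close>: \<open>LI\<close> is the
  number of occurrences of the more frequent letter plus a remainder of bounded expectation
  (\<open>LI_minus_majority_count\<close>, from an exponential Lyapunov function). The remainder is invisible
  at scale \<open>sqrt n\<close>, and the occupation count satisfies a central limit theorem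
  (\<open>markov_chain_clt\<close>). That theorem is proved with a perturbed eigenfunction: the transition
  operator tilted by \<open>iexp (\<epsilon> * f)\<close> has, to second order in \<open>\<epsilon>\<close>, an explicit eigenfunction with
  eigenvalue \<open>1 - s * \<epsilon>\<^sup>2 / 2\<close>, and the \<open>n\<close>-th power of this eigenvalue at
  \<open>\<epsilon> = \<theta> / sqrt n\<close> converges to the Gaussian characteristic function.

  If \<open>a = b\<close>, the walk is driftless, and up to a bounded error it is a martingale whose increments
  have a constant conditional variance. Lindeberg's exchange (\<open>lindeberg_exchange\<close>) replaces these
  increments one at a time by increments of the given Brownian motion over a grid of mesh \<open>1 / n\<close>,
  on the product of the two probability spaces. The exchange needs three derivatives of the
  functional in each increment, so the maximum is replaced by
  \<open>softmax \<beta> n\<close>, the logarithm of the sum of the \<open>exp (\<beta> * S k)\<close> divided by \<open>\<beta>\<close>. This costs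
  \<open>ln (n + 1) / \<beta>\<close>, while the exchange costs a multiple of \<open>\<beta>\<^sup>2 / sqrt n\<close>; both vanish for
  \<open>\<beta> = n powr (1 / 8)\<close> (\<open>softmax_scale\<close>). What is left is the discretised functional of the
  Brownian motion itself, and it converges by continuity of paths (\<open>Max_grid_tendsto_SUP\<close>).
\<close>

section \<open>Longest increasing subsequences of two-letter words\<close>

lemma UNIV_letter: "(UNIV :: letter set) = {Alpha1, Alpha2}"
  using letter.exhaust by auto

text \<open>
  For every cut \<open>k\<close> the positions counted here carry an increasing word; it is the longest one whose
  change of letter happens at \<open>k\<close>.
\<close>

definition split_count :: "(nat \<Rightarrow> letter) \<Rightarrow> nat \<Rightarrow> nat \<Rightarrow> nat" where
  "split_count x n k =
     card {i \<in> {1..k}. x i = Alpha1} + card {i \<in> {Suc k..n}. x i = Alpha2}"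

text \<open>
  An increasing subsequence reads \<open>Alpha1\<close>s and then \<open>Alpha2\<close>s; cutting at the position of its last
  \<open>Alpha1\<close> embeds it into the index set counted by \<open>split_count\<close>. Conversely that index set,
  enumerated in increasing order, is an increasing subsequence.
\<close>

lemma LI_eq_Max_split_count: "LI x n = Max (split_count x n ` {..n})"
proof -
  define S where "S = {k. \<exists>i::nat \<Rightarrow> nat. strict_mono_on {1..k} i \<and> i ` {1..k} \<subseteq> {1..n} \<and>
                      mono_on {1..k} (\<lambda>j. x (i j))}"
  have fS: "finite S" "S \<noteq> {}"
    unfolding S_def by (rule LI_lengths_finite_nonempty)+
  define W where "W k = {i \<in> {1..k}. x i = Alpha1} \<union> {i \<in> {Suc k..n}. x i = Alpha2}" for k
  have cardW: "card (W k) = split_count x n k" for k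
    unfolding W_def split_count_def by (subst card_Un_disjoint) auto
  have finW: "finite (W k)" for k unfolding W_def by auto
  have le: "\<exists>k\<le>n. l \<le> split_count x n k" if "l \<in> S" for l
  proof -
    from that obtain i :: "nat \<Rightarrow> nat"
      where i: "strict_mono_on {1..l} i" "i ` {1..l} \<subseteq> {1..n}"
        "mono_on {1..l} (\<lambda>j. x (i j))"
      unfolding S_def by blast
    \<comment> \<open>The element \<open>0\<close> gives the cut \<open>k = 0\<close> for a subsequence without \<open>Alpha1\<close>.\<close>
    define J where "J = insert 0 (i ` {j \<in> {1..l}. x (i j) = Alpha1})"
    define k where "k = Max J"
    have fJ: "finite J" "J \<noteq> {}" unfolding J_def by auto
    have kJ: "k \<in> J" unfolding k_def using fJ by (rule Max_in)
    have "i ` {1..l} \<subseteq> W k"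
    proof
      fix v assume "v \<in> i ` {1..l}"
      then obtain j where j: "j \<in> {1..l}" "v = i j" by auto
      have vn: "v \<in> {1..n}" using i(2) j by (auto simp del: atLeastAtMost_iff)
      show "v \<in> W k"
      proof (cases "x v")
        case Alpha1
        then have "v \<in> J" unfolding J_def using j by auto
        then have "v \<le> k" unfolding k_def using fJ by simp
        then show ?thesis using Alpha1 vn unfolding W_def by auto
      next
        case Alpha2
        have "k < v"
        proof (rule ccontr)
          assume "\<not> k < v"
          then have "k \<noteq> 0" using vn by auto
          then obtain j' where j': "j' \<in> {1..l}" "x (i j') = Alpha1" "k = i j'"
            using kJ unfolding J_def by auto
          have "v \<noteq> k" using j' Alpha2 by auto
          then have "i j < i j'" using \<open>\<not> k < v\<close> j j' by auto
          then have "j \<le> j'" using i(1) j j'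
            by (meson linorder_not_le order_less_asym strict_mono_onD)
          then have "x (i j) \<le> x (i j')" using mono_onD[OF i(3) j(1) j'(1)] by blast
          then show False using Alpha2 j' j by (simp add: less_eq_letter_def)
        qed
        then show ?thesis using Alpha2 vn unfolding W_def by auto
      qed
    qed
    then have "card (i ` {1..l}) \<le> card (W k)" by (rule card_mono[OF finW])
    moreover have "card (i ` {1..l}) = l"
      using strict_mono_on_imp_inj_on[OF i(1)] by (simp add: card_image)
    moreover have "k \<le> n" using kJ i(2) unfolding J_def by (auto simp: image_subset_iff)
    ultimately show ?thesis using cardW by auto
  qed
  have ge: "split_count x n k \<in> S" if "k \<le> n" for k
  proof -
    define i where "i j = enumerate (W k) (j - 1)" for j
    have inW: "i j \<in> W k" if "j \<in> {1..split_count x n k}" for j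
      unfolding i_def using that
      by (intro finite_enumerate_in_set[OF finW]) (auto simp: cardW)
    have mono: "i j < i j'" if "j \<in> {1..split_count x n k}" "j' \<in> {1..split_count x n k}" "j < j'" for j j'
      unfolding i_def using that
      by (intro finite_enumerate_mono[OF _ finW]) (auto simp: cardW)
    have "strict_mono_on {1..split_count x n k} i"
      by (auto intro!: strict_mono_onI mono)
    moreover have "i ` {1..split_count x n k} \<subseteq> {1..n}"
      using inW that unfolding W_def by fastforce
    moreover have "mono_on {1..split_count x n k} (\<lambda>j. x (i j))"
    proof (rule mono_onI)
      fix r s assume rs: "r \<in> {1..split_count x n k}" "s \<in> {1..split_count x n k}" "r \<le> s"
      have "i r \<le> i s" using mono rs by (cases "r = s") (auto simp: less_imp_le)
      then show "x (i r) \<le> x (i s)" using inW[OF rs(1)] inW[OF rs(2)]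
        unfolding W_def less_eq_letter_def by auto
    qed
    ultimately show ?thesis unfolding S_def by blast
  qed
  have "Max S = Max (split_count x n ` {..n})"
  proof (rule antisym)
    obtain k where "k \<le> n" "Max S \<le> split_count x n k" using le[OF Max_in[OF fS]] by auto
    then show "Max S \<le> Max (split_count x n ` {..n})"
      by (auto intro: order_trans Max_ge)
    show "Max (split_count x n ` {..n}) \<le> Max S"
      using ge fS by (subst Max_le_iff) (auto intro: Max_ge)
  qed
  then show ?thesis unfolding LI_def S_def .
qed

definition letter_sign :: "letter \<Rightarrow> real" where
  "letter_sign s = (if s = Alpha1 then 1 else -1)"

lemma card_letter_eq_sum:
  "real (card {i \<in> I. x i = s}) = (\<Sum>i\<in>I. if x i = s then 1 else 0)" if "finite I"
  using that by (simp add: sum.If_cases Int_def)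

lemma split_count_eq_walk:
  assumes "k \<le> n"
  shows "real (split_count x n k) = real n / 2 - (\<Sum>i=1..n. letter_sign (x i)) / 2
           + (\<Sum>i=1..k. letter_sign (x i))"
proof -
  have sp: "(\<Sum>i=1..n. letter_sign (x i)) = (\<Sum>i=1..k. letter_sign (x i)) + (\<Sum>i=Suc k..n. letter_sign (x i))"
    using assms sum.ub_add_nat[of 1 k "\<lambda>i. letter_sign (x i)" "n - k"] by simp
  have "(if x i = Alpha1 then 1 else 0) = 1/2 + letter_sign (x i) / 2"
    and "(if x i = Alpha2 then 1 else 0) = 1/2 - letter_sign (x i) / 2" for i
    by (cases "x i"; simp add: letter_sign_def)+
  then have "real (split_count x n k) =
      (\<Sum>i=1..k. 1/2 + letter_sign (x i) / 2) + (\<Sum>i=Suc k..n. 1/2 - letter_sign (x i) / 2)"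
    unfolding split_count_def of_nat_add by (subst (1 2) card_letter_eq_sum) (simp_all only: finite_atLeastAtMost)
  also have "\<dots> = real n / 2 + (\<Sum>i=1..k. letter_sign (x i)) / 2 - (\<Sum>i=Suc k..n. letter_sign (x i)) / 2"
    using assms by (simp add: sum.distrib sum_subtractf sum_divide_distrib[symmetric] of_nat_diff Suc_diff_le field_simps)
  finally show ?thesis using sp by (simp add: field_simps)
qed

lemma real_Max_image:
  assumes "finite A" "A \<noteq> {}"
  shows "real (Max (f ` A)) = Max ((\<lambda>k. real (f k)) ` A)"
  using mono_Max_commute[of real "f ` A"] assms by (simp add: mono_def image_image)

lemma Max_add_const:
  fixes c :: real
  assumes "finite A" "A \<noteq> {}"
  shows "Max ((\<lambda>k. c + f k) ` A) = c + Max (f ` A)"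
  using mono_Max_commute[of "\<lambda>y. c + y" "f ` A"] assms by (simp add: mono_def image_image)

text \<open>
  This identity reduces the fluctuations of \<open>LI\<close> to those of the end point and the maximum of the
  sign walk.
\<close>

lemma LI_eq_walk_max:
  "real (LI x n) - real n / 2 =
     - (\<Sum>i=1..n. letter_sign (x i)) / 2 + Max ((\<lambda>k. \<Sum>i=1..k. letter_sign (x i)) ` {..n})"
proof -
  have "real (LI x n) = Max ((\<lambda>k. (real n / 2 - (\<Sum>i=1..n. letter_sign (x i)) / 2)
           + (\<Sum>i=1..k. letter_sign (x i))) ` {..n})"
    unfolding LI_eq_Max_split_count by (subst real_Max_image) (auto simp: split_count_eq_walk intro!: arg_cong[where f=Max])
  then show ?thesis by (subst (asm) Max_add_const) auto
qed

text \<open>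
  Relative to the total count of a letter, a cut costs or gains a partial sum of signs: a suffix sum
  for \<open>Alpha1\<close> and a prefix sum for \<open>Alpha2\<close>. The intervals are written \<open>{Suc k..k + l}\<close> so that both
  cases fit the moment bound \<open>exponential_moment_decay\<close>.
\<close>

lemma split_count_eq_count1:
  assumes "k \<le> n"
  shows "real (split_count x n k) = (\<Sum>i=1..n. if x i = Alpha1 then 1 else 0)
     + (\<Sum>i=Suc k..k + (n - k). - letter_sign (x i))"
proof -
  have "(if x i = Alpha1 then 1 else 0) = 1/2 + letter_sign (x i) / 2" for i
    by (cases "x i"; simp add: letter_sign_def)
  then have "(\<Sum>i=1..n. if x i = Alpha1 then 1 else 0) = real n / 2 + (\<Sum>i=1..n. letter_sign (x i)) / 2"
    by (simp add: sum.distrib sum_divide_distrib)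
  moreover have "(\<Sum>i=1..n. letter_sign (x i)) = (\<Sum>i=1..k. letter_sign (x i)) + (\<Sum>i=Suc k..n. letter_sign (x i))"
    using assms sum.ub_add_nat[of 1 k "\<lambda>i. letter_sign (x i)" "n - k"] by simp
  ultimately show ?thesis
    using split_count_eq_walk[OF assms, of x] assms by (simp add: sum_negf add_divide_distrib diff_divide_distrib)
qed

lemma split_count_eq_count2:
  assumes "k \<le> n"
  shows "real (split_count x n k) = (\<Sum>i=1..n. if x i = Alpha2 then 1 else 0)
     + (\<Sum>i=Suc 0..0 + k. letter_sign (x i))"
proof -
  have "(if x i = Alpha2 then 1 else 0) = 1/2 - letter_sign (x i) / 2" for i
    by (cases "x i"; simp add: letter_sign_def)
  then have "(\<Sum>i=1..n. if x i = Alpha2 then 1 else 0) = real n / 2 - (\<Sum>i=1..n. letter_sign (x i)) / 2"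
    by (simp add: sum_subtractf sum_divide_distrib)
  then show ?thesis using split_count_eq_walk[OF assms, of x] by simp
qed

text \<open>
  Since \<open>y \<le> exp y\<close>, the maximum of the \<open>t k\<close> is at most a sum of exponentials, whose
  expectation can be bounded term by term.
\<close>

lemma LI_le_exponential_sum:
  assumes \<eta>: "\<eta> > 0" and c: "\<And>k. k \<le> n \<Longrightarrow> real (split_count x n k) = N + t k"
    and 0: "\<exists>k\<le>n. t k = 0"
  shows "real (LI x n) - N \<ge> 0" "real (LI x n) - N \<le> (\<Sum>k\<le>n. exp (\<eta> * t k)) / \<eta>"
proof -
  have LI: "real (LI x n) = Max ((\<lambda>k. real (split_count x n k)) ` {..n})"
    unfolding LI_eq_Max_split_count by (rule real_Max_image) auto
  obtain k0 where k0: "k0 \<le> n" "t k0 = 0" using 0 by auto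
  have "real (split_count x n k0) \<le> real (LI x n)" unfolding LI using k0 by (intro Max_ge) auto
  then show "real (LI x n) - N \<ge> 0" using c[OF k0(1)] k0 by simp
  have "real (LI x n) \<in> (\<lambda>k. real (split_count x n k)) ` {..n}" unfolding LI by (intro Max_in) auto
  then obtain k where k: "k \<le> n" "real (LI x n) = N + t k" using c by auto
  have "\<eta> * t k \<le> exp (\<eta> * t k)" using exp_ge_add_one_self[of "\<eta> * t k"] by linarith
  also have "\<dots> \<le> (\<Sum>k\<le>n. exp (\<eta> * t k))" using k by (intro member_le_sum) auto
  finally show "real (LI x n) - N \<le> (\<Sum>k\<le>n. exp (\<eta> * t k)) / \<eta>" using k \<eta> by (simp add: field_simps)
qed

lemma LI_cong:
  fixes x y :: "nat \<Rightarrow> letter"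
  assumes "\<And>i. i \<le> n \<Longrightarrow> x i = y i"
  shows "LI x n = LI y n"
proof -
  have "split_count x n k = split_count y n k" if "k \<le> n" for k
    unfolding split_count_def using assms that
    by (intro arg_cong2[where f="(+)"] arg_cong[where f=card] Collect_cong) auto
  then show ?thesis unfolding LI_eq_Max_split_count by (intro arg_cong[where f=Max] image_cong) auto
qed

section \<open>Path functionals of a finite Markov chain\<close>

lemma (in prob_space) norm_expectation_le:
  fixes F :: "'a \<Rightarrow> 'b::{banach, second_countable_topology}"
  assumes "integrable M F" "\<And>\<omega>. \<omega> \<in> space M \<Longrightarrow> norm (F \<omega>) \<le> c"
  shows "norm (expectation F) \<le> c"
proof -
  have "norm (expectation F) \<le> expectation (\<lambda>\<omega>. norm (F \<omega>))" by (rule integral_norm_bound)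
  also have "\<dots> \<le> c" using assms by (intro integral_le_const) auto
  finally show ?thesis .
qed

text \<open>
  Finiteness of the state space makes every functional of finitely many steps a finite linear
  combination of cylinder events: measurability, boundedness and integrability are then automatic
  for arbitrary functions of the history.
\<close>

locale finite_markov_chain = homogeneous_markov_chain M X P
  for M :: "'w measure" and X :: "nat \<Rightarrow> 'w \<Rightarrow> 's" and P :: "'s \<Rightarrow> 's \<Rightarrow> real" +
  assumes finite_states: "finite (UNIV :: 's set)"
begin

abbreviation trajectory :: "'w \<Rightarrow> nat \<Rightarrow> 's" where
  "trajectory \<omega> \<equiv> \<lambda>i. X i \<omega>"

text \<open>
  Histories are kept as total sequences, of which only the coordinates up to \<open>n\<close> may matter. Sums over
  the path and \<open>LI\<close> are then functionals as they stand.
\<close>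

definition past_determined :: "nat \<Rightarrow> ((nat \<Rightarrow> 's) \<Rightarrow> 'b) \<Rightarrow> bool" where
  "past_determined n h \<longleftrightarrow> (\<forall>x y. (\<forall>i\<le>n. x i = y i) \<longrightarrow> h x = h y)"

lemma past_determinedI:
  "(\<And>x y. (\<And>i. i \<le> n \<Longrightarrow> x i = y i) \<Longrightarrow> h x = h y) \<Longrightarrow> past_determined n h"
  unfolding past_determined_def by blast

definition histories :: "nat \<Rightarrow> (nat \<Rightarrow> 's) set" where
  "histories n = PiE {..n} (\<lambda>_. UNIV)"

definition cylinder :: "nat \<Rightarrow> (nat \<Rightarrow> 's) \<Rightarrow> 'w set" where
  "cylinder n x = {\<omega> \<in> space M. \<forall>i\<le>n. X i \<omega> = x i}"

lemma finite_histories: "finite (histories n)"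
  unfolding histories_def by (intro finite_PiE) (auto simp: finite_states)

lemma state_event [measurable]: "{\<omega> \<in> space M. X n \<omega> = s} \<in> sets M"
  using measurable_sets[OF measurable_state, of "{s}" n]
  by (simp add: vimage_def Int_def conj_commute)

lemma cylinder_sets [measurable]: "cylinder n x \<in> sets M"
  unfolding cylinder_def by measurable

lemma past_determined_eq_sum:
  fixes h :: "(nat \<Rightarrow> 's) \<Rightarrow> 'b::real_vector"
  assumes "past_determined n h" "\<omega> \<in> space M"
  shows "h (trajectory \<omega>) = (\<Sum>x\<in>histories n. indicat_real (cylinder n x) \<omega> *\<^sub>R h x)"
proof -
  define x0 where "x0 = restrict (trajectory \<omega>) {..n}"
  have x0: "x0 \<in> histories n" unfolding histories_def x0_def by auto
  have "indicat_real (cylinder n x) \<omega> = (if x = x0 then 1 else 0)" if "x \<in> histories n" for x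
  proof -
    have "\<omega> \<in> cylinder n x \<longleftrightarrow> x = x0"
      using that assms(2) unfolding histories_def x0_def cylinder_def
      by (auto simp: PiE_iff extensional_def fun_eq_iff)
    then show ?thesis by (simp add: indicator_def)
  qed
  then have "(\<Sum>x\<in>histories n. indicat_real (cylinder n x) \<omega> *\<^sub>R h x)
      = (\<Sum>x\<in>histories n. if x = x0 then h x else 0)"
    by (intro sum.cong) auto
  also have "\<dots> = h x0" using x0 finite_histories by simp
  also have "h x0 = h (trajectory \<omega>)"
    using assms(1) unfolding past_determined_def x0_def by auto
  finally show ?thesis by simp
qed

lemma past_determined_measurable:
  fixes h :: "(nat \<Rightarrow> 's) \<Rightarrow> 'b::{real_normed_vector, second_countable_topology}"
  assumes "past_determined n h"
  shows "(\<lambda>\<omega>. h (trajectory \<omega>)) \<in> borel_measurable M"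
proof -
  have "(\<lambda>\<omega>. \<Sum>x\<in>histories n. indicat_real (cylinder n x) \<omega> *\<^sub>R h x) \<in> borel_measurable M"
    by measurable
  then show ?thesis
    by (subst measurable_cong[OF past_determined_eq_sum[OF assms]])
qed

lemma past_determined_bounded:
  fixes h :: "(nat \<Rightarrow> 's) \<Rightarrow> 'b::real_normed_vector"
  assumes "past_determined n h"
  obtains C where "\<And>x. norm (h x) \<le> C"
proof
  fix x
  have "h x = h (restrict x {..n})"
    using assms unfolding past_determined_def by auto
  moreover have "restrict x {..n} \<in> histories n" unfolding histories_def by auto
  ultimately show "norm (h x) \<le> (\<Sum>y\<in>histories n. norm (h y))"
    using member_le_sum[of "restrict x {..n}" "histories n" "\<lambda>y. norm (h y)"] finite_histories by auto
qed

lemma past_determined_integrable: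
  fixes h :: "(nat \<Rightarrow> 's) \<Rightarrow> 'b::{banach, second_countable_topology}"
  assumes "past_determined n h"
  shows "integrable M (\<lambda>\<omega>. h (trajectory \<omega>))"
proof -
  obtain C where "\<And>x. norm (h x) \<le> C" using past_determined_bounded[OF assms] by blast
  then show ?thesis
    by (intro integrable_const_bound[where B=C] past_determined_measurable[OF assms]) auto
qed

lemma expectation_past_determined:
  fixes h :: "(nat \<Rightarrow> 's) \<Rightarrow> 'b::{banach, second_countable_topology}"
  assumes "past_determined n h" and [measurable]: "A \<in> events"
  shows "expectation (\<lambda>\<omega>. indicat_real A \<omega> *\<^sub>R h (trajectory \<omega>))
    = (\<Sum>x\<in>histories n. prob (cylinder n x \<inter> A) *\<^sub>R h x)"
proof -
  have "expectation (\<lambda>\<omega>. indicat_real A \<omega> *\<^sub>R h (trajectory \<omega>)) =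
    expectation (\<lambda>\<omega>. \<Sum>x\<in>histories n. indicat_real (cylinder n x \<inter> A) \<omega> *\<^sub>R h x)"
    by (intro Bochner_Integration.integral_cong refl, subst past_determined_eq_sum[OF assms(1)])
       (simp_all add: scaleR_sum_right indicator_inter_arith mult.commute)
  also have "\<dots> = (\<Sum>x\<in>histories n. expectation (\<lambda>\<omega>. indicat_real (cylinder n x \<inter> A) \<omega> *\<^sub>R h x))"
    by (intro Bochner_Integration.integral_sum integrable_scaleR_left integrable_real_indicator)
       (auto simp: less_top[symmetric])
  also have "\<dots> = (\<Sum>x\<in>histories n. prob (cylinder n x \<inter> A) *\<^sub>R h x)"
  proof (intro sum.cong refl)
    fix x
    have "integrable M (indicat_real (cylinder n x \<inter> A))"
      by (intro integrable_real_indicator) (auto simp: less_top[symmetric])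
    moreover have "cylinder n x \<inter> A \<inter> space M = cylinder n x \<inter> A" unfolding cylinder_def by auto
    ultimately show "expectation (\<lambda>\<omega>. indicat_real (cylinder n x \<inter> A) \<omega> *\<^sub>R h x) = prob (cylinder n x \<inter> A) *\<^sub>R h x"
      by simp
  qed
  finally show ?thesis .
qed

text \<open>
  The defining Markov property conditions on events of positive probability. In product form it holds
  for every history, because both sides vanish on null cylinders.
\<close>

lemma cylinder_step:
  "prob (cylinder n x \<inter> {\<omega> \<in> space M. X (Suc n) \<omega> = y}) = prob (cylinder n x) * P (x n) y"
proof (cases "prob (cylinder n x) > 0")
  case True
  have "cond_prob M (\<lambda>\<omega>. X (Suc n) \<omega> = y) (\<lambda>\<omega>. \<forall>i\<le>n. X i \<omega> = x i) = P (x n) y"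
    using True unfolding cylinder_def by (rule markov)
  moreover have "{\<omega> \<in> space M. X (Suc n) \<omega> = y \<and> (\<forall>i\<le>n. X i \<omega> = x i)}
      = cylinder n x \<inter> {\<omega> \<in> space M. X (Suc n) \<omega> = y}"
    unfolding cylinder_def by auto
  ultimately show ?thesis using True unfolding cond_prob_def cylinder_def[symmetric]
    by (simp add: field_simps)
next
  case False
  then have "prob (cylinder n x) = 0" using measure_nonneg[of M "cylinder n x"] by linarith
  moreover from this have "prob (cylinder n x \<inter> {\<omega> \<in> space M. X (Suc n) \<omega> = y}) = 0"
    using finite_measure_mono[of "cylinder n x \<inter> {\<omega> \<in> space M. X (Suc n) \<omega> = y}" "cylinder n x"]
      measure_nonneg[of M "cylinder n x \<inter> {\<omega> \<in> space M. X (Suc n) \<omega> = y}"]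
    by simp
  ultimately show ?thesis by simp
qed

text \<open>
  The Markov property as it is used below: under an expectation with any functional of the past, a
  function of the next state may be replaced by its one-step average.
\<close>

lemma expectation_markov_step:
  fixes h :: "(nat \<Rightarrow> 's) \<Rightarrow> 'b::{banach, real_normed_field, second_countable_topology}"
  assumes h: "past_determined n h"
  shows "expectation (\<lambda>\<omega>. h (trajectory \<omega>) * \<phi> (X (Suc n) \<omega>)) =
         expectation (\<lambda>\<omega>. h (trajectory \<omega>) * (\<Sum>y\<in>UNIV. P (X n \<omega>) y *\<^sub>R \<phi> y))"
proof -
  define E where "E y = {\<omega> \<in> space M. X (Suc n) \<omega> = y}" for y
  have [measurable]: "E y \<in> events" for y unfolding E_def by measurable
  have pd: "past_determined n (\<lambda>x. h x * c)" for c
    using h unfolding past_determined_def by metis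
  have pdP: "past_determined n (\<lambda>x. h x * (\<Sum>y\<in>UNIV. P (x n) y *\<^sub>R \<phi> y))"
    using h unfolding past_determined_def by (metis order_refl)
  have "expectation (\<lambda>\<omega>. h (trajectory \<omega>) * \<phi> (X (Suc n) \<omega>)) =
      expectation (\<lambda>\<omega>. \<Sum>y\<in>UNIV. indicat_real (E y) \<omega> *\<^sub>R (h (trajectory \<omega>) * \<phi> y))"
  proof (intro Bochner_Integration.integral_cong refl)
    fix \<omega> assume "\<omega> \<in> space M"
    then have "indicat_real (E y) \<omega> = (if y = X (Suc n) \<omega> then 1 else 0)" for y
      by (auto simp: E_def indicator_def)
    then have "(\<Sum>y\<in>UNIV. indicat_real (E y) \<omega> *\<^sub>R (h (trajectory \<omega>) * \<phi> y)) =
       (\<Sum>y\<in>UNIV. if y = X (Suc n) \<omega> then h (trajectory \<omega>) * \<phi> y else 0)"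
      by (intro sum.cong) auto
    then show "h (trajectory \<omega>) * \<phi> (X (Suc n) \<omega>) = (\<Sum>y\<in>UNIV. indicat_real (E y) \<omega> *\<^sub>R (h (trajectory \<omega>) * \<phi> y))"
      using finite_states by simp
  qed
  also have "\<dots> = (\<Sum>y\<in>UNIV. expectation (\<lambda>\<omega>. indicat_real (E y) \<omega> *\<^sub>R (h (trajectory \<omega>) * \<phi> y)))"
    by (intro Bochner_Integration.integral_sum integrable_mult_indicator past_determined_integrable[OF pd])
       measurable
  also have "\<dots> = (\<Sum>y\<in>UNIV. \<Sum>x\<in>histories n. prob (cylinder n x) *\<^sub>R (h x * P (x n) y *\<^sub>R \<phi> y))"
    by (subst expectation_past_determined[OF pd])
       (simp_all add: E_def cylinder_step mult.commute)
  also have "\<dots> = (\<Sum>x\<in>histories n. prob (cylinder n x) *\<^sub>R (h x * (\<Sum>y\<in>UNIV. P (x n) y *\<^sub>R \<phi> y)))"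
    by (subst sum.swap) (simp add: scaleR_sum_right sum_distrib_left)
  also have "\<dots> = expectation (\<lambda>\<omega>. h (trajectory \<omega>) * (\<Sum>y\<in>UNIV. P (X n \<omega>) y *\<^sub>R \<phi> y))"
  proof -
    have "expectation (\<lambda>\<omega>. indicat_real (space M) \<omega> *\<^sub>R (h (trajectory \<omega>) * (\<Sum>y\<in>UNIV. P (X n \<omega>) y *\<^sub>R \<phi> y)))
      = (\<Sum>x\<in>histories n. prob (cylinder n x) *\<^sub>R (h x * (\<Sum>y\<in>UNIV. P (x n) y *\<^sub>R \<phi> y)))"
    proof -
      have "cylinder n x \<inter> space M = cylinder n x" for x unfolding cylinder_def by auto
      then show ?thesis using expectation_past_determined[OF pdP, of "space M"] by simp
    qed
    moreover have "expectation (\<lambda>\<omega>. indicat_real (space M) \<omega> *\<^sub>R (h (trajectory \<omega>) * (\<Sum>y\<in>UNIV. P (X n \<omega>) y *\<^sub>R \<phi> y)))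
      = expectation (\<lambda>\<omega>. h (trajectory \<omega>) * (\<Sum>y\<in>UNIV. P (X n \<omega>) y *\<^sub>R \<phi> y))"
      by (intro Bochner_Integration.integral_cong) auto
    ultimately show ?thesis by simp
  qed
  finally show ?thesis .
qed

lemma past_determined_sum: "past_determined n (\<lambda>x. F (\<Sum>i=1..n. G (x i)))"
  by (intro past_determinedI arg_cong[where f=F] sum.cong) auto

lemma past_determined_comb:
  "past_determined n h1 \<Longrightarrow> past_determined n h2 \<Longrightarrow> past_determined n (\<lambda>x. F (h1 x) (h2 x))"
  unfolding past_determined_def by metis

lemma past_determined_suffix: "k + l \<le> n \<Longrightarrow> past_determined n (\<lambda>x. F (\<Sum>i=Suc k..k + l. G (x i)))"
  by (intro past_determinedI arg_cong[where f=F] sum.cong) auto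

end

section \<open>Weak convergence through characteristic functions\<close>

lemma iexp_diff_le: "cmod (iexp x - iexp y) \<le> \<bar>x - y\<bar>"
proof -
  have "iexp x - iexp y = iexp y * (iexp (x - y) - 1)"
    by (simp add: algebra_simps exp_add[symmetric])
  then have "cmod (iexp x - iexp y) = cmod (iexp (x - y) - 1)" by (simp add: norm_mult)
  also have "\<dots> \<le> \<bar>x - y\<bar>" using iexp_approx1[of "x - y" 0] by simp
  finally show ?thesis .
qed

text \<open>
  Levy's continuity theorem, phrased for random variables.
\<close>

lemma (in prob_space) weak_conv_by_expectation_iexp:
  assumes "\<And>n. Z n \<in> borel_measurable M" "real_distribution \<mu>"
    and "\<And>\<theta>. (\<lambda>n. expectation (\<lambda>\<omega>. iexp (\<theta> * Z n \<omega>))) \<longlonglongrightarrow> char \<mu> \<theta>"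
  shows "weak_conv_m (\<lambda>n. distr M borel (Z n)) \<mu>"
proof (rule levy_continuity)
  show "real_distribution (distr M borel (Z n))" for n
    using assms(1) by (intro real_distribution_distr) auto
  show "(\<lambda>n. char (distr M borel (Z n)) \<theta>) \<longlonglongrightarrow> char \<mu> \<theta>" for \<theta>
    using assms(3)[of \<theta>] unfolding char_def by (subst integral_distr) (auto simp: assms(1))
qed (rule assms(2))

text \<open>
  The degenerate law has characteristic function \<open>1\<close>, so one formula covers all variances.
\<close>

lemma char_normal_law:
  assumes "v \<ge> 0"
  shows "char (normal_law 0 v) t = exp (- (v * t\<^sup>2) / 2)"
proof (cases "v = 0")
  case True
  have "char (return borel (0::real)) t = 1"
    unfolding char_def by (subst integral_return) auto
  then show ?thesis using True by (simp add: normal_law_def)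
next
  case False
  then have v: "v > 0" using assms by simp
  have sq: "sqrt v > 0" using v by simp
  have "char (normal_law 0 v) t = (CLINT x|lborel. normal_density 0 (sqrt v) x *\<^sub>R iexp (t * x))"
    unfolding char_def normal_law_def using False
    by (simp add: integral_density normal_density_nonneg)
  also have "\<dots> = \<bar>sqrt v\<bar> *\<^sub>R (CLINT x|lborel. normal_density 0 (sqrt v) (0 + sqrt v * x) *\<^sub>R iexp (t * (0 + sqrt v * x)))"
    by (rule lborel_integral_real_affine) (use v in auto)
  also have "\<dots> = (CLINT x|lborel. std_normal_density x *\<^sub>R iexp (sqrt v * t * x))"
  proof -
    have "sqrt v * normal_density 0 (sqrt v) (sqrt v * x) = std_normal_density x" for x
      using v by (simp add: normal_density_def real_sqrt_mult power_mult_distrib)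
    then have "\<bar>sqrt v\<bar> *\<^sub>R (normal_density 0 (sqrt v) (0 + sqrt v * x) *\<^sub>R iexp (t * (0 + sqrt v * x)))
        = std_normal_density x *\<^sub>R iexp (sqrt v * t * x)" for x
      using v by (simp add: algebra_simps)
    then show ?thesis by (subst integral_scaleR_right[symmetric]) (simp only:)
  qed
  also have "\<dots> = char std_normal_distribution (sqrt v * t)"
    unfolding char_def by (simp add: integral_density normal_density_nonneg)
  also have "\<dots> = exp (- (v * t\<^sup>2) / 2)"
    using v by (simp add: char_std_normal_distribution power_mult_distrib)
  finally show ?thesis .
qed

lemma real_distribution_normal_law:
  assumes "v \<ge> 0"
  shows "real_distribution (normal_law 0 v)"
proof (cases "v = 0")
  case True
  then show ?thesis unfolding normal_law_def real_distribution_def real_distribution_axioms_def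
    by (auto intro!: prob_space_return)
next
  case False
  then have "prob_space (density lborel (normal_density 0 (sqrt v)))"
    using assms by (intro prob_space_normal_density) auto
  then show ?thesis using False unfolding normal_law_def real_distribution_def real_distribution_axioms_def
    by auto
qed

section \<open>Central limit theorem for additive functionals of a finite chain\<close>

text \<open>
  Second-order Taylor expansion in \<open>\<epsilon>\<close> of the tilt \<open>iexp (\<epsilon> * f)\<close> times the corrected function
  \<open>1 + \<i> * \<epsilon> * g - \<epsilon>\<^sup>2 * h\<close>, at a single state.
\<close>

lemma iexp_mult_corrector_expansion:
  fixes f g h :: real
  shows "\<exists>C\<ge>0. \<forall>\<epsilon>::real. \<bar>\<epsilon>\<bar> \<le> 1 \<longrightarrow>
    cmod (iexp (\<epsilon> * f) * (1 + \<i> * \<epsilon> * g - \<epsilon>\<^sup>2 * h)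
        - (1 + \<i> * \<epsilon> * (f + g) - \<epsilon>\<^sup>2 * (f\<^sup>2 / 2 + f * g + h))) \<le> C * \<bar>\<epsilon>\<bar> ^ 3"
proof -
  define C where "C = \<bar>f\<bar> ^ 3 * (1 + \<bar>g\<bar> + \<bar>h\<bar>) + (\<bar>f\<bar> * \<bar>h\<bar> + f\<^sup>2 * \<bar>g\<bar> + f\<^sup>2 * \<bar>h\<bar>)"
  show ?thesis
  proof (intro exI[of _ C] conjI allI impI)
    show "C \<ge> 0" unfolding C_def by (intro add_nonneg_nonneg mult_nonneg_nonneg) auto
    fix \<epsilon> :: real assume e: "\<bar>\<epsilon>\<bar> \<le> 1"
    define T :: complex where "T = 1 + \<i> * \<epsilon> * f - \<epsilon>\<^sup>2 * f\<^sup>2 / 2"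
    define \<psi> :: complex where "\<psi> = 1 + \<i> * \<epsilon> * g - \<epsilon>\<^sup>2 * h"
    have e2: "\<bar>\<epsilon>\<bar>\<^sup>2 \<le> 1" using e by (simp add: abs_square_le_1)
    have T: "cmod (iexp (\<epsilon> * f) - T) \<le> (\<bar>\<epsilon>\<bar> * \<bar>f\<bar>) ^ 3"
    proof -
      have "cmod (iexp (\<epsilon> * f) - (\<Sum>k\<le>2. (\<i> * (\<epsilon> * f))^k / fact k)) \<le> \<bar>\<epsilon> * f\<bar> ^ Suc 2 / fact (Suc 2)"
        using iexp_approx1[of "\<epsilon> * f" 2] by simp
      also have "(\<Sum>k\<le>2. (\<i> * (\<epsilon> * f))^k / fact k) = T"
        unfolding T_def by (simp add: numeral_2_eq_2 power2_eq_square algebra_simps)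
      also have "\<bar>\<epsilon> * f\<bar> ^ Suc 2 / fact (Suc 2) \<le> (\<bar>\<epsilon>\<bar> * \<bar>f\<bar>) ^ 3"
        by (simp add: abs_mult fact_numeral eval_nat_numeral)
      finally show ?thesis .
    qed
    have \<psi>: "cmod \<psi> \<le> 1 + \<bar>g\<bar> + \<bar>h\<bar>"
    proof -
      have "cmod \<psi> \<le> 1 + \<bar>\<epsilon>\<bar> * \<bar>g\<bar> + \<bar>\<epsilon>\<bar>\<^sup>2 * \<bar>h\<bar>"
        unfolding \<psi>_def by (rule order_trans[OF norm_triangle_ineq4] add_mono order_trans[OF norm_triangle_ineq])+
           (auto simp: norm_mult norm_power)
      also have "\<dots> \<le> 1 + 1 * \<bar>g\<bar> + 1 * \<bar>h\<bar>"
        using e e2 by (intro add_mono mult_right_mono) auto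
      finally show ?thesis by simp
    qed
    have rem: "T * \<psi> - (1 + \<i> * \<epsilon> * (f + g) - \<epsilon>\<^sup>2 * (f\<^sup>2 / 2 + f * g + h))
        = of_real (\<epsilon>^3) * (- (\<i> * (f * h)) - \<i> * (f\<^sup>2 * g / 2) + \<epsilon> * (f\<^sup>2 * h / 2))"
      unfolding T_def \<psi>_def by (simp add: algebra_simps power2_eq_square power3_eq_cube)
    have rem_le: "cmod (- (\<i> * (f * h)) - \<i> * (f\<^sup>2 * g / 2) + \<epsilon> * (f\<^sup>2 * h / 2))
        \<le> \<bar>f\<bar> * \<bar>h\<bar> + f\<^sup>2 * \<bar>g\<bar> + f\<^sup>2 * \<bar>h\<bar>"
    proof -
      have "cmod (- (\<i> * (f * h)) - \<i> * (f\<^sup>2 * g / 2) + \<epsilon> * (f\<^sup>2 * h / 2))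
         \<le> cmod (- (\<i> * (f * h))) + cmod (\<i> * (f\<^sup>2 * g / 2)) + cmod (\<epsilon> * (f\<^sup>2 * h / 2))"
        by (rule order_trans[OF norm_triangle_ineq] add_mono norm_triangle_ineq4 order_refl)+
      also have "\<dots> = \<bar>f\<bar> * \<bar>h\<bar> + f\<^sup>2 * \<bar>g\<bar> / 2 + \<bar>\<epsilon>\<bar> * (f\<^sup>2 * \<bar>h\<bar> / 2)"
        by (simp add: norm_mult norm_divide norm_power)
      also have "\<dots> \<le> \<bar>f\<bar> * \<bar>h\<bar> + f\<^sup>2 * \<bar>g\<bar> + 1 * (f\<^sup>2 * \<bar>h\<bar>)"
        using e by (intro add_mono mult_mono) auto
      finally show ?thesis by simp
    qed
    have "cmod (iexp (\<epsilon> * f) * \<psi> - (1 + \<i> * \<epsilon> * (f + g) - \<epsilon>\<^sup>2 * (f\<^sup>2 / 2 + f * g + h)))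
       = cmod ((iexp (\<epsilon> * f) - T) * \<psi> + of_real (\<epsilon>^3) * (- (\<i> * (f * h)) - \<i> * (f\<^sup>2 * g / 2) + \<epsilon> * (f\<^sup>2 * h / 2)))"
      unfolding rem[symmetric] by (simp add: algebra_simps)
    also have "\<dots> \<le> (\<bar>\<epsilon>\<bar> * \<bar>f\<bar>) ^ 3 * (1 + \<bar>g\<bar> + \<bar>h\<bar>) + \<bar>\<epsilon>\<bar>^3 * (\<bar>f\<bar> * \<bar>h\<bar> + f\<^sup>2 * \<bar>g\<bar> + f\<^sup>2 * \<bar>h\<bar>)"
    proof (rule norm_triangle_le, rule add_mono)
      show "cmod ((iexp (\<epsilon> * f) - T) * \<psi>) \<le> (\<bar>\<epsilon>\<bar> * \<bar>f\<bar>) ^ 3 * (1 + \<bar>g\<bar> + \<bar>h\<bar>)"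
        unfolding norm_mult by (intro mult_mono T \<psi>) auto
      show "cmod (of_real (\<epsilon>^3) * (- (\<i> * (f * h)) - \<i> * (f\<^sup>2 * g / 2) + \<epsilon> * (f\<^sup>2 * h / 2)))
         \<le> \<bar>\<epsilon>\<bar>^3 * (\<bar>f\<bar> * \<bar>h\<bar> + f\<^sup>2 * \<bar>g\<bar> + f\<^sup>2 * \<bar>h\<bar>)"
        unfolding norm_mult norm_of_real power_abs by (intro mult_left_mono rem_le) auto
    qed
    also have "\<dots> = C * \<bar>\<epsilon>\<bar> ^ 3" unfolding C_def by (simp add: algebra_simps)
    finally show "cmod (iexp (\<epsilon> * f) * (1 + \<i> * \<epsilon> * g - \<epsilon>\<^sup>2 * h)
        - (1 + \<i> * \<epsilon> * (f + g) - \<epsilon>\<^sup>2 * (f\<^sup>2 / 2 + f * g + h))) \<le> C * \<bar>\<epsilon>\<bar> ^ 3"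
      unfolding \<psi>_def by simp
  qed
qed

text \<open>
  The transition operator tilted by \<open>iexp (\<epsilon> * f)\<close> is a perturbation of \<open>P\<close>, whose eigenvalue \<open>1\<close>
  belongs to constants. The two Poisson equations for \<open>g\<close> and \<open>h\<close> cancel the terms of order \<open>\<epsilon>\<close> and
  \<open>\<epsilon>\<^sup>2\<close>, so \<open>\<psi> \<epsilon>\<close> is an eigenfunction up to order \<open>\<epsilon>^3\<close>, with eigenvalue
  \<open>1 - s * \<epsilon>\<^sup>2 / 2\<close>; the number \<open>s\<close> is the asymptotic variance.
\<close>

lemma perturbed_eigenfunction:
  fixes P :: "'s \<Rightarrow> 's \<Rightarrow> real" and f g h :: "'s \<Rightarrow> real" and s :: real
    and \<psi> :: "real \<Rightarrow> 's \<Rightarrow> complex"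
  assumes fin: "finite (UNIV :: 's set)"
    and P: "\<And>x y. P x y \<ge> 0" "\<And>x. (\<Sum>y\<in>UNIV. P x y) = 1"
    and g: "\<And>x. (\<Sum>y\<in>UNIV. P x y * (f y + g y)) = g x"
    and h: "\<And>x. (\<Sum>y\<in>UNIV. P x y * ((f y)\<^sup>2 / 2 + f y * g y + h y)) = h x + s / 2"
    and \<psi>: "\<And>\<epsilon> y. \<psi> \<epsilon> y = 1 + \<i> * \<epsilon> * g y - \<epsilon>\<^sup>2 * h y"
  shows "\<exists>C\<ge>0. \<forall>\<epsilon> x. \<bar>\<epsilon>\<bar> \<le> 1 \<longrightarrow>
    cmod ((\<Sum>y\<in>UNIV. P x y *\<^sub>R (iexp (\<epsilon> * f y) * \<psi> \<epsilon> y)) - (1 - s * \<epsilon>\<^sup>2 / 2) * \<psi> \<epsilon> x) \<le> C * \<bar>\<epsilon>\<bar> ^ 3"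
proof -
  have "\<forall>y. \<exists>C\<ge>0. \<forall>\<epsilon>. \<bar>\<epsilon>\<bar> \<le> 1 \<longrightarrow>
      cmod (iexp (\<epsilon> * f y) * \<psi> \<epsilon> y
        - (1 + \<i> * \<epsilon> * (f y + g y) - \<epsilon>\<^sup>2 * ((f y)\<^sup>2 / 2 + f y * g y + h y))) \<le> C * \<bar>\<epsilon>\<bar> ^ 3"
    unfolding \<psi> by (intro allI iexp_mult_corrector_expansion)
  then obtain K where K: "\<And>y. K y \<ge> 0" "\<And>y \<epsilon>. \<bar>\<epsilon>\<bar> \<le> 1 \<Longrightarrow>
      cmod (iexp (\<epsilon> * f y) * \<psi> \<epsilon> y
        - (1 + \<i> * \<epsilon> * (f y + g y) - \<epsilon>\<^sup>2 * ((f y)\<^sup>2 / 2 + f y * g y + h y))) \<le> K y * \<bar>\<epsilon>\<bar> ^ 3"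
    by metis
  define L where "L x = \<bar>s\<bar> * (\<bar>g x\<bar> + \<bar>h x\<bar>)" for x
  define C where "C = (\<Sum>y\<in>UNIV. K y) + (\<Sum>x\<in>UNIV. L x)"
  have L: "L x \<ge> 0" for x unfolding L_def by auto
  show ?thesis
  proof (intro exI[of _ C] conjI allI impI)
    show "C \<ge> 0" unfolding C_def using K L by (auto intro!: add_nonneg_nonneg sum_nonneg)
    fix \<epsilon> :: real and x :: 's assume e: "\<bar>\<epsilon>\<bar> \<le> 1"
    define m :: "'s \<Rightarrow> complex" where
      "m y = 1 + \<i> * \<epsilon> * (f y + g y) - \<epsilon>\<^sup>2 * ((f y)\<^sup>2 / 2 + f y * g y + h y)" for y
    have "(\<Sum>y\<in>UNIV. P x y *\<^sub>R m y) = of_real (\<Sum>y\<in>UNIV. P x y)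
        + \<i> * \<epsilon> * of_real (\<Sum>y\<in>UNIV. P x y * (f y + g y))
        - \<epsilon>\<^sup>2 * of_real (\<Sum>y\<in>UNIV. P x y * ((f y)\<^sup>2 / 2 + f y * g y + h y))"
      unfolding m_def scaleR_conv_of_real of_real_sum sum_distrib_left
      by (simp add: sum.distrib[symmetric] sum_subtractf[symmetric] algebra_simps)
    also have "\<dots> = 1 + \<i> * \<epsilon> * g x - \<epsilon>\<^sup>2 * (h x + s / 2)"
      unfolding P g h by simp
    finally have m: "(\<Sum>y\<in>UNIV. P x y *\<^sub>R m y) = 1 + \<i> * \<epsilon> * g x - \<epsilon>\<^sup>2 * (h x + s / 2)" .
    have main: "(\<Sum>y\<in>UNIV. P x y *\<^sub>R (iexp (\<epsilon> * f y) * \<psi> \<epsilon> y)) - (1 - s * \<epsilon>\<^sup>2 / 2) * \<psi> \<epsilon> x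
       = (\<Sum>y\<in>UNIV. P x y *\<^sub>R (iexp (\<epsilon> * f y) * \<psi> \<epsilon> y - m y))
         + of_real (\<epsilon> ^ 3) * (\<i> * (s * g x / 2) - \<epsilon> * (s * h x / 2))"
      unfolding scaleR_diff_right sum_subtractf m
      by (simp add: \<psi> algebra_simps power2_eq_square power3_eq_cube)
    have "cmod (\<Sum>y\<in>UNIV. P x y *\<^sub>R (iexp (\<epsilon> * f y) * \<psi> \<epsilon> y - m y)) \<le> (\<Sum>y\<in>UNIV. K y * \<bar>\<epsilon>\<bar> ^ 3)"
    proof (rule order_trans[OF norm_sum], rule sum_mono)
      fix y
      have "P x y \<le> 1" using P member_le_sum[of y UNIV "P x"] fin by auto
      then show "cmod (P x y *\<^sub>R (iexp (\<epsilon> * f y) * \<psi> \<epsilon> y - m y)) \<le> K y * \<bar>\<epsilon>\<bar> ^ 3"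
        using mult_mono[OF _ K(2)[OF e, of y], of "P x y" 1] P(1)[of x y] unfolding m_def by simp
    qed
    moreover have "cmod (of_real (\<epsilon> ^ 3) * (\<i> * (s * g x / 2) - \<epsilon> * (s * h x / 2))) \<le> \<bar>\<epsilon>\<bar> ^ 3 * L x"
      unfolding norm_mult norm_of_real power_abs
    proof (rule mult_left_mono)
      have "cmod (\<i> * (s * g x / 2) - \<epsilon> * (s * h x / 2)) \<le> cmod (\<i> * (s * g x / 2)) + cmod (\<epsilon> * (s * h x / 2))"
        by (rule norm_triangle_ineq4)
      also have "\<dots> = \<bar>s\<bar> * \<bar>g x\<bar> / 2 + \<bar>\<epsilon>\<bar> * (\<bar>s\<bar> * \<bar>h x\<bar> / 2)"
        by (simp add: norm_mult norm_divide)
      also have "\<dots> \<le> \<bar>s\<bar> * \<bar>g x\<bar> + 1 * (\<bar>s\<bar> * \<bar>h x\<bar>)"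
        using e by (intro add_mono mult_mono) auto
      finally show "cmod (\<i> * (s * g x / 2) - \<epsilon> * (s * h x / 2)) \<le> L x"
        unfolding L_def by (simp add: algebra_simps)
    qed auto
    moreover have "L x \<le> (\<Sum>x\<in>UNIV. L x)" using L fin by (intro member_le_sum) auto
    then have "\<bar>\<epsilon>\<bar> ^ 3 * L x \<le> \<bar>\<epsilon>\<bar> ^ 3 * (\<Sum>x\<in>UNIV. L x)" by (intro mult_left_mono) auto
    ultimately have "cmod ((\<Sum>y\<in>UNIV. P x y *\<^sub>R (iexp (\<epsilon> * f y) * \<psi> \<epsilon> y)) - (1 - s * \<epsilon>\<^sup>2 / 2) * \<psi> \<epsilon> x)
        \<le> (\<Sum>y\<in>UNIV. K y * \<bar>\<epsilon>\<bar> ^ 3) + \<bar>\<epsilon>\<bar> ^ 3 * (\<Sum>x\<in>UNIV. L x)"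
      unfolding main by (intro norm_triangle_le) linarith
    also have "\<dots> = C * \<bar>\<epsilon>\<bar> ^ 3" unfolding C_def by (simp add: sum_distrib_left sum_distrib_right algebra_simps)
    finally show "cmod ((\<Sum>y\<in>UNIV. P x y *\<^sub>R (iexp (\<epsilon> * f y) * \<psi> \<epsilon> y)) - (1 - s * \<epsilon>\<^sup>2 / 2) * \<psi> \<epsilon> x) \<le> C * \<bar>\<epsilon>\<bar> ^ 3" .
  qed
qed

context finite_markov_chain begin

text \<open>
  Weighting with \<open>\<psi> \<epsilon> (X n)\<close> turns the characteristic function of the additive functional into an
  approximate geometric sequence in \<open>n\<close>. With \<open>\<epsilon> = \<theta> / sqrt n\<close> the \<open>n\<close> errors of order \<open>\<epsilon>^3\<close> add up to
  order \<open>1 / sqrt n\<close>, and the weight itself tends to \<open>1\<close>.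
\<close>

lemma markov_chain_clt:
  fixes f g h :: "'s \<Rightarrow> real" and s \<theta> :: real
  assumes P: "\<And>x y. P x y \<ge> 0" "\<And>x. (\<Sum>y\<in>UNIV. P x y) = 1"
    and g: "\<And>x. (\<Sum>y\<in>UNIV. P x y * (f y + g y)) = g x"
    and h: "\<And>x. (\<Sum>y\<in>UNIV. P x y * ((f y)\<^sup>2 / 2 + f y * g y + h y)) = h x + s / 2"
    and s: "s \<ge> 0"
  shows "(\<lambda>n. expectation (\<lambda>\<omega>. iexp (\<theta> * ((\<Sum>i=1..n. f (X i \<omega>)) / sqrt (real n)))))
     \<longlonglongrightarrow> exp (- (s * \<theta>\<^sup>2) / 2)"
proof -
  define \<psi> :: "real \<Rightarrow> 's \<Rightarrow> complex" where "\<psi> \<epsilon> y = 1 + \<i> * \<epsilon> * g y - \<epsilon>\<^sup>2 * h y" for \<epsilon> y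
  define S where "S n x = (\<Sum>i=1..n. f (x i))" for n :: nat and x :: "nat \<Rightarrow> 's"
  obtain C where C: "C \<ge> 0" "\<And>\<epsilon> x. \<bar>\<epsilon>\<bar> \<le> 1 \<Longrightarrow>
      cmod ((\<Sum>y\<in>UNIV. P x y *\<^sub>R (iexp (\<epsilon> * f y) * \<psi> \<epsilon> y)) - (1 - s * \<epsilon>\<^sup>2 / 2) * \<psi> \<epsilon> x) \<le> C * \<bar>\<epsilon>\<bar> ^ 3"
    using perturbed_eigenfunction[OF finite_states P g h \<psi>_def] by auto
  define K where "K = (\<Sum>x\<in>UNIV. \<bar>g x\<bar> + \<bar>h x\<bar>)"
  have \<psi>1: "cmod (\<psi> \<epsilon> x - 1) \<le> K * \<bar>\<epsilon>\<bar>" if e: "\<bar>\<epsilon>\<bar> \<le> 1" for \<epsilon> x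
  proof -
    have "cmod (\<psi> \<epsilon> x - 1) = cmod (\<i> * \<epsilon> * g x - \<epsilon>\<^sup>2 * h x)" unfolding \<psi>_def by simp
    also have "\<dots> \<le> cmod (\<i> * \<epsilon> * g x) + cmod (\<epsilon>\<^sup>2 * h x)" by (rule norm_triangle_ineq4)
    also have "\<dots> = \<bar>\<epsilon>\<bar> * (\<bar>g x\<bar> + \<bar>\<epsilon>\<bar> * \<bar>h x\<bar>)"
      by (simp add: norm_mult norm_power power2_eq_square algebra_simps)
    also have "\<dots> \<le> \<bar>\<epsilon>\<bar> * (\<bar>g x\<bar> + 1 * \<bar>h x\<bar>)"
      using e by (intro mult_left_mono add_mono mult_right_mono) auto
    also have "\<dots> \<le> \<bar>\<epsilon>\<bar> * K"
      unfolding K_def using member_le_sum[of x UNIV "\<lambda>x. \<bar>g x\<bar> + \<bar>h x\<bar>"] finite_states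
      by (intro mult_left_mono) auto
    finally show ?thesis by (simp add: mult.commute)
  qed
  have pdS: "past_determined n (\<lambda>x. F (S n x) (x n))" for n and F :: "real \<Rightarrow> 's \<Rightarrow> complex"
    unfolding S_def by (intro past_determinedI arg_cong2[where f=F] sum.cong) auto
  have int: "integrable M (\<lambda>\<omega>. F (S n (trajectory \<omega>)) (X n \<omega>))" for n and F :: "real \<Rightarrow> 's \<Rightarrow> complex"
    by (rule past_determined_integrable[OF pdS])
  define e where "e \<epsilon> n = expectation (\<lambda>\<omega>. iexp (\<epsilon> * S n (trajectory \<omega>)) * \<psi> \<epsilon> (X n \<omega>))" for \<epsilon> n
  have norm_iexp_mult: "cmod (iexp r * z) = cmod z" for r z by (simp add: norm_mult)
  have step: "cmod (e \<epsilon> (Suc n) - (1 - s * \<epsilon>\<^sup>2 / 2) * e \<epsilon> n) \<le> C * \<bar>\<epsilon>\<bar> ^ 3" if ep: "\<bar>\<epsilon>\<bar> \<le> 1" for \<epsilon> n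
  proof -
    define Q where "Q x = (\<Sum>y\<in>UNIV. P x y *\<^sub>R (iexp (\<epsilon> * f y) * \<psi> \<epsilon> y))" for x
    have "e \<epsilon> (Suc n) = expectation (\<lambda>\<omega>. iexp (\<epsilon> * S n (trajectory \<omega>)) * (iexp (\<epsilon> * f (X (Suc n) \<omega>)) * \<psi> \<epsilon> (X (Suc n) \<omega>)))"
      unfolding e_def S_def
      by (intro Bochner_Integration.integral_cong refl) (simp add: distrib_left exp_add mult.assoc)
    also have "\<dots> = expectation (\<lambda>\<omega>. iexp (\<epsilon> * S n (trajectory \<omega>)) * Q (X n \<omega>))"
      unfolding Q_def by (rule expectation_markov_step[OF pdS])
    finally have "e \<epsilon> (Suc n) - (1 - s * \<epsilon>\<^sup>2 / 2) * e \<epsilon> n =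
        expectation (\<lambda>\<omega>. iexp (\<epsilon> * S n (trajectory \<omega>)) * Q (X n \<omega>)) -
        expectation (\<lambda>\<omega>. (1 - s * \<epsilon>\<^sup>2 / 2) * (iexp (\<epsilon> * S n (trajectory \<omega>)) * \<psi> \<epsilon> (X n \<omega>)))"
      unfolding e_def by simp
    also have "\<dots> = expectation (\<lambda>\<omega>. iexp (\<epsilon> * S n (trajectory \<omega>)) * Q (X n \<omega>) -
        (1 - s * \<epsilon>\<^sup>2 / 2) * (iexp (\<epsilon> * S n (trajectory \<omega>)) * \<psi> \<epsilon> (X n \<omega>)))"
      by (intro Bochner_Integration.integral_diff[symmetric] integrable_mult_right int[of "\<lambda>a b. iexp (\<epsilon> * a) * Q b"]
            int[of "\<lambda>a b. iexp (\<epsilon> * a) * \<psi> \<epsilon> b"])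
    also have "cmod \<dots> \<le> C * \<bar>\<epsilon>\<bar> ^ 3"
    proof (rule norm_expectation_le)
      show "integrable M (\<lambda>\<omega>. iexp (\<epsilon> * S n (trajectory \<omega>)) * Q (X n \<omega>) -
        (1 - s * \<epsilon>\<^sup>2 / 2) * (iexp (\<epsilon> * S n (trajectory \<omega>)) * \<psi> \<epsilon> (X n \<omega>)))"
        by (intro Bochner_Integration.integrable_diff integrable_mult_right int[of "\<lambda>a b. iexp (\<epsilon> * a) * Q b"]
            int[of "\<lambda>a b. iexp (\<epsilon> * a) * \<psi> \<epsilon> b"])
      fix \<omega>
      have "iexp (\<epsilon> * S n (trajectory \<omega>)) * Q (X n \<omega>) -
        (1 - s * \<epsilon>\<^sup>2 / 2) * (iexp (\<epsilon> * S n (trajectory \<omega>)) * \<psi> \<epsilon> (X n \<omega>))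
        = iexp (\<epsilon> * S n (trajectory \<omega>)) * (Q (X n \<omega>) - (1 - s * \<epsilon>\<^sup>2 / 2) * \<psi> \<epsilon> (X n \<omega>))"
        by (simp add: algebra_simps)
      then show "cmod (iexp (\<epsilon> * S n (trajectory \<omega>)) * Q (X n \<omega>) -
        (1 - s * \<epsilon>\<^sup>2 / 2) * (iexp (\<epsilon> * S n (trajectory \<omega>)) * \<psi> \<epsilon> (X n \<omega>))) \<le> C * \<bar>\<epsilon>\<bar> ^ 3"
        using C(2)[OF ep, of "X n \<omega>"] unfolding Q_def by (simp only: norm_iexp_mult)
    qed
    finally show ?thesis .
  qed
  have iter: "cmod (e \<epsilon> n - of_real (1 - s * \<epsilon>\<^sup>2 / 2) ^ n * e \<epsilon> 0) \<le> real n * (C * \<bar>\<epsilon>\<bar> ^ 3)"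
    if ep: "\<bar>\<epsilon>\<bar> \<le> 1" "s * \<epsilon>\<^sup>2 \<le> 2" for \<epsilon> n
  proof (induction n)
    case (Suc n)
    define l where "l = 1 - s * \<epsilon>\<^sup>2 / 2"
    have l: "\<bar>l\<bar> \<le> 1" unfolding l_def using ep s by auto
    have "e \<epsilon> (Suc n) - of_real l ^ Suc n * e \<epsilon> 0 =
        (e \<epsilon> (Suc n) - of_real l * e \<epsilon> n) + of_real l * (e \<epsilon> n - of_real l ^ n * e \<epsilon> 0)"
      by (simp add: algebra_simps)
    also have "cmod \<dots> \<le> C * \<bar>\<epsilon>\<bar> ^ 3 + 1 * (real n * (C * \<bar>\<epsilon>\<bar> ^ 3))"
    proof (intro norm_triangle_le add_mono)
      show "cmod (e \<epsilon> (Suc n) - of_real l * e \<epsilon> n) \<le> C * \<bar>\<epsilon>\<bar> ^ 3"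
        using step[OF ep(1), of n] unfolding l_def by simp
      show "cmod (of_real l * (e \<epsilon> n - of_real l ^ n * e \<epsilon> 0)) \<le> 1 * (real n * (C * \<bar>\<epsilon>\<bar> ^ 3))"
        using Suc l unfolding l_def[symmetric] norm_mult norm_of_real by (intro mult_mono) auto
    qed
    finally show ?case unfolding l_def by (simp add: algebra_simps)
  qed simp
  define \<epsilon> where "\<epsilon> n = \<theta> / sqrt (real n)" for n :: nat
  have \<epsilon>0: "\<epsilon> \<longlonglongrightarrow> 0" unfolding \<epsilon>_def
    by (intro real_tendsto_divide_at_top[OF tendsto_const] filterlim_compose[OF sqrt_at_top filterlim_real_sequentially])
  have n_eps2: "real n * (\<epsilon> n)\<^sup>2 = \<theta>\<^sup>2" if "n > 0" for n
    using that unfolding \<epsilon>_def by (simp add: power_divide)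
  define u where "u n = expectation (\<lambda>\<omega>. iexp (\<theta> * ((\<Sum>i=1..n. f (X i \<omega>)) / sqrt (real n))))" for n
  have u: "u n = expectation (\<lambda>\<omega>. iexp (\<epsilon> n * S n (trajectory \<omega>)))" for n
    unfolding u_def \<epsilon>_def S_def by simp
  have close: "cmod (expectation (\<lambda>\<omega>. iexp (d * S n (trajectory \<omega>))) - e d n) \<le> K * \<bar>d\<bar>" if "\<bar>d\<bar> \<le> 1" for d n
  proof -
    have "expectation (\<lambda>\<omega>. iexp (d * S n (trajectory \<omega>))) - e d n
       = expectation (\<lambda>\<omega>. iexp (d * S n (trajectory \<omega>)) - iexp (d * S n (trajectory \<omega>)) * \<psi> d (X n \<omega>))"
      unfolding e_def
      by (intro Bochner_Integration.integral_diff[symmetric] int[of "\<lambda>a b. iexp (d * a)"]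
            int[of "\<lambda>a b. iexp (d * a) * \<psi> d b"])
    also have "cmod \<dots> \<le> K * \<bar>d\<bar>"
    proof (rule norm_expectation_le)
      show "integrable M (\<lambda>\<omega>. iexp (d * S n (trajectory \<omega>)) - iexp (d * S n (trajectory \<omega>)) * \<psi> d (X n \<omega>))"
        by (intro Bochner_Integration.integrable_diff int[of "\<lambda>a b. iexp (d * a)"]
            int[of "\<lambda>a b. iexp (d * a) * \<psi> d b"])
      fix \<omega>
      have "iexp (d * S n (trajectory \<omega>)) - iexp (d * S n (trajectory \<omega>)) * \<psi> d (X n \<omega>)
         = iexp (d * S n (trajectory \<omega>)) * (1 - \<psi> d (X n \<omega>))" by (simp add: algebra_simps)
      then show "cmod (iexp (d * S n (trajectory \<omega>)) - iexp (d * S n (trajectory \<omega>)) * \<psi> d (X n \<omega>)) \<le> K * \<bar>d\<bar>"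
        using \<psi>1[OF that, of "X n \<omega>"] by (simp only: norm_iexp_mult norm_minus_commute)
    qed
    finally show ?thesis .
  qed
  have e0: "cmod (e d 0 - 1) \<le> K * \<bar>d\<bar>" if "\<bar>d\<bar> \<le> 1" for d
    using close[OF that, of 0] unfolding S_def by (simp add: prob_space norm_minus_commute)
  have bound: "cmod (u n - of_real ((1 - s * (\<epsilon> n)\<^sup>2 / 2) ^ n))
      \<le> 2 * K * \<bar>\<epsilon> n\<bar> + C * \<theta>\<^sup>2 * \<bar>\<epsilon> n\<bar>" if d: "\<bar>\<epsilon> n\<bar> \<le> 1" "s * (\<epsilon> n)\<^sup>2 \<le> 2" "n > 0" for n
  proof -
    define l where "l = complex_of_real (1 - s * (\<epsilon> n)\<^sup>2 / 2) ^ n"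
    have "\<bar>1 - s * (\<epsilon> n)\<^sup>2 / 2\<bar> \<le> 1" using d s by auto
    then have l: "cmod l \<le> 1" unfolding l_def norm_power norm_of_real by (intro power_le_one) auto
    have "u n - l = (u n - e (\<epsilon> n) n) + (e (\<epsilon> n) n - l * e (\<epsilon> n) 0) + l * (e (\<epsilon> n) 0 - 1)"
      by (simp add: algebra_simps)
    also have "cmod \<dots> \<le> K * \<bar>\<epsilon> n\<bar> + real n * (C * \<bar>\<epsilon> n\<bar> ^ 3) + 1 * (K * \<bar>\<epsilon> n\<bar>)"
    proof (intro norm_triangle_le add_mono)
      show "cmod (u n - e (\<epsilon> n) n) \<le> K * \<bar>\<epsilon> n\<bar>" unfolding u by (rule close[OF d(1)])
      show "cmod (e (\<epsilon> n) n - l * e (\<epsilon> n) 0) \<le> real n * (C * \<bar>\<epsilon> n\<bar> ^ 3)"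
        unfolding l_def by (rule iter[OF d(1,2)])
      show "cmod (l * (e (\<epsilon> n) 0 - 1)) \<le> 1 * (K * \<bar>\<epsilon> n\<bar>)"
        unfolding norm_mult by (intro mult_mono l e0[OF d(1)]) auto
    qed
    also have "real n * (C * \<bar>\<epsilon> n\<bar> ^ 3) = C * (real n * (\<epsilon> n)\<^sup>2) * \<bar>\<epsilon> n\<bar>"
      by (simp add: power3_eq_cube power2_eq_square)
    finally show ?thesis unfolding n_eps2[OF d(3)] l_def by simp
  qed
  have "(\<lambda>n. 2 * K * \<bar>\<epsilon> n\<bar> + C * \<theta>\<^sup>2 * \<bar>\<epsilon> n\<bar>) \<longlonglongrightarrow> 2 * K * \<bar>0\<bar> + C * \<theta>\<^sup>2 * \<bar>0\<bar>"
    by (intro tendsto_intros \<epsilon>0)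
  then have lim0: "(\<lambda>n. 2 * K * \<bar>\<epsilon> n\<bar> + C * \<theta>\<^sup>2 * \<bar>\<epsilon> n\<bar>) \<longlonglongrightarrow> 0" by simp
  have lim_eps: "(\<lambda>n. s * (\<epsilon> n)\<^sup>2) \<longlonglongrightarrow> s * 0\<^sup>2" "(\<lambda>n. \<bar>\<epsilon> n\<bar>) \<longlonglongrightarrow> \<bar>0\<bar>"
    by (intro tendsto_intros \<epsilon>0)+
  have ev: "\<forall>\<^sub>F n in sequentially. s * (\<epsilon> n)\<^sup>2 < 2" "\<forall>\<^sub>F n in sequentially. \<bar>\<epsilon> n\<bar> < 1"
    by (rule order_tendstoD(2)[OF lim_eps(1)] order_tendstoD(2)[OF lim_eps(2)], simp)+
  have "(\<lambda>n. u n - of_real ((1 - s * (\<epsilon> n)\<^sup>2 / 2) ^ n)) \<longlonglongrightarrow> 0"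
    by (rule Lim_null_comparison[OF _ lim0])
       (use ev eventually_gt_at_top[of 0] in eventually_elim, intro bound; simp)
  moreover have "(\<lambda>n. complex_of_real ((1 - s * (\<epsilon> n)\<^sup>2 / 2) ^ n)) \<longlonglongrightarrow> of_real (exp (- (s * \<theta>\<^sup>2) / 2))"
  proof (rule tendsto_of_real, rule Lim_transform_eventually)
    show "(\<lambda>n. (1 + (- (s * \<theta>\<^sup>2) / 2) / real n) ^ n) \<longlonglongrightarrow> exp (- (s * \<theta>\<^sup>2) / 2)"
      by (rule tendsto_exp_limit_sequentially)
    show "\<forall>\<^sub>F n in sequentially. (1 + (- (s * \<theta>\<^sup>2) / 2) / real n) ^ n = (1 - s * (\<epsilon> n)\<^sup>2 / 2) ^ n"
      using eventually_gt_at_top[of 0]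
      by eventually_elim (simp add: \<epsilon>_def power_divide mult.commute)
  qed
  ultimately have "(\<lambda>n. (u n - of_real ((1 - s * (\<epsilon> n)\<^sup>2 / 2) ^ n)) + of_real ((1 - s * (\<epsilon> n)\<^sup>2 / 2) ^ n))
     \<longlonglongrightarrow> 0 + complex_of_real (exp (- (s * \<theta>\<^sup>2) / 2))" by (rule tendsto_add)
  then show ?thesis unfolding u_def by simp
qed

end

section \<open>Exponential moments of sums with negative drift\<close>

lemma geometric_partial_sum_le: "0 \<le> r \<Longrightarrow> r < 1 \<Longrightarrow> (\<Sum>k\<le>n. r ^ k) \<le> 1 / (1 - r)" for r :: real
  using sum_le_suminf[of "\<lambda>k. r ^ k" "{..n}"] suminf_geometric[of r] summable_geometric[of r] by auto

text \<open>
  A chain that moves down in its frequent state and up in its rare one, with \<open>a\<close> the probability to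
  leave the frequent state. To first order in \<open>\<eta>\<close> the two inequalities for \<open>\<psi> = 1 + \<eta> * D\<close> read
  \<open>a * D < 1 - 2 * a\<close> and \<open>b * D > 1 - 2 * b\<close>. Such a \<open>D\<close> exists because \<open>a < b\<close> means that the
  stationary drift is negative, and a small \<open>\<eta>\<close> then gives \<open>r < 1\<close>.
\<close>

lemma exponential_lyapunov_two_state:
  fixes a b :: real
  assumes a: "0 \<le> a" "a < b" "b \<le> 1"
  shows "\<exists>\<eta> \<psi> r. 0 < \<eta> \<and> 0 < \<psi> \<and> 0 \<le> r \<and> r < 1 \<and>
    (1 - a) * exp (- \<eta>) + a * exp \<eta> * \<psi> \<le> r \<and>
    b * exp (- \<eta>) + (1 - b) * exp \<eta> * \<psi> \<le> r * \<psi>"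
proof -
  \<comment> \<open>This choice lies between \<open>1 / b - 2\<close> and \<open>1 / a - 2\<close>, the bounds imposed on \<open>D\<close> when \<open>a > 0\<close>.\<close>
  define D where "D = 2 / (a + b) - 2"
  have D1: "a * D < 1 - 2 * a" and D2: "b * D > 1 - 2 * b" and D3: "D > -1"
    using a unfolding D_def by (auto simp: field_simps)
  define F1 where "F1 \<eta> = (1 - a) * exp (- \<eta>) + a * exp \<eta> * (1 + \<eta> * D) - 1" for \<eta>
  define F2 where "F2 \<eta> = b * exp (- \<eta>) + (1 - b) * exp \<eta> * (1 + \<eta> * D) - (1 + \<eta> * D)" for \<eta>
  have dF1: "DERIV F1 0 :> - (1 - a) + a * D + a"
    unfolding F1_def by (auto intro!: derivative_eq_intros)
  have nF1: "- (1 - a) + a * D + a < 0" using D1 by (simp add: algebra_simps)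
  obtain d1 where d1: "d1 > 0" "\<And>\<eta>. 0 < \<eta> \<Longrightarrow> \<eta> < d1 \<Longrightarrow> F1 \<eta> < F1 0"
    using DERIV_neg_dec_right[OF dF1 nF1] by auto
  have dF2: "DERIV F2 0 :> - b + (1 - b) * (1 + D) - D"
    unfolding F2_def by (auto intro!: derivative_eq_intros simp: algebra_simps)
  have nF2: "- b + (1 - b) * (1 + D) - D < 0" using D2 by (simp add: algebra_simps)
  obtain d2 where d2: "d2 > 0" "\<And>\<eta>. 0 < \<eta> \<Longrightarrow> \<eta> < d2 \<Longrightarrow> F2 \<eta> < F2 0"
    using DERIV_neg_dec_right[OF dF2 nF2] by auto
  define \<eta> where "\<eta> = min 1 (min d1 d2) / 2"
  have \<eta>: "0 < \<eta>" "\<eta> < d1" "\<eta> < d2" "\<eta> < 1" unfolding \<eta>_def using d1(1) d2(1) by auto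
  define \<psi> where "\<psi> = 1 + \<eta> * D"
  have \<psi>: "\<psi> > 0"
  proof -
    have "\<eta> * (- D) \<le> \<eta> * 1" using \<eta> D3 by (intro mult_left_mono) auto
    then have "\<eta> * (- D) < 1" using \<eta> by linarith
    then show ?thesis unfolding \<psi>_def by simp
  qed
  define r1 where "r1 = (1 - a) * exp (- \<eta>) + a * exp \<eta> * \<psi>"
  define r2 where "r2 = (b * exp (- \<eta>) + (1 - b) * exp \<eta> * \<psi>) / \<psi>"
  have r1: "r1 < 1" using d1(2)[OF \<eta>(1,2)] unfolding r1_def F1_def \<psi>_def by simp
  have r2: "r2 < 1" using d2(2)[OF \<eta>(1,3)] \<psi> unfolding r2_def F2_def \<psi>_def by simp
  have r0: "r1 \<ge> 0" unfolding r1_def using a \<psi> by (intro add_nonneg_nonneg mult_nonneg_nonneg) auto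
  show ?thesis
  proof (intro exI conjI)
    show "0 < \<eta>" "0 < \<psi>" "0 \<le> max r1 r2" "max r1 r2 < 1" using \<eta> \<psi> r0 r1 r2 by auto
    show "(1 - a) * exp (- \<eta>) + a * exp \<eta> * \<psi> \<le> max r1 r2" unfolding r1_def[symmetric] by simp
    have "b * exp (- \<eta>) + (1 - b) * exp \<eta> * \<psi> = r2 * \<psi>" unfolding r2_def using \<psi> by simp
    also have "\<dots> \<le> max r1 r2 * \<psi>" using \<psi> by (intro mult_right_mono) auto
    finally show "b * exp (- \<eta>) + (1 - b) * exp \<eta> * \<psi> \<le> max r1 r2 * \<psi>" .
  qed
qed

context finite_markov_chain begin

text \<open>
  The function \<open>\<psi>\<close> is a supersolution for the operator tilted by \<open>exp z\<close>, so each further step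
  contracts the \<open>\<psi>\<close>-weighted exponential moment by the factor \<open>r\<close>. The bound is uniform in the
  starting time \<open>k\<close>.
\<close>

lemma exponential_moment_decay:
  fixes z \<psi> :: "'s \<Rightarrow> real" and r :: real
  assumes \<psi>: "\<And>x. \<psi> x > 0" and r: "r \<ge> 0"
    and lyap: "\<And>x. (\<Sum>y\<in>UNIV. P x y * (exp (z y) * \<psi> y)) \<le> r * \<psi> x"
  shows "\<exists>C\<ge>0. \<forall>k l. expectation (\<lambda>\<omega>. exp (\<Sum>i=Suc k..k + l. z (X i \<omega>))) \<le> C * r ^ l"
proof -
  define S where "S k l x = (\<Sum>i=Suc k..k + l. z (x i))" for k l :: nat and x :: "nat \<Rightarrow> 's"
  have pd: "past_determined (k + l) (\<lambda>x. F (S k l x) (x (k + l)))" for k l and F :: "real \<Rightarrow> 's \<Rightarrow> real"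
    unfolding S_def by (intro past_determinedI arg_cong2[where f=F] sum.cong) auto
  have int: "integrable M (\<lambda>\<omega>. F (S k l (trajectory \<omega>)) (X (k + l) \<omega>))" for k l and F :: "real \<Rightarrow> 's \<Rightarrow> real"
    by (rule past_determined_integrable[OF pd])
  define m where "m = Min (\<psi> ` UNIV)"
  define U where "U = Max (\<psi> ` UNIV)"
  have m: "m \<le> \<psi> x" "\<psi> x \<le> U" for x unfolding m_def U_def using finite_states by auto
  have m0: "m > 0" unfolding m_def using finite_states \<psi> by (subst Min_gr_iff) auto
  define e where "e k l = expectation (\<lambda>\<omega>. exp (S k l (trajectory \<omega>)) * \<psi> (X (k + l) \<omega>))" for k l
  have step: "e k (Suc l) \<le> r * e k l" for k l
  proof -
    define Q where "Q x = (\<Sum>y\<in>UNIV. P x y *\<^sub>R (exp (z y) * \<psi> y))" for x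
    have "e k (Suc l) = expectation (\<lambda>\<omega>. exp (S k l (trajectory \<omega>)) * (exp (z (X (Suc (k + l)) \<omega>)) * \<psi> (X (Suc (k + l)) \<omega>)))"
      unfolding e_def S_def
      by (intro Bochner_Integration.integral_cong refl) (simp add: exp_add mult.assoc)
    also have "\<dots> = expectation (\<lambda>\<omega>. exp (S k l (trajectory \<omega>)) * Q (X (k + l) \<omega>))"
      unfolding Q_def by (rule expectation_markov_step[OF pd])
    also have "\<dots> \<le> expectation (\<lambda>\<omega>. r * (exp (S k l (trajectory \<omega>)) * \<psi> (X (k + l) \<omega>)))"
    proof (intro integral_mono int[of "\<lambda>a b. exp a * Q b"] int[of "\<lambda>a b. r * (exp a * \<psi> b)"])
      fix \<omega>
      have "Q (X (k + l) \<omega>) \<le> r * \<psi> (X (k + l) \<omega>)" unfolding Q_def using lyap by simp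
      then show "exp (S k l (trajectory \<omega>)) * Q (X (k + l) \<omega>) \<le> r * (exp (S k l (trajectory \<omega>)) * \<psi> (X (k + l) \<omega>))"
        using mult_left_mono[of "Q (X (k + l) \<omega>)" "r * \<psi> (X (k + l) \<omega>)" "exp (S k l (trajectory \<omega>))"]
        by (simp add: algebra_simps)
    qed
    also have "\<dots> = r * e k l" unfolding e_def by simp
    finally show ?thesis .
  qed
  have e0: "e k 0 \<le> U" for k
    unfolding e_def by (intro integral_le_const int[of "\<lambda>a b. exp a * \<psi> b"]) (simp add: S_def m)
  have el: "e k l \<le> r ^ l * U" for k l
  proof (induction l)
    case (Suc l)
    have "e k (Suc l) \<le> r * (r ^ l * U)" using step[of k l] mult_left_mono[OF Suc r] by linarith
    then show ?case by (simp add: mult.assoc)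
  qed (use e0 in simp)
  have "expectation (\<lambda>\<omega>. exp (S k l (trajectory \<omega>))) \<le> U / m * r ^ l" for k l
  proof -
    have "m * expectation (\<lambda>\<omega>. exp (S k l (trajectory \<omega>))) = expectation (\<lambda>\<omega>. m * exp (S k l (trajectory \<omega>)))" by simp
    also have "\<dots> \<le> e k l" unfolding e_def
      by (intro integral_mono int[of "\<lambda>a b. m * exp a"] int[of "\<lambda>a b. exp a * \<psi> b"]) (simp add: m mult.commute mult_left_mono)
    also have "\<dots> \<le> r ^ l * U" by (rule el)
    finally show ?thesis using m0 by (simp add: field_simps)
  qed
  moreover have "U / m \<ge> 0" using m0 m[of undefined] by auto
  ultimately show ?thesis unfolding S_def by blast
qed

end

section \<open>The two-state chain with a majority letter\<close>

lemma sum_UNIV_letter: "(\<Sum>y\<in>UNIV. F y) = F Alpha1 + F Alpha2" for F :: "letter \<Rightarrow> 'b::comm_monoid_add"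
  unfolding UNIV_letter by simp

locale two_state_chain = finite_markov_chain M X "two_state_trans a b"
  for M :: "'w measure" and X :: "nat \<Rightarrow> 'w \<Rightarrow> letter" and a b :: real +
  assumes a01: "a \<in> {0..1}" and b01: "b \<in> {0..1}"
begin

lemma two_state_trans_stochastic:
  "two_state_trans a b x y \<ge> 0" "(\<Sum>y\<in>UNIV. two_state_trans a b x y) = 1"
  using a01 b01 by (cases x; cases y; simp add: sum_UNIV_letter) (cases x; simp add: sum_UNIV_letter)

text \<open>
  The centred indicator \<open>f\<close> is an eigenfunction of the transition matrix with eigenvalue
  \<open>1 - a - b\<close>, and \<open>f\<^sup>2\<close> is affine in \<open>f\<close>. Both correctors of \<open>markov_chain_clt\<close> are therefore multiples
  of \<open>f\<close>: their factors \<open>c\<close> and \<open>d\<close> solve scalar equations.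
\<close>

lemma occupation_clt:
  assumes ab: "a + b > 0"
  shows "(\<lambda>n. expectation (\<lambda>\<omega>. iexp (\<theta> * ((\<Sum>i=1..n. (if X i \<omega> = Alpha1 then 1 else 0) - b / (a + b)) / sqrt (real n)))))
     \<longlonglongrightarrow> exp (- (a * b * (2 - a - b) / (a + b) ^ 3 * \<theta>\<^sup>2) / 2)"
proof -
  define N where "N = a + b"
  define p where "p = a / N"
  define q where "q = b / N"
  have N: "N > 0" using ab unfolding N_def .
  have a: "a = N * p" and b: "b = N * q" unfolding p_def q_def using N by auto
  have "N * (p + q) = N" using a b unfolding N_def by (simp add: algebra_simps)
  then have "p + q = 1" using N by (metis mult_cancel_left2 less_irrefl)
  then have pq: "q = 1 - p" by simp
  define f where "f y = (if y = Alpha1 then 1 else 0) - q" for y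
  have f: "f Alpha1 = p" "f Alpha2 = p - 1" unfolding f_def by (simp_all add: pq)
  define c where "c = (1 - N) / N"
  define d where "d = c * (1 / 2 + c) * (p - q)"
  have Nc: "N * c = 1 - N" unfolding c_def using N by simp
  have cN: "(1 + c) * (1 - N) = c" using Nc by (simp add: algebra_simps)
  have Pf: "(\<Sum>y\<in>UNIV. two_state_trans a b x y * f y) = (1 - N) * f x" for x
    unfolding sum_UNIV_letter by (cases x; simp add: f a b pq algebra_simps)
  have s: "a * b * (2 - a - b) / (a + b) ^ 3 = (1 + 2 * c) * (p * q)"
  proof -
    have "a * b * (2 - a - b) / (a + b) ^ 3 = (N * p) * (N * q) * (2 - N) / N ^ 3"
    proof -
      have e: "a + b = N" "2 - a - b = 2 - N" unfolding N_def by simp_all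
      show ?thesis unfolding e a[symmetric] b[symmetric] ..
    qed
    also have "\<dots> = (1 + 2 * c) * (p * q)"
      unfolding c_def using N by (simp add: field_simps power3_eq_cube)
    finally show ?thesis .
  qed
  have "(\<lambda>n. expectation (\<lambda>\<omega>. iexp (\<theta> * ((\<Sum>i=1..n. f (X i \<omega>)) / sqrt (real n)))))
     \<longlonglongrightarrow> exp (- ((1 + 2 * c) * (p * q) * \<theta>\<^sup>2) / 2)"
  proof (rule markov_chain_clt[OF two_state_trans_stochastic])
    show "(\<Sum>y\<in>UNIV. two_state_trans a b x y * (f y + c * f y)) = c * f x" for x
    proof -
      have "f y + c * f y = (1 + c) * f y" for y by (simp add: algebra_simps)
      then have "(\<Sum>y\<in>UNIV. two_state_trans a b x y * (f y + c * f y)) = (1 + c) * (\<Sum>y\<in>UNIV. two_state_trans a b x y * f y)"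
        by (simp add: sum_distrib_left mult.left_commute)
      also have "\<dots> = ((1 + c) * (1 - N)) * f x" unfolding Pf by simp
      finally show ?thesis unfolding cN .
    qed
    show "(\<Sum>y\<in>UNIV. two_state_trans a b x y * ((f y)\<^sup>2 / 2 + f y * (c * f y) + d * f y))
        = d * f x + (1 + 2 * c) * (p * q) / 2" for x
    proof -
      have f2: "(f y)\<^sup>2 = p * q + (p - q) * f y" for y
        by (cases y) (simp_all add: f pq power2_eq_square algebra_simps)
      have "(f y)\<^sup>2 / 2 + f y * (c * f y) + d * f y = (1 / 2 + c) * (f y)\<^sup>2 + d * f y" for y
        by (simp add: power2_eq_square algebra_simps)
      moreover have "(1 / 2 + c) * (f y)\<^sup>2 + d * f y = (1 / 2 + c) * (p * q) + ((1 / 2 + c) * (p - q) * (1 + c)) * f y" for y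
        unfolding f2 d_def by (simp add: field_simps)
      ultimately have "(\<Sum>y\<in>UNIV. two_state_trans a b x y * ((f y)\<^sup>2 / 2 + f y * (c * f y) + d * f y))
         = (\<Sum>y\<in>UNIV. two_state_trans a b x y * ((1 / 2 + c) * (p * q)))
           + (\<Sum>y\<in>UNIV. two_state_trans a b x y * (((1 / 2 + c) * (p - q) * (1 + c)) * f y))"
        by (simp only: distrib_left sum.distrib)
      also have "(\<Sum>y\<in>UNIV. two_state_trans a b x y * ((1 / 2 + c) * (p * q))) = (1 / 2 + c) * (p * q)"
        using two_state_trans_stochastic(2)[of x] by (simp add: sum_distrib_right[symmetric])
      also have "(\<Sum>y\<in>UNIV. two_state_trans a b x y * (((1 / 2 + c) * (p - q) * (1 + c)) * f y))
         = ((1 / 2 + c) * (p - q) * (1 + c)) * (\<Sum>y\<in>UNIV. two_state_trans a b x y * f y)"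
        by (simp only: sum_distrib_left mult.left_commute)
      also have "\<dots> = (1 / 2 + c) * (p - q) * ((1 + c) * (1 - N)) * f x" unfolding Pf by simp
      also have "\<dots> = d * f x" unfolding cN d_def by (simp only: mult_ac)
      finally show ?thesis by (simp add: algebra_simps)
    qed
    show "0 \<le> (1 + 2 * c) * (p * q)"
      unfolding s[symmetric] using a01 b01 ab by (intro divide_nonneg_pos mult_nonneg_nonneg) auto
  qed
  then show ?thesis unfolding s f_def q_def N_def by simp
qed

end

context two_state_chain begin

lemma past_determined_LI: "past_determined n (\<lambda>x. F (LI x n))"
  by (intro past_determinedI arg_cong[where f=F] LI_cong) auto

text \<open>
  If \<open>Alpha1\<close> is the majority letter (\<open>a < b\<close>), replacing a suffix of the word by its \<open>Alpha2\<close>s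
  changes the count by a sum with negative drift; if \<open>Alpha2\<close> is, the same holds for a prefix and
  \<open>Alpha1\<close>. The exponential moments of these sums decay geometrically in their length, and summing the
  geometric series bounds the expected gain of the best cut.
\<close>

lemma LI_minus_majority_count:
  assumes "a \<noteq> b"
  defines "m \<equiv> (if a < b then Alpha1 else Alpha2)"
  shows "\<exists>K. \<forall>n. expectation (\<lambda>\<omega>. real (LI (trajectory \<omega>) n) - (\<Sum>i=1..n. if X i \<omega> = m then 1 else 0)) \<le> K"
    and "\<And>x n. real (LI x n) - (\<Sum>i=1..n. if x i = m then 1 else 0) \<ge> 0"
proof -
  \<comment> \<open>The two cases differ only in whether the sum attached to the cut \<open>k\<close> starts after \<open>w k n = k\<close> and
    has \<open>n - k\<close> terms, or starts after \<open>0\<close> and has \<open>k\<close> terms.\<close>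
  define w where "w k n = (if a < b then k else 0)" for k n :: nat
  define l where "l k n = (if a < b then n - k else k)" for k n :: nat
  define z where "z s = (if s = m then -1 else 1 :: real)" for s
  define t where "t x n k = (\<Sum>i=Suc (w k n)..w k n + l k n. z (x i))" for x n k
  have z: "z s = (if a < b then - letter_sign s else letter_sign s)" for s
    unfolding z_def m_def letter_sign_def by (cases s) auto
  have sc: "real (split_count x n k) = (\<Sum>i=1..n. if x i = m then 1 else 0) + t x n k" if "k \<le> n" for x n k
    using split_count_eq_count1[OF that, of x] split_count_eq_count2[OF that, of x]
    unfolding t_def z w_def l_def m_def by (cases "a < b") simp_all
  have t0: "\<exists>k\<le>n. t x n k = 0" for x n
    unfolding t_def w_def l_def by (cases "a < b") (auto intro: exI[of _ n] exI[of _ 0])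
  show "real (LI x n) - (\<Sum>i=1..n. if x i = m then 1 else 0) \<ge> 0" for x n
    using LI_le_exponential_sum(1)[of 1 n x, OF _ sc t0] by simp
  have "\<exists>\<eta> \<psi> r. 0 < \<eta> \<and> 0 < \<psi> \<and> 0 \<le> r \<and> r < 1 \<and>
    (1 - min a b) * exp (- \<eta>) + min a b * exp \<eta> * \<psi> \<le> r \<and>
    max a b * exp (- \<eta>) + (1 - max a b) * exp \<eta> * \<psi> \<le> r * \<psi>"
    using assms(1) a01 b01 by (intro exponential_lyapunov_two_state) auto
  then obtain \<eta> \<psi> r where \<eta>: "0 < \<eta>" and \<psi>: "0 < \<psi>" and r: "0 \<le> r" "r < 1"
    and L1: "(1 - min a b) * exp (- \<eta>) + min a b * exp \<eta> * \<psi> \<le> r"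
    and L2: "max a b * exp (- \<eta>) + (1 - max a b) * exp \<eta> * \<psi> \<le> r * \<psi>" by blast
  have "\<exists>C\<ge>0. \<forall>k l. expectation (\<lambda>\<omega>. exp (\<Sum>i=Suc k..k + l. \<eta> * z (X i \<omega>))) \<le> C * r ^ l"
  proof (rule exponential_moment_decay[where \<psi> = "\<lambda>s. if s = m then 1 else \<psi>"])
    show "(\<Sum>y\<in>UNIV. two_state_trans a b x y * (exp (\<eta> * z y) * (if y = m then 1 else \<psi>)))
         \<le> r * (if x = m then 1 else \<psi>)" for x
      using L1 L2 assms(1) unfolding sum_UNIV_letter z_def m_def
      by (cases x; cases "a < b") (simp_all add: algebra_simps)
  qed (use \<psi> r in auto)
  then obtain C where C: "C \<ge> 0"
    "\<And>k l. expectation (\<lambda>\<omega>. exp (\<Sum>i=Suc k..k + l. \<eta> * z (X i \<omega>))) \<le> C * r ^ l" by blast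
  have "expectation (\<lambda>\<omega>. real (LI (trajectory \<omega>) n) - (\<Sum>i=1..n. if X i \<omega> = m then 1 else 0)) \<le> C * (1 / (1 - r)) / \<eta>" for n
  proof -
    have wl: "k \<le> n \<Longrightarrow> w k n + l k n \<le> n" for k unfolding w_def l_def by auto
    have int: "integrable M (\<lambda>\<omega>. exp (\<eta> * t (trajectory \<omega>) n k))" if "k \<le> n" for k
      unfolding t_def by (rule past_determined_integrable[OF past_determined_suffix[OF wl[OF that]]])
    have "expectation (\<lambda>\<omega>. real (LI (trajectory \<omega>) n) - (\<Sum>i=1..n. if X i \<omega> = m then 1 else 0))
       \<le> expectation (\<lambda>\<omega>. (\<Sum>k\<le>n. exp (\<eta> * t (trajectory \<omega>) n k)) / \<eta>)"
    proof (rule integral_mono)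
      show "integrable M (\<lambda>\<omega>. real (LI (trajectory \<omega>) n) - (\<Sum>i=1..n. if X i \<omega> = m then 1 else 0))"
        by (rule past_determined_integrable[OF past_determined_comb[OF past_determined_LI past_determined_sum,
              where F="\<lambda>a b. a - b"]])
      show "integrable M (\<lambda>\<omega>. (\<Sum>k\<le>n. exp (\<eta> * t (trajectory \<omega>) n k)) / \<eta>)"
        using int by (intro integrable_divide Bochner_Integration.integrable_sum) auto
    qed (use LI_le_exponential_sum(2)[OF \<eta> sc t0] in auto)
    also have "\<dots> = (\<Sum>k\<le>n. expectation (\<lambda>\<omega>. exp (\<eta> * t (trajectory \<omega>) n k))) / \<eta>"
      using int by (simp add: Bochner_Integration.integral_sum)
    also have "\<dots> \<le> (\<Sum>k\<le>n. C * r ^ l k n) / \<eta>"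
      using \<eta> C(2) unfolding t_def sum_distrib_left by (intro divide_right_mono sum_mono) auto
    also have "(\<Sum>k\<le>n. C * r ^ l k n) = C * (\<Sum>k\<le>n. r ^ k)"
    proof (cases "a < b")
      case True
      have "(\<Sum>k\<le>n. C * r ^ (n - k)) = (\<Sum>k\<le>n. C * r ^ k)"
        using sum.nat_diff_reindex[of "\<lambda>k. C * r ^ k" "Suc n"] by (simp add: lessThan_Suc_atMost)
      then show ?thesis using True unfolding l_def by (simp add: sum_distrib_left)
    qed (simp add: l_def sum_distrib_left)
    also have "C * (\<Sum>k\<le>n. r ^ k) / \<eta> \<le> C * (1 / (1 - r)) / \<eta>"
      using \<eta> C(1) r by (intro divide_right_mono mult_left_mono geometric_partial_sum_le) auto
    finally show ?thesis .
  qed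
  then show "\<exists>K. \<forall>n. expectation (\<lambda>\<omega>. real (LI (trajectory \<omega>) n) - (\<Sum>i=1..n. if X i \<omega> = m then 1 else 0)) \<le> K"
    by blast
qed

end

context two_state_chain begin

text \<open>
  The bounded expected remainder changes characteristic functions by \<open>O(1 / sqrt n)\<close>, so \<open>LI\<close> inherits
  the central limit theorem of the majority count.
\<close>

lemma LI_asymmetric_limit:
  assumes ab: "a \<noteq> b"
  shows "weak_conv_m
          (\<lambda>n. distr M borel
            (\<lambda>\<omega>. (real (LI (\<lambda>i. X i \<omega>) n)
                    - real n * max (invariant_dist a b Alpha1) (invariant_dist a b Alpha2))
                  / sqrt (real n)))
          (normal_law 0 (sigma_tilde_sq a b / 4))"
proof -
  define m where "m = (if a < b then Alpha1 else Alpha2)"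
  define \<pi> where "\<pi> = max (invariant_dist a b Alpha1) (invariant_dist a b Alpha2)"
  define v where "v = a * b * (2 - a - b) / (a + b) ^ 3"
  have ab0: "a + b > 0" using a01 b01 ab by auto
  have v: "sigma_tilde_sq a b / 4 = v" unfolding sigma_tilde_sq_def v_def using ab by auto
  have v0: "v \<ge> 0" unfolding v_def using a01 b01 ab0 by (intro divide_nonneg_pos mult_nonneg_nonneg) auto
  have \<pi>: "\<pi> = (if a < b then b / (a + b) else a / (a + b))"
    unfolding \<pi>_def using ab ab0 divide_strict_right_mono[of a b "a + b"] divide_strict_right_mono[of b a "a + b"]
    by (cases a b rule: linorder_cases) (simp_all add: max_def)
  define N where "N n x = (\<Sum>i=1..n. (if x i = m then 1 else 0) - \<pi>)" for n and x :: "nat \<Rightarrow> letter"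
  define R where "R n x = real (LI x n) - (\<Sum>i=1..n. if x i = m then 1 else 0)" for n and x :: "nat \<Rightarrow> letter"
  have LI: "real (LI x n) - real n * \<pi> = N n x + R n x" for n x
    unfolding N_def R_def by (simp add: sum_subtractf)
  obtain K where K: "\<And>n. expectation (\<lambda>\<omega>. R n (trajectory \<omega>)) \<le> K"
    using LI_minus_majority_count(1)[OF ab] unfolding R_def m_def by blast
  have R0: "R n x \<ge> 0" for n x using LI_minus_majority_count(2)[OF ab] unfolding R_def m_def by blast
  have pdN: "past_determined n (\<lambda>x. F (N n x))" for n and F :: "real \<Rightarrow> 'c"
    unfolding N_def by (rule past_determined_sum)
  have pdR: "past_determined n (\<lambda>x. F (R n x))" for n and F :: "real \<Rightarrow> 'c"
    unfolding R_def by (intro past_determinedI arg_cong[where f=F] arg_cong2[where f="(-)"] arg_cong[where f=real] LI_cong sum.cong) auto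
  define Z where "Z n x = (real (LI x n) - real n * \<pi>) / sqrt (real n)" for n and x :: "nat \<Rightarrow> letter"
  have meas: "(\<lambda>\<omega>. Z n (trajectory \<omega>)) \<in> borel_measurable M" for n
    unfolding Z_def by (rule past_determined_measurable[OF past_determined_LI])
  have clt: "(\<lambda>n. expectation (\<lambda>\<omega>. iexp (\<theta> * (N n (trajectory \<omega>) / sqrt (real n))))) \<longlonglongrightarrow> exp (- (v * \<theta>\<^sup>2) / 2)" for \<theta>
  proof (cases "a < b")
    case True
    then show ?thesis using occupation_clt[OF ab0, of \<theta>] unfolding N_def \<pi> m_def v_def by simp
  next
    case False
    \<comment> \<open>When \<open>Alpha2\<close> is the majority letter its centred count is the negative of that of \<open>Alpha1\<close>,
      and the Gaussian limit is symmetric.\<close>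
    have *: "(if s = m then 1 else 0) - \<pi> = - ((if s = Alpha1 then 1 else 0) - b / (a + b))" for s
      unfolding \<pi> m_def using False ab0 by (cases s) (auto simp: field_simps)
    have "\<theta> * (N n x / sqrt (real n)) = (- \<theta>) * ((\<Sum>i=1..n. (if x i = Alpha1 then 1 else 0) - b / (a + b)) / sqrt (real n))" for n x
      unfolding N_def * sum_negf by simp
    then show ?thesis using occupation_clt[OF ab0, of "- \<theta>"] unfolding v_def by simp
  qed
  have main: "(\<lambda>n. expectation (\<lambda>\<omega>. iexp (\<theta> * Z n (trajectory \<omega>)))) \<longlonglongrightarrow> exp (- (v * \<theta>\<^sup>2) / 2)" for \<theta>
  proof -
    define u where "u n = expectation (\<lambda>\<omega>. iexp (\<theta> * Z n (trajectory \<omega>)))" for n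
    define u' where "u' n = expectation (\<lambda>\<omega>. iexp (\<theta> * (N n (trajectory \<omega>) / sqrt (real n))))" for n
    have diff: "cmod (u n - u' n) \<le> \<bar>\<theta>\<bar> * K / sqrt (real n)" for n
    proof -
      have i1: "integrable M (\<lambda>\<omega>. iexp (\<theta> * Z n (trajectory \<omega>)))"
        unfolding Z_def by (rule past_determined_integrable[OF past_determined_LI])
      have i2: "integrable M (\<lambda>\<omega>. iexp (\<theta> * (N n (trajectory \<omega>) / sqrt (real n))))"
        by (rule past_determined_integrable[OF pdN])
      have "cmod (u n - u' n) = cmod (expectation (\<lambda>\<omega>. iexp (\<theta> * Z n (trajectory \<omega>)) - iexp (\<theta> * (N n (trajectory \<omega>) / sqrt (real n)))))"
        unfolding u_def u'_def using i1 i2 by simp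
      also have "\<dots> \<le> expectation (\<lambda>\<omega>. cmod (iexp (\<theta> * Z n (trajectory \<omega>)) - iexp (\<theta> * (N n (trajectory \<omega>) / sqrt (real n)))))"
        by (rule integral_norm_bound)
      also have "\<dots> \<le> expectation (\<lambda>\<omega>. \<bar>\<theta>\<bar> / sqrt (real n) * R n (trajectory \<omega>))"
      proof (rule integral_mono)
        show "integrable M (\<lambda>\<omega>. cmod (iexp (\<theta> * Z n (trajectory \<omega>)) - iexp (\<theta> * (N n (trajectory \<omega>) / sqrt (real n)))))"
          using i1 i2 by (intro integrable_norm Bochner_Integration.integrable_diff)
        show "integrable M (\<lambda>\<omega>. \<bar>\<theta>\<bar> / sqrt (real n) * R n (trajectory \<omega>))"
          by (rule past_determined_integrable[OF pdR])
        fix \<omega>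
        have "\<theta> * Z n (trajectory \<omega>) - \<theta> * (N n (trajectory \<omega>) / sqrt (real n)) = \<theta> / sqrt (real n) * R n (trajectory \<omega>)"
          unfolding Z_def LI by (simp add: field_simps add_divide_distrib)
        then show "cmod (iexp (\<theta> * Z n (trajectory \<omega>)) - iexp (\<theta> * (N n (trajectory \<omega>) / sqrt (real n))))
           \<le> \<bar>\<theta>\<bar> / sqrt (real n) * R n (trajectory \<omega>)"
          using iexp_diff_le[of "\<theta> * Z n (trajectory \<omega>)" "\<theta> * (N n (trajectory \<omega>) / sqrt (real n))"] R0[of n "trajectory \<omega>"]
          by (simp only: abs_mult abs_divide) simp
      qed
      also have "\<dots> = \<bar>\<theta>\<bar> / sqrt (real n) * expectation (\<lambda>\<omega>. R n (trajectory \<omega>))" by simp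
      also have "\<dots> \<le> \<bar>\<theta>\<bar> / sqrt (real n) * K" by (intro mult_left_mono K) auto
      finally show ?thesis by simp
    qed
    have "(\<lambda>n. \<bar>\<theta>\<bar> * K / sqrt (real n)) \<longlonglongrightarrow> 0"
      by (intro real_tendsto_divide_at_top[OF tendsto_const] filterlim_compose[OF sqrt_at_top filterlim_real_sequentially])
    then have "(\<lambda>n. u n - u' n) \<longlonglongrightarrow> 0"
      by (rule Lim_null_comparison[OF always_eventually[OF allI[OF diff]]])
    from tendsto_add[OF this clt[of \<theta>, folded u'_def]] show ?thesis unfolding u_def by simp
  qed
  show ?thesis
    unfolding v \<pi>_def[symmetric] Z_def[of _ "trajectory _", symmetric]
    by (rule weak_conv_by_expectation_iexp[OF meas real_distribution_normal_law[OF v0]])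
       (simp only: main char_normal_law[OF v0])
qed

text \<open>
  With \<open>a = b = 0\<close> the transition matrix is the identity and its corrector equations degenerate, but
  the chain never leaves \<open>Alpha1\<close> and \<open>LI\<close> equals \<open>n\<close> almost surely.
\<close>

lemma LI_frozen_limit:
  assumes ab: "a = 0" "b = 0" and init: "\<P>(\<omega> in M. X 0 \<omega> = Alpha1) = 1"
  shows "weak_conv_m
          (\<lambda>n. distr M borel (\<lambda>\<omega>. (real (LI (\<lambda>i. X i \<omega>) n) - real n) / sqrt (real n)))
          (normal_law 0 0)"
proof -
  have "AE \<omega> in M. X i \<omega> = Alpha1" for i
  proof (induction i)
    case 0
    show ?case using init by (subst prob_Collect_eq_1[symmetric]) auto
  next
    case (Suc i)
    let ?I = "\<lambda>x. if x = Alpha1 then 0 else 1 :: real"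
    have pd1: "past_determined (Suc i) (\<lambda>x. ?I (x (Suc i)))" and pd0: "past_determined i (\<lambda>x. ?I (x i))"
      and pdc: "past_determined i (\<lambda>x. 1::real)"
      by (auto simp: past_determined_def)
    have "expectation (\<lambda>\<omega>. ?I (X (Suc i) \<omega>)) = expectation (\<lambda>\<omega>. ?I (X i \<omega>))"
      using expectation_markov_step[OF pdc, of ?I] unfolding sum_UNIV_letter ab
      by (simp, intro Bochner_Integration.integral_cong refl) (metis (full_types) letter.exhaust two_state_trans.simps(2,4) diff_zero)
    also have "\<dots> = expectation (\<lambda>\<omega>. 0)"
      using Suc past_determined_measurable[OF pd0] by (intro integral_cong_AE) auto
    finally have "expectation (\<lambda>\<omega>. ?I (X (Suc i) \<omega>)) = 0" by simp
    then have "AE \<omega> in M. ?I (X (Suc i) \<omega>) = 0"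
      using integral_nonneg_eq_0_iff_AE[OF past_determined_integrable[OF pd1]] by simp
    then show ?case by eventually_elim (auto split: if_splits)
  qed
  then have "AE \<omega> in M. \<forall>i. X i \<omega> = Alpha1" by (subst AE_all_countable) auto
  moreover have "LI x n = n" if "\<And>i. x i = Alpha1" for x n
  proof -
    have "split_count x n k = k" if "k \<le> n" for k
    proof -
      have "{i \<in> {1..k}. x i = Alpha1} = {1..k}" "{i \<in> {Suc k..n}. x i = Alpha2} = {}"
        using \<open>\<And>i. x i = Alpha1\<close> by auto
      then show ?thesis unfolding split_count_def by simp
    qed
    then have "split_count x n ` {..n} = {..n}" by auto
    then show ?thesis unfolding LI_eq_Max_split_count by (intro Max_eqI) auto
  qed
  ultimately have ae: "AE \<omega> in M. (real (LI (\<lambda>i. X i \<omega>) n) - real n) / sqrt (real n) = 0" for n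
    by (auto elim!: eventually_mono)
  have meas: "(\<lambda>\<omega>. (real (LI (\<lambda>i. X i \<omega>) n) - real n) / sqrt (real n)) \<in> borel_measurable M" for n
    by (rule past_determined_measurable[OF past_determined_LI])
  show ?thesis
  proof (rule weak_conv_by_expectation_iexp[OF meas real_distribution_normal_law])
    show "(\<lambda>n. expectation (\<lambda>\<omega>. iexp (\<theta> * ((real (LI (\<lambda>i. X i \<omega>) n) - real n) / sqrt (real n)))))
       \<longlonglongrightarrow> char (normal_law 0 0) \<theta>" for \<theta>
    proof -
      have "expectation (\<lambda>\<omega>. iexp (\<theta> * ((real (LI (\<lambda>i. X i \<omega>) n) - real n) / sqrt (real n)))) = expectation (\<lambda>\<omega>. 1)" for n
      proof (rule integral_cong_AE)
        show "(\<lambda>\<omega>. iexp (\<theta> * ((real (LI (\<lambda>i. X i \<omega>) n) - real n) / sqrt (real n)))) \<in> borel_measurable M"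
          by (rule past_determined_measurable[OF past_determined_LI])
      qed (use ae[of n] in auto)
      then show ?thesis by (simp add: char_normal_law prob_space)
    qed
  qed simp
qed

end

section \<open>A smooth maximum of partial sums\<close>

definition partial_sum :: "(nat \<Rightarrow> real) \<Rightarrow> nat \<Rightarrow> real" where
  "partial_sum e k = (\<Sum>j<k. e j)"

text \<open>
  The smooth maximum at inverse temperature \<open>\<beta>\<close> (log-sum-exp).
\<close>

definition softmax :: "real \<Rightarrow> nat \<Rightarrow> (nat \<Rightarrow> real) \<Rightarrow> real" where
  "softmax \<beta> n e = ln (\<Sum>k\<le>n. exp (\<beta> * partial_sum e k)) / \<beta>"

lemma softmax_bounds:
  assumes "\<beta> > 0"
  shows "Max (partial_sum e ` {..n}) \<le> softmax \<beta> n e"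
    and "softmax \<beta> n e \<le> Max (partial_sum e ` {..n}) + ln (real (Suc n)) / \<beta>"
proof -
  define m where "m = Max (partial_sum e ` {..n})"
  define Z where "Z = (\<Sum>k\<le>n. exp (\<beta> * partial_sum e k))"
  have "m \<in> partial_sum e ` {..n}" unfolding m_def by (intro Max_in) auto
  then obtain k0 where k0: "k0 \<le> n" "m = partial_sum e k0" by auto
  have le: "partial_sum e k \<le> m" if "k \<le> n" for k unfolding m_def using that by (intro Max_ge) auto
  have lower: "exp (\<beta> * m) \<le> Z" unfolding Z_def k0(2)
    using k0(1) by (intro member_le_sum) auto
  then have Z0: "Z > 0" using exp_gt_zero[of "\<beta> * m"] by linarith
  have "\<beta> * m \<le> ln Z" using lower Z0 by (simp add: ln_ge_iff)
  then show "Max (partial_sum e ` {..n}) \<le> softmax \<beta> n e"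
    unfolding softmax_def m_def[symmetric] Z_def[symmetric] using assms by (simp add: field_simps)
  have "Z \<le> (\<Sum>k\<le>n. exp (\<beta> * m))"
    unfolding Z_def using le assms by (intro sum_mono) auto
  also have "\<dots> = real (Suc n) * exp (\<beta> * m)" by simp
  finally have "ln Z \<le> ln (real (Suc n) * exp (\<beta> * m))" using Z0 by (subst ln_le_cancel_iff) auto
  also have "\<dots> = ln (real (Suc n)) + \<beta> * m" by (subst ln_mult) auto
  finally show "softmax \<beta> n e \<le> Max (partial_sum e ` {..n}) + ln (real (Suc n)) / \<beta>"
    unfolding softmax_def m_def[symmetric] Z_def[symmetric] using assms by (simp add: field_simps)
qed

text \<open>
  A single increment enters \<open>softmax\<close> only through \<open>ln (A + B * exp (\<beta> * x)) / \<beta>\<close>. Its derivative is the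
  logistic function \<open>r\<close>, with \<open>0 \<le> r \<le> 1\<close> and \<open>r' = \<beta> * r * (1 - r)\<close>, so each further
  derivative costs one factor \<open>\<beta>\<close>: the third derivative of the composition with \<open>f\<close> is of order
  \<open>\<beta>\<^sup>2\<close>, whatever the weights \<open>A\<close> and \<open>B\<close>.
\<close>

lemma log_sum_exp_taylor:
  fixes f f1 f2 f3 :: "real \<Rightarrow> real" and A B c \<beta> K x :: real
  assumes d: "\<And>y. (f has_real_derivative f1 y) (at y)" "\<And>y. (f1 has_real_derivative f2 y) (at y)"
      "\<And>y. (f2 has_real_derivative f3 y) (at y)"
    and K: "\<And>y. \<bar>f1 y\<bar> \<le> K" "\<And>y. \<bar>f2 y\<bar> \<le> K" "\<And>y. \<bar>f3 y\<bar> \<le> K"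
    and AB: "A > 0" "B > 0" and \<beta>: "\<beta> \<ge> 1"
  defines "u \<equiv> (\<lambda>x. c - x / 2 + ln (A + B * exp (\<beta> * x)) / \<beta>)"
    and "p \<equiv> B / (A + B)"
  shows "\<bar>f (u x) - f (u 0) - f1 (u 0) * (p - 1 / 2) * x
      - (f2 (u 0) * (p - 1 / 2)\<^sup>2 + f1 (u 0) * (\<beta> * p * (1 - p))) * x\<^sup>2 / 2\<bar> \<le> K * \<beta>\<^sup>2 * \<bar>x\<bar> ^ 3"
proof -
  define r where "r x = B * exp (\<beta> * x) / (A + B * exp (\<beta> * x))" for x
  have pos: "A + B * exp (\<beta> * x) > 0" for x using AB by (intro add_pos_pos mult_pos_pos) auto
  have du: "(u has_real_derivative (r y - 1 / 2)) (at y)" for y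
  proof -
    have "(u has_real_derivative (- 1 / 2 + (\<beta> * (B * exp (\<beta> * y))) / (A + B * exp (\<beta> * y)) / \<beta>)) (at y)"
      unfolding u_def using pos[of y] \<beta> by (auto intro!: derivative_eq_intros)
    then show ?thesis unfolding r_def using \<beta> by simp
  qed
  have dr: "(r has_real_derivative \<beta> * r y * (1 - r y)) (at y)" for y
  proof -
    have "(r has_real_derivative
       ((\<beta> * (B * exp (\<beta> * y))) * (A + B * exp (\<beta> * y)) - B * exp (\<beta> * y) * (\<beta> * (B * exp (\<beta> * y))))
         / ((A + B * exp (\<beta> * y)) * (A + B * exp (\<beta> * y)))) (at y)"
      unfolding r_def using pos[of y]
      by (auto intro!: derivative_eq_intros simp: algebra_simps)
    moreover have "((\<beta> * (B * exp (\<beta> * y))) * (A + B * exp (\<beta> * y)) - B * exp (\<beta> * y) * (\<beta> * (B * exp (\<beta> * y))))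
         / ((A + B * exp (\<beta> * y)) * (A + B * exp (\<beta> * y))) = \<beta> * r y * (1 - r y)"
      unfolding r_def using pos[of y] by (simp add: field_simps)
    ultimately show ?thesis by simp
  qed
  have r01: "0 \<le> r y" "r y \<le> 1" for y
    unfolding r_def using AB pos[of y] by (auto intro!: divide_nonneg_pos)
  define u2 where "u2 y = \<beta> * r y * (1 - r y)" for y
  define u3 where "u3 y = \<beta>\<^sup>2 * (r y * (1 - r y)) * (1 - 2 * r y)" for y
  have du2: "(u2 has_real_derivative u3 y) (at y)" for y
    unfolding u2_def u3_def
    by (auto intro!: derivative_eq_intros dr simp: algebra_simps power2_eq_square)
  define w where "w y = r y - 1 / 2" for y
  have dw: "(w has_real_derivative u2 y) (at y)" for y
    unfolding w_def[abs_def] u2_def using DERIV_diff[OF dr[of y] DERIV_const[of "1 / 2"]] by simp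
  \<comment> \<open>The composition \<open>f (u y)\<close> and its first three derivatives.\<close>
  define diff :: "nat \<Rightarrow> real \<Rightarrow> real" where "diff m y =
     (if m = 0 then f (u y) else if m = 1 then f1 (u y) * w y
      else if m = 2 then f2 (u y) * (w y)\<^sup>2 + f1 (u y) * u2 y
      else f3 (u y) * w y ^ 3 + 3 * (f2 (u y) * w y * u2 y) + f1 (u y) * u3 y)" for m y
  have chain: "((\<lambda>y. g (u y)) has_real_derivative g' (u y) * w y) (at y)"
    if "\<And>y. (g has_real_derivative g' y) (at y)" for g g' y
    using DERIV_chain2[OF that du] unfolding w_def .
  have D: "(diff m has_real_derivative diff (Suc m) y) (at y)" if "m < 3" for m y
  proof -
    have "m = 0 \<or> m = 1 \<or> m = 2" using that by linarith
    then consider "m = 0" | "m = 1" | "m = 2" by blast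
    then show ?thesis
    proof cases
      case 1
      then show ?thesis unfolding diff_def using chain[OF d(1)] by simp
    next
      case 2
      have "((\<lambda>y. f1 (u y) * w y) has_real_derivative
         f2 (u y) * (w y)\<^sup>2 + f1 (u y) * u2 y) (at y)"
        by (auto intro!: derivative_eq_intros chain[OF d(2)] dw simp: power2_eq_square)
      then show ?thesis unfolding diff_def using 2 by simp
    next
      case 3
      have "((\<lambda>y. f2 (u y) * (w y)\<^sup>2 + f1 (u y) * u2 y) has_real_derivative
         f3 (u y) * w y ^ 3 + 3 * (f2 (u y) * w y * u2 y) + f1 (u y) * u3 y) (at y)"
        by (auto intro!: derivative_eq_intros chain[OF d(2)] chain[OF d(3)] dw du2
             simp: power2_eq_square power3_eq_cube algebra_simps)
      then show ?thesis unfolding diff_def using 3 by simp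
    qed
  qed
  have diff0: "diff 0 = (\<lambda>y. f (u y))" by (simp add: diff_def fun_eq_iff)
  obtain t where t: "f (u x) = (\<Sum>m<3. diff m 0 / fact m * x ^ m) + diff 3 t / fact 3 * x ^ 3"
    using Maclaurin_bi_le[of diff "\<lambda>y. f (u y)", OF diff0, of 3 x] D by blast
  have r0: "r 0 = p" unfolding r_def p_def by simp
  have "f (u x) - f (u 0) - f1 (u 0) * (p - 1 / 2) * x
      - (f2 (u 0) * (p - 1 / 2)\<^sup>2 + f1 (u 0) * (\<beta> * p * (1 - p))) * x\<^sup>2 / 2 = diff 3 t / 6 * x ^ 3"
    unfolding t by (simp add: numeral_3_eq_3 diff_def r0 u2_def w_def fact_numeral power2_eq_square)
  from arg_cong[OF this, of abs] have eq: "\<bar>f (u x) - f (u 0) - f1 (u 0) * (p - 1 / 2) * x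
      - (f2 (u 0) * (p - 1 / 2)\<^sup>2 + f1 (u 0) * (\<beta> * p * (1 - p))) * x\<^sup>2 / 2\<bar> = \<bar>diff 3 t\<bar> / 6 * \<bar>x\<bar> ^ 3"
    by (simp only: abs_mult abs_divide power_abs abs_numeral)
  have K0: "K \<ge> 0" using K(1)[of 0] by linarith
  have \<beta>2: "1 \<le> \<beta>\<^sup>2" "\<beta> \<le> \<beta>\<^sup>2" using \<beta> mult_left_mono[of 1 \<beta> \<beta>] one_le_power[of \<beta> 2] by (simp_all add: power2_eq_square)
  have w: "\<bar>w t\<bar> \<le> 1" and rr: "\<bar>r t * (1 - r t)\<bar> \<le> 1" and r2: "\<bar>1 - 2 * r t\<bar> \<le> 1"
    using r01[of t] by (auto simp: w_def abs_le_iff mult_le_one)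
  have u2: "\<bar>u2 t\<bar> \<le> \<beta>\<^sup>2"
  proof -
    have "\<bar>u2 t\<bar> = \<beta> * \<bar>r t * (1 - r t)\<bar>" unfolding u2_def using \<beta> by (simp add: abs_mult)
    also have "\<dots> \<le> \<beta> * 1" using rr \<beta> by (intro mult_left_mono) auto
    finally show ?thesis using \<beta>2 by simp
  qed
  have u3: "\<bar>u3 t\<bar> \<le> \<beta>\<^sup>2"
  proof -
    have "\<bar>u3 t\<bar> = \<beta>\<^sup>2 * (\<bar>r t * (1 - r t)\<bar> * \<bar>1 - 2 * r t\<bar>)" unfolding u3_def by (simp add: abs_mult)
    also have "\<dots> \<le> \<beta>\<^sup>2 * (1 * 1)" using rr r2 by (intro mult_left_mono mult_mono) auto
    finally show ?thesis by simp
  qed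
  have "\<bar>diff 3 t\<bar> \<le> \<bar>f3 (u t) * w t ^ 3\<bar> + 3 * \<bar>f2 (u t) * w t * u2 t\<bar> + \<bar>f1 (u t) * u3 t\<bar>"
    unfolding diff_def by simp
  also have "\<dots> \<le> K * 1 + 3 * (K * 1 * \<beta>\<^sup>2) + K * \<beta>\<^sup>2"
  proof (intro add_mono mult_left_mono)
    show "\<bar>f3 (u t) * w t ^ 3\<bar> \<le> K * 1"
      unfolding abs_mult power_abs using w K0 K by (intro mult_mono power_le_one) auto
    show "\<bar>f2 (u t) * w t * u2 t\<bar> \<le> K * 1 * \<beta>\<^sup>2"
      unfolding abs_mult using w K0 K u2 by (intro mult_mono) auto
    show "\<bar>f1 (u t) * u3 t\<bar> \<le> K * \<beta>\<^sup>2"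
      unfolding abs_mult using K0 K u3 by (intro mult_mono) auto
  qed auto
  also have "\<dots> \<le> 6 * (K * \<beta>\<^sup>2)"
    using mult_left_mono[OF \<beta>2(1) K0] mult_nonneg_nonneg[OF K0, of "\<beta>\<^sup>2"] by simp
  finally have "\<bar>diff 3 t\<bar> / 6 \<le> K * \<beta>\<^sup>2" by simp
  then show ?thesis unfolding eq by (intro mult_right_mono) auto
qed

abbreviation seq_borel :: "(nat \<Rightarrow> real) measure" where
  "seq_borel \<equiv> PiM UNIV (\<lambda>_. borel)"

lemma seq_borel_component [measurable]: "(\<lambda>e. e j) \<in> borel_measurable seq_borel"
  by (rule measurable_component_singleton) simp

lemma measurable_seq_borelI:
  assumes "\<And>j. (\<lambda>\<omega>. F \<omega> j) \<in> borel_measurable M"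
  shows "F \<in> M \<rightarrow>\<^sub>M seq_borel"
  by (rule measurable_abs_UNIV[of "\<lambda>j \<omega>. F \<omega> j" M "\<lambda>_. borel", OF assms])

lemma partial_sum_update_le: "k \<le> i \<Longrightarrow> partial_sum (e(i := x)) k = partial_sum e k"
  by (induction k) (simp_all add: partial_sum_def)

lemma partial_sum_update: "i < k \<Longrightarrow> partial_sum (e(i := x)) k = partial_sum (e(i := 0)) k + x"
proof (induction k)
  case (Suc k)
  then show ?case
    using partial_sum_update_le[of k i e x] partial_sum_update_le[of k i e 0]
    by (cases "i < k") (simp_all add: partial_sum_def less_Suc_eq del: fun_upd_apply, auto)
qed simp

text \<open>
  The functional \<open>- S n / 2 + max S\<close> of \<open>LI_eq_walk_max\<close> with the maximum smoothed.
\<close>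

definition walk_functional :: "real \<Rightarrow> nat \<Rightarrow> (nat \<Rightarrow> real) \<Rightarrow> real" where
  "walk_functional \<beta> n e = - partial_sum e n / 2 + softmax \<beta> n e"

lemma walk_functional_measurable [measurable]: "walk_functional \<beta> n \<in> borel_measurable seq_borel"
  unfolding walk_functional_def[abs_def] softmax_def partial_sum_def by measurable

text \<open>
  Changing the increment \<open>i\<close> shifts the partial sums beyond \<open>i\<close> and fixes the earlier ones, which
  gives the form treated in \<open>log_sum_exp_taylor\<close>. The coefficients are functions of the remaining
  increments alone and are bounded, as the exchange argument requires.
\<close>

lemma walk_functional_taylor:
  fixes f f1 f2 f3 :: "real \<Rightarrow> real"
  assumes d: "\<And>y. (f has_real_derivative f1 y) (at y)" "\<And>y. (f1 has_real_derivative f2 y) (at y)"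
      "\<And>y. (f2 has_real_derivative f3 y) (at y)"
    and K: "\<And>y. \<bar>f1 y\<bar> \<le> K" "\<And>y. \<bar>f2 y\<bar> \<le> K" "\<And>y. \<bar>f3 y\<bar> \<le> K"
    and \<beta>: "\<beta> \<ge> 1" and i: "i < n"
  shows "\<exists>T1 T2 C. T1 \<in> borel_measurable seq_borel \<and> T2 \<in> borel_measurable seq_borel \<and>
     (\<forall>e. \<bar>T1 e\<bar> \<le> C \<and> \<bar>T2 e\<bar> \<le> C) \<and>
     (\<forall>e x. \<bar>f (walk_functional \<beta> n (e(i := x))) - f (walk_functional \<beta> n (e(i := 0))) - T1 (e(i := 0)) * x
        - T2 (e(i := 0)) * x\<^sup>2 / 2\<bar> \<le> K * \<beta>\<^sup>2 * \<bar>x\<bar> ^ 3)"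
proof -
  \<comment> \<open>The terms of the log-sum-exp that do not, respectively do, contain the increment \<open>i\<close>.\<close>
  define A where "A e = (\<Sum>k\<le>i. exp (\<beta> * partial_sum e k))" for e
  define B where "B e = (\<Sum>k\<in>{i<..n}. exp (\<beta> * partial_sum e k))" for e
  define p where "p e = B e / (A e + B e)" for e
  define T1 where "T1 e = f1 (walk_functional \<beta> n e) * (p e - 1 / 2)" for e
  define T2 where "T2 e = f2 (walk_functional \<beta> n e) * (p e - 1 / 2)\<^sup>2
      + f1 (walk_functional \<beta> n e) * (\<beta> * p e * (1 - p e))" for e
  have AB: "A e > 0" "B e > 0" for e
    unfolding A_def B_def using i by (auto intro!: sum_pos)
  have p01: "0 \<le> p e" "p e \<le> 1" for e
    unfolding p_def using AB[of e] by auto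
  have K0: "K \<ge> 0" using K(1)[of 0] by linarith
  have cont: "continuous_on UNIV f1" "continuous_on UNIV f2"
    by (rule DERIV_continuous_on[where D=f2] DERIV_continuous_on[where D=f3], simp add: d)+
  have [measurable]: "f1 \<in> borel_measurable borel" "f2 \<in> borel_measurable borel"
    using cont by (auto intro!: borel_measurable_continuous_onI)
  have [measurable]: "p \<in> borel_measurable seq_borel"
    unfolding p_def[abs_def] A_def B_def partial_sum_def by measurable
  show ?thesis
  proof (rule exI[of _ T1], rule exI[of _ T2], rule exI[of _ "K + K * \<beta>"], intro conjI allI)
    show "T1 \<in> borel_measurable seq_borel" "T2 \<in> borel_measurable seq_borel"
      unfolding T1_def[abs_def] T2_def[abs_def] by measurable
    fix e :: "nat \<Rightarrow> real"
    have w: "\<bar>p e - 1 / 2\<bar> \<le> 1" and pp: "\<bar>p e * (1 - p e)\<bar> \<le> 1"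
      using p01[of e] by (auto simp: abs_le_iff mult_le_one)
    have "\<bar>T1 e\<bar> \<le> K * 1"
      unfolding T1_def abs_mult using w K0 K by (intro mult_mono) auto
    moreover have "0 \<le> K * \<beta>" using K0 \<beta> by (intro mult_nonneg_nonneg) auto
    ultimately show "\<bar>T1 e\<bar> \<le> K + K * \<beta>" by simp
    have "\<bar>T2 e\<bar> \<le> \<bar>f2 (walk_functional \<beta> n e) * (p e - 1 / 2)\<^sup>2\<bar>
      + \<bar>f1 (walk_functional \<beta> n e) * (\<beta> * (p e * (1 - p e)))\<bar>"
      unfolding T2_def by (simp only: mult.assoc abs_triangle_ineq)
    also have "\<dots> \<le> K * 1 + K * (\<beta> * 1)"
      unfolding abs_mult[of "f2 _"] abs_mult[of "f1 _"] abs_mult[of \<beta>]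
      using w pp K0 K \<beta> by (intro add_mono mult_mono) (auto simp: abs_square_le_1)
    finally show "\<bar>T2 e\<bar> \<le> K + K * \<beta>" by simp
    fix x :: real
    define e0 where "e0 = e(i := 0)"
    define c where "c = - partial_sum e0 n / 2"
    have W: "walk_functional \<beta> n (e(i := y)) = c - y / 2 + ln (A e0 + B e0 * exp (\<beta> * y)) / \<beta>" for y
    proof -
      have "{..n} = {..i} \<union> {i<..n}" using i by auto
      then have "(\<Sum>k\<le>n. exp (\<beta> * partial_sum (e(i := y)) k)) =
         (\<Sum>k\<le>i. exp (\<beta> * partial_sum (e(i := y)) k)) + (\<Sum>k\<in>{i<..n}. exp (\<beta> * partial_sum (e(i := y)) k))"
        by (simp add: sum.union_disjoint[symmetric] ivl_disj_int)
      also have "(\<Sum>k\<le>i. exp (\<beta> * partial_sum (e(i := y)) k)) = A e0"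
        unfolding A_def e0_def by (intro sum.cong refl) (simp add: partial_sum_update_le)
      also have "(\<Sum>k\<in>{i<..n}. exp (\<beta> * partial_sum (e(i := y)) k)) = B e0 * exp (\<beta> * y)"
        unfolding B_def e0_def sum_distrib_right
        by (intro sum.cong refl) (subst partial_sum_update, auto simp: distrib_left exp_add)
      finally have "(\<Sum>k\<le>n. exp (\<beta> * partial_sum (e(i := y)) k)) = A e0 + B e0 * exp (\<beta> * y)" .
      moreover have "- partial_sum (e(i := y)) n / 2 = c - y / 2"
        unfolding c_def e0_def partial_sum_update[OF i, of e y] by simp
      ultimately show ?thesis unfolding walk_functional_def softmax_def by simp
    qed
    have W0: "walk_functional \<beta> n e0 = c - 0 / 2 + ln (A e0 + B e0 * exp (\<beta> * 0)) / \<beta>"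
      using W[of 0] unfolding e0_def .
    show "\<bar>f (walk_functional \<beta> n (e(i := x))) - f (walk_functional \<beta> n (e(i := 0))) - T1 (e(i := 0)) * x
        - T2 (e(i := 0)) * x\<^sup>2 / 2\<bar> \<le> K * \<beta>\<^sup>2 * \<bar>x\<bar> ^ 3"
      unfolding e0_def[symmetric] T1_def T2_def W0 W p_def
      by (rule log_sum_exp_taylor[where A="A e0" and B="B e0" and c=c and x=x and f=f and ?f1.0=f1 and ?f2.0=f2 and ?f3.0=f3,
            OF d K AB(1) AB(2) \<beta>])
  qed
qed

section \<open>Exchanging martingale increments for independent ones\<close>

lemma (in prob_space) integrable_of_third_moment:
  assumes x: "x \<in> borel_measurable M" "integrable M (\<lambda>\<omega>. \<bar>x \<omega>\<bar> ^ 3 :: real)"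
    and t: "t \<in> borel_measurable M" "\<And>\<omega>. \<bar>t \<omega> :: real\<bar> \<le> C"
  shows "integrable M (\<lambda>\<omega>. t \<omega> * x \<omega>)" "integrable M (\<lambda>\<omega>. t \<omega> * (x \<omega>)\<^sup>2)"
proof -
  have C: "C \<ge> 0" using t(2)[of undefined] by linarith
  have i: "integrable M (\<lambda>\<omega>. C * (1 + \<bar>x \<omega>\<bar> ^ 3))" using x(2) by (intro integrable_mult_right Bochner_Integration.integrable_add) auto
  have le: "y \<le> 1 + y ^ 3" "y\<^sup>2 \<le> 1 + y ^ 3" if "y \<ge> 0" for y :: real
  proof -
    have y3: "y ^ 3 \<ge> 0" using that by simp
    have "y \<le> y ^ 3" if "y \<ge> 1" using power_increasing[of 1 3 y] that by simp
    then show "y \<le> 1 + y ^ 3" using y3 by linarith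
    show "y\<^sup>2 \<le> 1 + y ^ 3"
      using power_increasing[of 2 3 y] y3 power_le_one[OF that, of 2] by (cases "y \<le> 1") linarith+
  qed
  show "integrable M (\<lambda>\<omega>. t \<omega> * x \<omega>)"
  proof (rule Bochner_Integration.integrable_bound[OF i])
    show "(\<lambda>\<omega>. t \<omega> * x \<omega>) \<in> borel_measurable M" using x t by measurable
    have "norm (t \<omega> * x \<omega>) \<le> C * (1 + \<bar>x \<omega>\<bar> ^ 3)" for \<omega>
      unfolding real_norm_def abs_mult using C t le by (intro mult_mono) auto
    then show "AE \<omega> in M. norm (t \<omega> * x \<omega>) \<le> norm (C * (1 + \<bar>x \<omega>\<bar> ^ 3))"
      by (auto intro: order_trans[OF _ abs_ge_self])
  qed
  show "integrable M (\<lambda>\<omega>. t \<omega> * (x \<omega>)\<^sup>2)"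
  proof (rule Bochner_Integration.integrable_bound[OF i])
    show "(\<lambda>\<omega>. t \<omega> * (x \<omega>)\<^sup>2) \<in> borel_measurable M" using x t by measurable
    have "norm (t \<omega> * (x \<omega>)\<^sup>2) \<le> C * (1 + \<bar>x \<omega>\<bar> ^ 3)" for \<omega>
      unfolding real_norm_def abs_mult using C t le(2)[of "\<bar>x \<omega>\<bar>"] by (intro mult_mono) auto
    then show "AE \<omega> in M. norm (t \<omega> * (x \<omega>)\<^sup>2) \<le> norm (C * (1 + \<bar>x \<omega>\<bar> ^ 3))"
      by (auto intro: order_trans[OF _ abs_ge_self])
  qed
qed

text \<open>
  If the increment \<open>x\<close> has conditional mean \<open>0\<close> and conditional variance \<open>v\<close> given the coefficients,
  the expected Taylor polynomial does not depend on the law of \<open>x\<close> otherwise.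
\<close>

lemma (in prob_space) taylor_expectation:
  fixes Y Y0 t1 t2 x :: "'a \<Rightarrow> real"
  assumes [measurable]: "Y \<in> borel_measurable M" "Y0 \<in> borel_measurable M"
      "t1 \<in> borel_measurable M" "t2 \<in> borel_measurable M" "x \<in> borel_measurable M"
    and bd: "\<And>\<omega>. \<bar>Y \<omega>\<bar> \<le> C" "\<And>\<omega>. \<bar>Y0 \<omega>\<bar> \<le> C" "\<And>\<omega>. \<bar>t1 \<omega>\<bar> \<le> C" "\<And>\<omega>. \<bar>t2 \<omega>\<bar> \<le> C"
    and x3: "integrable M (\<lambda>\<omega>. \<bar>x \<omega>\<bar> ^ 3)"
    and mean: "expectation (\<lambda>\<omega>. t1 \<omega> * x \<omega>) = 0"
    and var: "expectation (\<lambda>\<omega>. t2 \<omega> * (x \<omega>)\<^sup>2) = v * expectation t2"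
    and rem: "\<And>\<omega>. \<bar>Y \<omega> - Y0 \<omega> - t1 \<omega> * x \<omega> - t2 \<omega> * (x \<omega>)\<^sup>2 / 2\<bar> \<le> L * \<bar>x \<omega>\<bar> ^ 3"
  shows "\<bar>expectation Y - expectation Y0 - v / 2 * expectation t2\<bar> \<le> L * expectation (\<lambda>\<omega>. \<bar>x \<omega>\<bar> ^ 3)"
proof -
  have iY: "integrable M Y" "integrable M Y0"
    using bd by (auto intro!: integrable_const_bound[where B=C])
  have i1: "integrable M (\<lambda>\<omega>. t1 \<omega> * x \<omega>)" and i2: "integrable M (\<lambda>\<omega>. t2 \<omega> * (x \<omega>)\<^sup>2)"
    using integrable_of_third_moment[OF _ x3 _ bd(3)] integrable_of_third_moment[OF _ x3 _ bd(4)] by auto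
  define R where "R \<omega> = Y \<omega> - Y0 \<omega> - t1 \<omega> * x \<omega> - t2 \<omega> * (x \<omega>)\<^sup>2 / 2" for \<omega>
  have iR: "integrable M R" unfolding R_def using iY i1 i2 by auto
  have "expectation R = expectation Y - expectation Y0 - v / 2 * expectation t2"
    unfolding R_def using iY i1 i2 mean var by simp
  moreover have "\<bar>expectation R\<bar> \<le> expectation (\<lambda>\<omega>. L * \<bar>x \<omega>\<bar> ^ 3)"
  proof (rule order_trans[OF integral_abs_bound], rule integral_mono)
    show "integrable M (\<lambda>\<omega>. \<bar>R \<omega>\<bar>)" using iR by simp
    show "integrable M (\<lambda>\<omega>. L * \<bar>x \<omega>\<bar> ^ 3)" using x3 by simp
    show "\<bar>R \<omega>\<bar> \<le> L * \<bar>x \<omega>\<bar> ^ 3" for \<omega> unfolding R_def by (rule rem)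
  qed
  ultimately show ?thesis by simp
qed

context pair_prob_space begin

lemma integral_of_fst:
  fixes F :: "'a \<Rightarrow> real"
  assumes F: "F \<in> borel_measurable M1"
  shows "integral\<^sup>L (M1 \<Otimes>\<^sub>M M2) (\<lambda>z. F (fst z)) = integral\<^sup>L M1 F"
    and "integrable M1 F \<Longrightarrow> integrable (M1 \<Otimes>\<^sub>M M2) (\<lambda>z. F (fst z))"
  using integral_distr[OF measurable_fst F, of M2] integrable_distr_eq[OF measurable_fst F, of M2]
  unfolding M2.distr_pair_fst by auto

lemma distr_pair_snd: "distr (M1 \<Otimes>\<^sub>M M2) M2 snd = M2"
proof (intro measure_eqI)
  fix A assume A: "A \<in> sets (distr (M1 \<Otimes>\<^sub>M M2) M2 snd)"
  from A have "emeasure (distr (M1 \<Otimes>\<^sub>M M2) M2 snd) A = emeasure (M1 \<Otimes>\<^sub>M M2) (space M1 \<times> A)"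
    by (auto simp add: emeasure_distr space_pair_measure dest: sets.sets_into_space intro!: arg_cong2[where f=emeasure])
  with A show "emeasure (distr (M1 \<Otimes>\<^sub>M M2) M2 snd) A = emeasure M2 A"
    by (simp add: M2.emeasure_pair_measure_Times M1.emeasure_space_1)
qed simp

lemma integral_of_snd:
  fixes F :: "'b \<Rightarrow> real"
  assumes F: "F \<in> borel_measurable M2"
  shows "integral\<^sup>L (M1 \<Otimes>\<^sub>M M2) (\<lambda>z. F (snd z)) = integral\<^sup>L M2 F"
    and "integrable M2 F \<Longrightarrow> integrable (M1 \<Otimes>\<^sub>M M2) (\<lambda>z. F (snd z))"
  using integral_distr[OF measurable_snd F, of M1] integrable_distr_eq[OF measurable_snd F, of M1]
  unfolding distr_pair_snd by auto

text \<open>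
  The hybrid sequences \<open>hyb i\<close> use the first \<open>i\<close> increments of the martingale \<open>D\<close> and the remaining
  ones of the independent sequence \<open>G\<close>. Consecutive hybrids differ in the increment \<open>i\<close> alone. The
  others form \<open>E\<close>, which consists of the past of \<open>D\<close> and the future of \<open>G\<close>; given \<open>E\<close>, both candidates
  for the increment have mean \<open>0\<close> and variance \<open>v\<close>, so the two expectations agree up to third
  absolute moments. The moment hypotheses express this conditioning by test functions \<open>h\<close> of the
  past, respectively of the future.
\<close>

lemma lindeberg_exchange:
  fixes D :: "nat \<Rightarrow> 'a \<Rightarrow> real" and G :: "nat \<Rightarrow> 'b \<Rightarrow> real" and \<Phi> :: "(nat \<Rightarrow> real) \<Rightarrow> real"
  assumes D [measurable]: "\<And>i. D i \<in> borel_measurable M1" and G [measurable]: "\<And>i. G i \<in> borel_measurable M2"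
    and D3: "\<And>i. i < n \<Longrightarrow> integrable M1 (\<lambda>\<omega>. \<bar>D i \<omega>\<bar> ^ 3)" "\<And>i. i < n \<Longrightarrow> (\<integral>\<omega>. \<bar>D i \<omega>\<bar> ^ 3 \<partial>M1) \<le> m"
    and G3: "\<And>i. i < n \<Longrightarrow> integrable M2 (\<lambda>\<nu>. \<bar>G i \<nu>\<bar> ^ 3)" "\<And>i. i < n \<Longrightarrow> (\<integral>\<nu>. \<bar>G i \<nu>\<bar> ^ 3 \<partial>M2) \<le> m'"
    and D_moments: "\<And>i h C. i < n \<Longrightarrow> h \<in> borel_measurable seq_borel \<Longrightarrow> (\<And>e. \<bar>h e\<bar> \<le> C) \<Longrightarrow>
        (\<integral>\<omega>. h (\<lambda>j. if j < i then D j \<omega> else 0) * D i \<omega> \<partial>M1) = 0 \<and>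
        (\<integral>\<omega>. h (\<lambda>j. if j < i then D j \<omega> else 0) * (D i \<omega>)\<^sup>2 \<partial>M1)
          = v * (\<integral>\<omega>. h (\<lambda>j. if j < i then D j \<omega> else 0) \<partial>M1)"
    and G_moments: "\<And>i h C. i < n \<Longrightarrow> h \<in> borel_measurable seq_borel \<Longrightarrow> (\<And>e. \<bar>h e\<bar> \<le> C) \<Longrightarrow>
        (\<integral>\<nu>. h (\<lambda>j. if i < j then G j \<nu> else 0) * G i \<nu> \<partial>M2) = 0 \<and>
        (\<integral>\<nu>. h (\<lambda>j. if i < j then G j \<nu> else 0) * (G i \<nu>)\<^sup>2 \<partial>M2)
          = v * (\<integral>\<nu>. h (\<lambda>j. if i < j then G j \<nu> else 0) \<partial>M2)"
    and \<Phi> [measurable]: "\<Phi> \<in> borel_measurable seq_borel" and \<Phi>_bd: "\<And>e. \<bar>\<Phi> e\<bar> \<le> K"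
    and \<Phi>_dep: "\<And>e e'. (\<And>j. j < n \<Longrightarrow> e j = e' j) \<Longrightarrow> \<Phi> e = \<Phi> e'"
    and L: "L \<ge> 0"
    and taylor: "\<And>i. i < n \<Longrightarrow> \<exists>T1 T2 C. T1 \<in> borel_measurable seq_borel \<and> T2 \<in> borel_measurable seq_borel \<and>
     (\<forall>e. \<bar>T1 e\<bar> \<le> C \<and> \<bar>T2 e\<bar> \<le> C) \<and>
     (\<forall>e x. \<bar>\<Phi> (e(i := x)) - \<Phi> (e(i := 0)) - T1 (e(i := 0)) * x - T2 (e(i := 0)) * x\<^sup>2 / 2\<bar> \<le> L * \<bar>x\<bar> ^ 3)"
  shows "\<bar>(\<integral>\<omega>. \<Phi> (\<lambda>j. D j \<omega>) \<partial>M1) - (\<integral>\<nu>. \<Phi> (\<lambda>j. G j \<nu>) \<partial>M2)\<bar> \<le> real n * (L * (m + m'))"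
proof -
  define hyb where "hyb i z j = (if j < i then D j (fst z) else G j (snd z))" for i z and j :: nat
  define a where "a i = (\<integral>z. \<Phi> (hyb i z) \<partial>(M1 \<Otimes>\<^sub>M M2))" for i
  have hyb_meas: "hyb i \<in> (M1 \<Otimes>\<^sub>M M2) \<rightarrow>\<^sub>M seq_borel" for i
    by (rule measurable_seq_borelI, unfold hyb_def) measurable
  have seqD: "(\<lambda>\<omega> j. D j \<omega>) \<in> M1 \<rightarrow>\<^sub>M seq_borel" and seqG: "(\<lambda>\<nu> j. G j \<nu>) \<in> M2 \<rightarrow>\<^sub>M seq_borel"
    by (rule measurable_seq_borelI, rule D, rule measurable_seq_borelI, rule G)
  have a0: "a 0 = (\<integral>\<nu>. \<Phi> (\<lambda>j. G j \<nu>) \<partial>M2)"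
    unfolding a_def hyb_def using integral_of_snd(1)[OF measurable_compose[OF seqG \<Phi>]] by simp
  have an: "a n = (\<integral>\<omega>. \<Phi> (\<lambda>j. D j \<omega>) \<partial>M1)"
  proof -
    have "\<Phi> (hyb n z) = \<Phi> (\<lambda>j. D j (fst z))" for z by (rule \<Phi>_dep) (simp add: hyb_def)
    then show ?thesis
      unfolding a_def using integral_of_fst(1)[OF measurable_compose[OF seqD \<Phi>]] by simp
  qed
  have step: "\<bar>a (Suc i) - a i\<bar> \<le> L * (m + m')" if i: "i < n" for i
  proof -
    obtain T1 T2 C where T [measurable]: "T1 \<in> borel_measurable seq_borel" "T2 \<in> borel_measurable seq_borel"
      and C: "\<And>e. \<bar>T1 e\<bar> \<le> C" "\<And>e. \<bar>T2 e\<bar> \<le> C"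
      and tay: "\<And>e x. \<bar>\<Phi> (e(i := x)) - \<Phi> (e(i := 0)) - T1 (e(i := 0)) * x - T2 (e(i := 0)) * x\<^sup>2 / 2\<bar> \<le> L * \<bar>x\<bar> ^ 3"
      using taylor[OF i] by blast
    define E where "E z j = (if j < i then D j (fst z) else if i < j then G j (snd z) else 0)" for z and j :: nat
    have E_meas: "E \<in> (M1 \<Otimes>\<^sub>M M2) \<rightarrow>\<^sub>M seq_borel"
      by (rule measurable_seq_borelI, unfold E_def) measurable
    have E0: "(E z)(i := 0) = E z" for z by (auto simp: E_def fun_eq_iff)
    have hS: "hyb (Suc i) z = (E z)(i := D i (fst z))" and hi: "hyb i z = (E z)(i := G i (snd z))" for z
      by (auto simp: E_def hyb_def fun_eq_iff)
    have Em: "(\<lambda>z. \<Phi> (E z)) \<in> borel_measurable (M1 \<Otimes>\<^sub>M M2)"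
      "(\<lambda>z. T1 (E z)) \<in> borel_measurable (M1 \<Otimes>\<^sub>M M2)" "(\<lambda>z. T2 (E z)) \<in> borel_measurable (M1 \<Otimes>\<^sub>M M2)"
      by (rule measurable_compose[OF E_meas \<Phi>] measurable_compose[OF E_meas T(1)] measurable_compose[OF E_meas T(2)])+
    have Hm: "(\<lambda>z. \<Phi> (hyb k z)) \<in> borel_measurable (M1 \<Otimes>\<^sub>M M2)" for k
      by (rule measurable_compose[OF hyb_meas \<Phi>])
    have x3D: "integrable (M1 \<Otimes>\<^sub>M M2) (\<lambda>z. \<bar>D i (fst z)\<bar> ^ 3)"
      by (rule integral_of_fst(2)[OF _ D3(1)[OF i]]) measurable
    have x3G: "integrable (M1 \<Otimes>\<^sub>M M2) (\<lambda>z. \<bar>G i (snd z)\<bar> ^ 3)"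
      by (rule integral_of_snd(2)[OF _ G3(1)[OF i]]) measurable
    have Dm: "(\<lambda>z. D i (fst z)) \<in> borel_measurable (M1 \<Otimes>\<^sub>M M2)"
      and Gm: "(\<lambda>z. G i (snd z)) \<in> borel_measurable (M1 \<Otimes>\<^sub>M M2)" by measurable

    \<comment> \<open>Sections of the coefficient \<open>T\<close>: with the Brownian side frozen at \<open>\<nu>\<close> it is a test function of the
      past of \<open>D\<close>, and with the chain frozen at \<open>\<omega>\<close> it is a test function of the future of \<open>G\<close>. Fubini then
      reduces the mixed moments on the product space to the moment hypotheses.\<close>
    define hD where "hD T \<nu> e = T (\<lambda>j. if j < i then e j else if i < j then G j \<nu> else 0)" for T :: "(nat \<Rightarrow> real) \<Rightarrow> real" and \<nu> and e :: "nat \<Rightarrow> real"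
    define hG where "hG T \<omega> e = T (\<lambda>j. if j < i then D j \<omega> else if i < j then e j else 0)" for T :: "(nat \<Rightarrow> real) \<Rightarrow> real" and \<omega> and e :: "nat \<Rightarrow> real"
    have hDm: "hD T \<nu> \<in> borel_measurable seq_borel" and hGm: "hG T \<omega> \<in> borel_measurable seq_borel"
      if "T \<in> borel_measurable seq_borel" for T \<nu> \<omega>
    proof -
      have "(\<lambda>e j. if j < i then e j else if i < j then G j \<nu> else 0) \<in> seq_borel \<rightarrow>\<^sub>M seq_borel"
        by (rule measurable_seq_borelI) measurable
      from measurable_compose[OF this that] show "hD T \<nu> \<in> borel_measurable seq_borel" unfolding hD_def .
      have "(\<lambda>e j. if j < i then D j \<omega> else if i < j then e j else 0) \<in> seq_borel \<rightarrow>\<^sub>M seq_borel"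
        by (rule measurable_seq_borelI) measurable
      from measurable_compose[OF this that] show "hG T \<omega> \<in> borel_measurable seq_borel" unfolding hG_def .
    qed
    have hDE: "hD T \<nu> (\<lambda>j. if j < i then D j \<omega> else 0) = T (E (\<omega>, \<nu>))"
      and hGE: "hG T \<omega> (\<lambda>j. if i < j then G j \<nu> else 0) = T (E (\<omega>, \<nu>))" for T \<omega> \<nu>
      unfolding hD_def hG_def E_def by (rule arg_cong[where f=T]; auto simp: fun_eq_iff)+
    have D1: "(\<integral>z. T1 (E z) * D i (fst z) \<partial>(M1 \<Otimes>\<^sub>M M2)) = 0"
    proof -
      have "integrable (M1 \<Otimes>\<^sub>M M2) (\<lambda>(\<omega>, \<nu>). T1 (E (\<omega>, \<nu>)) * D i \<omega>)"
        using P.integrable_of_third_moment(1)[OF Dm x3D Em(2) C(1)] by (simp add: case_prod_unfold)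
      then have "(\<integral>z. T1 (E z) * D i (fst z) \<partial>(M1 \<Otimes>\<^sub>M M2)) = (\<integral>\<nu>. (\<integral>\<omega>. T1 (E (\<omega>, \<nu>)) * D i \<omega> \<partial>M1) \<partial>M2)"
        by (subst integral_snd) (simp_all add: case_prod_unfold)
      also have "\<dots> = (\<integral>\<nu>. 0 \<partial>M2)"
      proof -
        have "\<bar>hD T1 \<nu> e\<bar> \<le> C" for \<nu> e unfolding hD_def by (rule C(1))
        from D_moments[OF i hDm[OF T(1)] this] show ?thesis unfolding hDE by simp
      qed
      finally show ?thesis by simp
    qed
    have D2: "(\<integral>z. T2 (E z) * (D i (fst z))\<^sup>2 \<partial>(M1 \<Otimes>\<^sub>M M2)) = v * (\<integral>z. T2 (E z) \<partial>(M1 \<Otimes>\<^sub>M M2))"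
    proof -
      have "integrable (M1 \<Otimes>\<^sub>M M2) (\<lambda>(\<omega>, \<nu>). T2 (E (\<omega>, \<nu>)) * (D i \<omega>)\<^sup>2)"
        using P.integrable_of_third_moment(2)[OF Dm x3D Em(3) C(2)] by (simp add: case_prod_unfold)
      then have "(\<integral>z. T2 (E z) * (D i (fst z))\<^sup>2 \<partial>(M1 \<Otimes>\<^sub>M M2)) = (\<integral>\<nu>. (\<integral>\<omega>. T2 (E (\<omega>, \<nu>)) * (D i \<omega>)\<^sup>2 \<partial>M1) \<partial>M2)"
        by (subst integral_snd) (simp_all add: case_prod_unfold)
      also have "\<dots> = (\<integral>\<nu>. v * (\<integral>\<omega>. T2 (E (\<omega>, \<nu>)) \<partial>M1) \<partial>M2)"
      proof -
        have "\<bar>hD T2 \<nu> e\<bar> \<le> C" for \<nu> e unfolding hD_def by (rule C(2))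
        from D_moments[OF i hDm[OF T(2)] this] show ?thesis unfolding hDE by simp
      qed
      also have "\<dots> = v * (\<integral>\<nu>. (\<integral>\<omega>. T2 (E (\<omega>, \<nu>)) \<partial>M1) \<partial>M2)" by simp
      also have "(\<integral>\<nu>. (\<integral>\<omega>. T2 (E (\<omega>, \<nu>)) \<partial>M1) \<partial>M2) = (\<integral>z. T2 (E z) \<partial>(M1 \<Otimes>\<^sub>M M2))"
        using P.integrable_const_bound[where f="\<lambda>z. T2 (E z)" and B=C] Em(3) C(2)
        by (subst integral_snd) (simp_all add: case_prod_unfold)
      finally show ?thesis .
    qed
    have G1: "(\<integral>z. T1 (E z) * G i (snd z) \<partial>(M1 \<Otimes>\<^sub>M M2)) = 0"
    proof -
      have "integrable (M1 \<Otimes>\<^sub>M M2) (\<lambda>(\<omega>, \<nu>). T1 (E (\<omega>, \<nu>)) * G i \<nu>)"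
        using P.integrable_of_third_moment(1)[OF Gm x3G Em(2) C(1)] by (simp add: case_prod_unfold)
      then have "(\<integral>z. T1 (E z) * G i (snd z) \<partial>(M1 \<Otimes>\<^sub>M M2)) = (\<integral>\<omega>. (\<integral>\<nu>. T1 (E (\<omega>, \<nu>)) * G i \<nu> \<partial>M2) \<partial>M1)"
        by (subst integral_fst) (simp_all add: case_prod_unfold)
      also have "\<dots> = (\<integral>\<omega>. 0 \<partial>M1)"
      proof -
        have "\<bar>hG T1 \<omega> e\<bar> \<le> C" for \<omega> e unfolding hG_def by (rule C(1))
        from G_moments[OF i hGm[OF T(1)] this] show ?thesis unfolding hGE by simp
      qed
      finally show ?thesis by simp
    qed
    have G2: "(\<integral>z. T2 (E z) * (G i (snd z))\<^sup>2 \<partial>(M1 \<Otimes>\<^sub>M M2)) = v * (\<integral>z. T2 (E z) \<partial>(M1 \<Otimes>\<^sub>M M2))"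
    proof -
      have "integrable (M1 \<Otimes>\<^sub>M M2) (\<lambda>(\<omega>, \<nu>). T2 (E (\<omega>, \<nu>)) * (G i \<nu>)\<^sup>2)"
        using P.integrable_of_third_moment(2)[OF Gm x3G Em(3) C(2)] by (simp add: case_prod_unfold)
      then have "(\<integral>z. T2 (E z) * (G i (snd z))\<^sup>2 \<partial>(M1 \<Otimes>\<^sub>M M2)) = (\<integral>\<omega>. (\<integral>\<nu>. T2 (E (\<omega>, \<nu>)) * (G i \<nu>)\<^sup>2 \<partial>M2) \<partial>M1)"
        by (subst integral_fst) (simp_all add: case_prod_unfold)
      also have "\<dots> = (\<integral>\<omega>. v * (\<integral>\<nu>. T2 (E (\<omega>, \<nu>)) \<partial>M2) \<partial>M1)"
      proof -
        have "\<bar>hG T2 \<omega> e\<bar> \<le> C" for \<omega> e unfolding hG_def by (rule C(2))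
        from G_moments[OF i hGm[OF T(2)] this] show ?thesis unfolding hGE by simp
      qed
      also have "\<dots> = v * (\<integral>\<omega>. (\<integral>\<nu>. T2 (E (\<omega>, \<nu>)) \<partial>M2) \<partial>M1)" by simp
      also have "(\<integral>\<omega>. (\<integral>\<nu>. T2 (E (\<omega>, \<nu>)) \<partial>M2) \<partial>M1) = (\<integral>z. T2 (E z) \<partial>(M1 \<Otimes>\<^sub>M M2))"
        using P.integrable_const_bound[where f="\<lambda>z. T2 (E z)" and B=C] Em(3) C(2)
        by (subst integral_fst) (simp_all add: case_prod_unfold)
      finally show ?thesis .
    qed
    have tayE: "\<bar>\<Phi> ((E z)(i := x)) - \<Phi> (E z) - T1 (E z) * x - T2 (E z) * x\<^sup>2 / 2\<bar> \<le> L * \<bar>x\<bar> ^ 3" for z x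
      using tay[of "E z" x] unfolding E0 .
    have b: "\<bar>\<Phi> e\<bar> \<le> max K C" "\<bar>T1 e\<bar> \<le> max K C" "\<bar>T2 e\<bar> \<le> max K C" for e
      using \<Phi>_bd[of e] C[of e] by linarith+
    have "\<bar>a (Suc i) - (\<integral>z. \<Phi> (E z) \<partial>(M1 \<Otimes>\<^sub>M M2)) - v / 2 * (\<integral>z. T2 (E z) \<partial>(M1 \<Otimes>\<^sub>M M2))\<bar>
        \<le> L * (\<integral>z. \<bar>D i (fst z)\<bar> ^ 3 \<partial>(M1 \<Otimes>\<^sub>M M2))"
      unfolding a_def
      by (rule P.taylor_expectation[OF Hm Em(1,2,3) Dm b(1) b(1) b(2) b(3) x3D D1 D2])
         (unfold hS, rule tayE)
    moreover have "\<bar>a i - (\<integral>z. \<Phi> (E z) \<partial>(M1 \<Otimes>\<^sub>M M2)) - v / 2 * (\<integral>z. T2 (E z) \<partial>(M1 \<Otimes>\<^sub>M M2))\<bar>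
        \<le> L * (\<integral>z. \<bar>G i (snd z)\<bar> ^ 3 \<partial>(M1 \<Otimes>\<^sub>M M2))"
      unfolding a_def
      by (rule P.taylor_expectation[OF Hm Em(1,2,3) Gm b(1) b(1) b(2) b(3) x3G G1 G2])
         (unfold hi, rule tayE)
    moreover have "L * (\<integral>z. \<bar>D i (fst z)\<bar> ^ 3 \<partial>(M1 \<Otimes>\<^sub>M M2)) \<le> L * m"
      using integral_of_fst(1)[of "\<lambda>\<omega>. \<bar>D i \<omega>\<bar> ^ 3"] D3(2)[OF i] L by (intro mult_left_mono) auto
    moreover have "L * (\<integral>z. \<bar>G i (snd z)\<bar> ^ 3 \<partial>(M1 \<Otimes>\<^sub>M M2)) \<le> L * m'"
      using integral_of_snd(1)[of "\<lambda>\<nu>. \<bar>G i \<nu>\<bar> ^ 3"] G3(2)[OF i] L by (intro mult_left_mono) auto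
    ultimately show ?thesis unfolding distrib_left abs_le_iff by linarith
  qed
  have "\<bar>a k - a 0\<bar> \<le> real k * (L * (m + m'))" if "k \<le> n" for k
    using that
  proof (induction k)
    case (Suc k)
    have "\<bar>a (Suc k) - a 0\<bar> \<le> \<bar>a (Suc k) - a k\<bar> + \<bar>a k - a 0\<bar>" by linarith
    also have "\<dots> \<le> L * (m + m') + real k * (L * (m + m'))" using step[of k] Suc by (intro add_mono) auto
    finally show ?case by (simp add: algebra_simps)
  qed simp
  from this[of n] show ?thesis unfolding a0 an by simp
qed

end

section \<open>Brownian motion on a grid\<close>

text \<open>
  The supremum is attained at some \<open>t\<close>, and the grid point just below \<open>t\<close> converges to \<open>t\<close>.
\<close>

lemma Max_grid_tendsto_SUP:
  fixes g :: "real \<Rightarrow> real"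
  assumes g: "continuous_on {0..1} g"
  shows "(\<lambda>n. Max ((\<lambda>k. g (real k / real n)) ` {..n})) \<longlonglongrightarrow> (SUP t\<in>{0..1}. g t)"
proof -
  obtain t where t: "t \<in> {0..1}" "\<And>y. y \<in> {0..1} \<Longrightarrow> g y \<le> g t"
    using continuous_attains_sup[OF _ _ g] by auto
  have S: "(SUP t\<in>{0..1}. g t) = g t" using t by (intro cSup_eq_maximum) auto
  define k where "k n = nat \<lfloor>real n * t\<rfloor>" for n :: nat
  have k1: "real (k n) \<le> real n * t" "real n * t < real (k n) + 1" for n
    unfolding k_def using t(1) by auto
  have kn: "k n \<le> n" for n
  proof -
    have "real n * t \<le> real n * 1" using t(1) by (intro mult_left_mono) auto
    then have "real (k n) \<le> real n" using k1(1)[of n] by linarith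
    then show ?thesis by simp
  qed
  have l1: "(\<lambda>n. t - 1 / real n) \<longlonglongrightarrow> t - 0"
    by (intro tendsto_diff tendsto_const lim_1_over_n)
  have "(\<lambda>n. real (k n) / real n) \<longlonglongrightarrow> t"
  proof (rule real_tendsto_sandwich[OF _ _ l1[simplified] tendsto_const])
    show "\<forall>\<^sub>F n in sequentially. t - 1 / real n \<le> real (k n) / real n"
      using eventually_gt_at_top[of 0]
    proof eventually_elim
      case (elim n)
      then have "t \<le> (real (k n) + 1) / real n" using k1(2)[of n] by (simp add: pos_le_divide_eq mult.commute)
      then show ?case by (simp add: add_divide_distrib)
    qed
    show "\<forall>\<^sub>F n in sequentially. real (k n) / real n \<le> t"
      using eventually_gt_at_top[of 0]
    proof eventually_elim
      case (elim n)
      then show ?case using k1(1)[of n] by (simp add: field_simps)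
    qed
  qed
  then have lim: "(\<lambda>n. g (real (k n) / real n)) \<longlonglongrightarrow> g t"
    by (rule continuous_on_tendsto_compose[OF g _ t(1)])
       (use kn in \<open>auto intro!: always_eventually divide_le_eq_1[THEN iffD2] simp: divide_le_eq_1\<close>)
  show ?thesis unfolding S
  proof (rule real_tendsto_sandwich[OF _ _ lim tendsto_const])
    show "\<forall>\<^sub>F n in sequentially. g (real (k n) / real n) \<le> Max ((\<lambda>k. g (real k / real n)) ` {..n})"
      using kn by (intro always_eventually allI Max_ge) auto
    show "\<forall>\<^sub>F n in sequentially. Max ((\<lambda>k. g (real k / real n)) ` {..n}) \<le> g t"
      by (intro always_eventually allI Max.boundedI) (auto intro!: t(2) simp: divide_le_eq_1)
  qed
qed

context standard_brownian_motion begin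

text \<open>
  Increments beyond the index \<open>n\<close> are set to \<open>0\<close>, so that for each \<open>n\<close> they form a sequence indexed by
  all natural numbers.
\<close>

definition bm_increment :: "real \<Rightarrow> nat \<Rightarrow> nat \<Rightarrow> 'w \<Rightarrow> real" where
  "bm_increment \<sigma> n j \<nu> = (if j < n then \<sigma> * (B (real (Suc j) / real n) \<nu> - B (real j / real n) \<nu>) else 0)"

lemma grid_point: "j \<le> n \<Longrightarrow> real j / real n \<in> {0..1}"
  by (auto simp: divide_le_eq_1)

lemma bm_increment_measurable: "bm_increment \<sigma> n j \<in> borel_measurable M"
proof (cases "j < n")
  case True
  then have [measurable]: "B (real (Suc j) / real n) \<in> borel_measurable M" "B (real j / real n) \<in> borel_measurable M"
    by (intro random_variable_B grid_point; simp)+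
  have "(\<lambda>\<nu>. \<sigma> * (B (real (Suc j) / real n) \<nu> - B (real j / real n) \<nu>)) \<in> borel_measurable M" by measurable
  then show ?thesis unfolding bm_increment_def[abs_def] using True by (simp del: of_nat_Suc)
next
  case False
  then show ?thesis unfolding bm_increment_def[abs_def] by simp
qed

lemma bm_increment_distributed:
  assumes "j < n"
  shows "distributed M lborel (\<lambda>\<nu>. B (real (Suc j) / real n) \<nu> - B (real j / real n) \<nu>) (normal_density 0 (sqrt (1 / real n)))"
proof -
  have "real (Suc j) / real n - real j / real n = 1 / real n"
    by (simp add: diff_divide_distrib[symmetric])
  then show ?thesis
    using gaussian_increments[of "real j / real n" "real (Suc j) / real n"] assms
    by (simp add: divide_strict_right_mono)
qed

lemma bm_increment_moments:
  assumes j: "j < n"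
  shows "integrable M (bm_increment \<sigma> n j)" "expectation (bm_increment \<sigma> n j) = 0"
    and "integrable M (\<lambda>\<nu>. (bm_increment \<sigma> n j \<nu>)\<^sup>2)" "expectation (\<lambda>\<nu>. (bm_increment \<sigma> n j \<nu>)\<^sup>2) = \<sigma>\<^sup>2 / real n"
    and "integrable M (\<lambda>\<nu>. \<bar>bm_increment \<sigma> n j \<nu>\<bar> ^ 3)"
      "expectation (\<lambda>\<nu>. \<bar>bm_increment \<sigma> n j \<nu>\<bar> ^ 3) \<le> 2 * \<bar>\<sigma>\<bar> ^ 3 / (real n * sqrt (real n))"
proof -
  define s where "s = sqrt (1 / real n)"
  have n: "real n > 0" using j by simp
  have s: "s > 0" "s\<^sup>2 = 1 / real n" unfolding s_def using n by auto
  define Y where "Y \<nu> = B (real (Suc j) / real n) \<nu> - B (real j / real n) \<nu>" for \<nu>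
  have G: "bm_increment \<sigma> n j \<nu> = \<sigma> * Y \<nu>" for \<nu> unfolding bm_increment_def Y_def using j by simp
  have d: "distributed M lborel Y (normal_density 0 s)"
    unfolding Y_def s_def by (rule bm_increment_distributed[OF j])
  note I = distributed_integrable[OF d _ normal_density_nonneg] distributed_integral[OF d _ normal_density_nonneg]
  have i1: "integrable M Y" "expectation Y = 0"
    using I[of "\<lambda>x. x"] integrable_normal_moment[OF s(1), of 0 1] integral_normal_moment_odd[OF s(1), of 0 0] by auto
  have i2: "integrable M (\<lambda>\<nu>. (Y \<nu>)\<^sup>2)" "expectation (\<lambda>\<nu>. (Y \<nu>)\<^sup>2) = s\<^sup>2"
    using I[of "\<lambda>x. x\<^sup>2"] integrable_normal_moment[OF s(1), of 0 2] integral_normal_moment_even[OF s(1), of 0 1]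
    by (auto simp: fact_numeral)
  have i3: "integrable M (\<lambda>\<nu>. \<bar>Y \<nu>\<bar> ^ 3)" "expectation (\<lambda>\<nu>. \<bar>Y \<nu>\<bar> ^ 3) = 2 * s ^ 3 * sqrt (2 / pi)"
    using I[of "\<lambda>x. \<bar>x\<bar> ^ 3"] integrable_normal_moment_abs[OF s(1), of 0 3] integral_normal_moment_abs_odd[OF s(1), of 0 1]
    by (auto simp: numeral_3_eq_3)
  show "integrable M (bm_increment \<sigma> n j)" "expectation (bm_increment \<sigma> n j) = 0"
    using i1 by (auto simp: G[abs_def])
  show "integrable M (\<lambda>\<nu>. (bm_increment \<sigma> n j \<nu>)\<^sup>2)" "expectation (\<lambda>\<nu>. (bm_increment \<sigma> n j \<nu>)\<^sup>2) = \<sigma>\<^sup>2 / real n"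
    using i2 by (auto simp: G power_mult_distrib s)
  show "integrable M (\<lambda>\<nu>. \<bar>bm_increment \<sigma> n j \<nu>\<bar> ^ 3)"
    using i3 by (auto simp: G power_mult_distrib abs_mult)
  have "expectation (\<lambda>\<nu>. \<bar>bm_increment \<sigma> n j \<nu>\<bar> ^ 3) = \<bar>\<sigma>\<bar> ^ 3 * (2 * s ^ 3 * sqrt (2 / pi))"
    using i3 by (simp add: G power_mult_distrib abs_mult)
  also have "\<dots> \<le> \<bar>\<sigma>\<bar> ^ 3 * (2 * s ^ 3 * 1)"
  proof -
    have "sqrt (2 / pi) \<le> 1" using pi_ge_two by (simp add: real_sqrt_le_1_iff)
    then show ?thesis using s by (intro mult_left_mono) auto
  qed
  also have "s ^ 3 = 1 / (real n * sqrt (real n))"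
    using s by (simp add: power3_eq_cube s_def real_sqrt_divide)
  finally show "expectation (\<lambda>\<nu>. \<bar>bm_increment \<sigma> n j \<nu>\<bar> ^ 3) \<le> 2 * \<bar>\<sigma>\<bar> ^ 3 / (real n * sqrt (real n))"
    by (simp add: mult.commute)
qed

text \<open>
  The increments after \<open>i\<close> are independent of the increment \<open>i\<close>, so expectations of products
  factorise.
\<close>

lemma bm_increment_factorize:
  assumes i: "i < n" and h: "h \<in> borel_measurable seq_borel" "\<And>e. \<bar>h e\<bar> \<le> C"
  shows "expectation (\<lambda>\<nu>. h (\<lambda>j. if i < j then bm_increment \<sigma> n j \<nu> else 0) * bm_increment \<sigma> n i \<nu>) = 0 \<and>
    expectation (\<lambda>\<nu>. h (\<lambda>j. if i < j then bm_increment \<sigma> n j \<nu> else 0) * (bm_increment \<sigma> n i \<nu>)\<^sup>2)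
     = \<sigma>\<^sup>2 / real n * expectation (\<lambda>\<nu>. h (\<lambda>j. if i < j then bm_increment \<sigma> n j \<nu> else 0))"
proof -
  define Y where "Y j \<nu> = B (real (Suc j) / real n) \<nu> - B (real j / real n) \<nu>" for j \<nu>
  have ind: "indep_vars (\<lambda>_. borel) Y {..<n}"
    unfolding Y_def by (rule independent_increments[of "\<lambda>j. real j / real n"])
      (use i in \<open>auto simp: divide_strict_right_mono\<close>)
  define A where "A = {i<..<n}"
  define h' where "h' e = h (\<lambda>j. if j \<in> A then \<sigma> * e j else 0)" for e
  define H where "H \<nu> = h (\<lambda>j. if i < j then bm_increment \<sigma> n j \<nu> else 0)" for \<nu>
  have "(\<lambda>e j. if j \<in> A then \<sigma> * e j else 0) \<in> PiM A (\<lambda>_. borel) \<rightarrow>\<^sub>M seq_borel"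
  proof (rule measurable_seq_borelI)
    fix j show "(\<lambda>e. if j \<in> A then \<sigma> * e j else 0) \<in> borel_measurable (PiM A (\<lambda>_. borel))"
      by (cases "j \<in> A") (auto intro!: borel_measurable_times measurable_component_singleton)
  qed
  from measurable_compose[OF this h(1)] have h'm: "h' \<in> borel_measurable (PiM A (\<lambda>_. borel))"
    unfolding h'_def .
  have "indep_var (PiM A (\<lambda>_. borel)) (\<lambda>\<nu>. restrict (\<lambda>j. Y j \<nu>) A) (PiM {i} (\<lambda>_. borel)) (\<lambda>\<nu>. restrict (\<lambda>j. Y j \<nu>) {i})"
    by (rule indep_var_restrict[OF ind]) (use i in \<open>auto simp: A_def\<close>)
  note indc = indep_var_compose[OF this h'm]
  have H: "h' \<circ> (\<lambda>\<nu>. restrict (\<lambda>j. Y j \<nu>) A) = H"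
    unfolding h'_def H_def comp_def bm_increment_def Y_def A_def
    by (intro ext arg_cong[where f=h]) auto
  have i1: "indep_var borel H borel (bm_increment \<sigma> n i)"
  proof -
    have "(\<lambda>e. \<sigma> * e i) \<in> borel_measurable (PiM {i} (\<lambda>_. borel))"
      by (intro borel_measurable_times measurable_component_singleton) auto
    from indc[OF this] show ?thesis
      unfolding H unfolding comp_def bm_increment_def[abs_def] Y_def using i by simp
  qed
  have i2: "indep_var borel H borel (\<lambda>\<nu>. (bm_increment \<sigma> n i \<nu>)\<^sup>2)"
    using indep_var_compose[OF i1, of "\<lambda>x. x" borel "\<lambda>x. x\<^sup>2" borel] by (simp add: comp_def)
  have iH: "integrable M H"
    using indep_var_rv1[OF i1] h(2) by (intro integrable_const_bound[where B=C]) (auto simp: H_def)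
  have "expectation (\<lambda>\<nu>. H \<nu> * bm_increment \<sigma> n i \<nu>) = 0"
    using indep_var_lebesgue_integral[OF i1 iH] bm_increment_moments[OF i, of \<sigma>] by simp
  moreover have "expectation (\<lambda>\<nu>. H \<nu> * (bm_increment \<sigma> n i \<nu>)\<^sup>2) = \<sigma>\<^sup>2 / real n * expectation H"
    using indep_var_lebesgue_integral[OF i2 iH] bm_increment_moments[OF i, of \<sigma>] by simp
  ultimately show ?thesis unfolding H_def by simp
qed

lemma partial_sum_bm_increment:
  assumes "k \<le> n"
  shows "partial_sum (\<lambda>j. bm_increment \<sigma> n j \<nu>) k = \<sigma> * (B (real k / real n) \<nu> - B 0 \<nu>)"
  using assms
proof (induction k)
  case (Suc k)
  then show ?case
    unfolding partial_sum_def by (simp add: bm_increment_def algebra_simps)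
qed (simp add: partial_sum_def)

lemma measurable_SUP_B: "(\<lambda>\<nu>. SUP t\<in>{0..1}. B t \<nu>) \<in> borel_measurable M"
proof (rule borel_measurable_LIMSEQ_real)
  show "\<nu> \<in> space M \<Longrightarrow> (\<lambda>n. Max ((\<lambda>k. B (real k / real n) \<nu>) ` {..n})) \<longlonglongrightarrow> (SUP t\<in>{0..1}. B t \<nu>)" for \<nu>
    by (rule Max_grid_tendsto_SUP[OF continuous_paths])
  show "(\<lambda>\<nu>. Max ((\<lambda>k. B (real k / real n) \<nu>) ` {..n})) \<in> borel_measurable M" for n
    by (rule borel_measurable_Max) (auto intro!: random_variable_B grid_point)
qed

lemma bm_walk_functional_tendsto:
  assumes \<sigma>: "\<sigma> \<ge> 0" and \<beta>: "\<And>n. n > 0 \<Longrightarrow> \<beta> n > 0"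
    and \<beta>_lim: "(\<lambda>n. ln (real (Suc n)) / \<beta> n) \<longlonglongrightarrow> 0"
    and \<nu>: "\<nu> \<in> space M" "B 0 \<nu> = 0"
  shows "(\<lambda>n. walk_functional (\<beta> n) n (\<lambda>j. bm_increment \<sigma> n j \<nu>))
     \<longlonglongrightarrow> \<sigma> * (- (1 / 2) * B 1 \<nu> + (SUP t\<in>{0..1}. B t \<nu>))"
proof -
  define m where "m n = Max ((\<lambda>k. B (real k / real n) \<nu>) ` {..n})" for n
  define w where "w n = walk_functional (\<beta> n) n (\<lambda>j. bm_increment \<sigma> n j \<nu>)" for n
  have m: "m \<longlonglongrightarrow> (SUP t\<in>{0..1}. B t \<nu>)"
    unfolding m_def by (rule Max_grid_tendsto_SUP[OF continuous_paths[OF \<nu>(1)]])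
  have Max: "Max (partial_sum (\<lambda>j. bm_increment \<sigma> n j \<nu>) ` {..n}) = \<sigma> * m n" for n
  proof -
    have "partial_sum (\<lambda>j. bm_increment \<sigma> n j \<nu>) ` {..n} = (\<lambda>y. \<sigma> * y) ` ((\<lambda>k. B (real k / real n) \<nu>) ` {..n})"
      unfolding image_image using partial_sum_bm_increment[of _ n \<sigma> \<nu>] \<nu>(2) by (intro image_cong) auto
    then show ?thesis
      unfolding m_def using mono_Max_commute[of "\<lambda>y. \<sigma> * y" "(\<lambda>k. B (real k / real n) \<nu>) ` {..n}"] \<sigma>
      by (simp add: mono_def mult_left_mono)
  qed
  define c where "c = \<sigma> * (- (1 / 2) * B 1 \<nu>)"
  have bounds: "c + \<sigma> * m n \<le> w n" "w n \<le> c + \<sigma> * m n + ln (real (Suc n)) / \<beta> n" if "n > 0" for n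
    using softmax_bounds[OF \<beta>[OF that], where e="\<lambda>j. bm_increment \<sigma> n j \<nu>" and n=n]
      partial_sum_bm_increment[of n n \<sigma> \<nu>] \<nu>(2) that
    unfolding w_def walk_functional_def Max c_def by auto
  have l1: "(\<lambda>n. c + \<sigma> * m n) \<longlonglongrightarrow> c + \<sigma> * (SUP t\<in>{0..1}. B t \<nu>)" by (intro tendsto_intros m)
  have l2: "(\<lambda>n. c + \<sigma> * m n + ln (real (Suc n)) / \<beta> n) \<longlonglongrightarrow> c + \<sigma> * (SUP t\<in>{0..1}. B t \<nu>) + 0"
    by (intro tendsto_add l1 \<beta>_lim)
  have "w \<longlonglongrightarrow> c + \<sigma> * (SUP t\<in>{0..1}. B t \<nu>)"
  proof (rule real_tendsto_sandwich[OF _ _ l1])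
    show "\<forall>\<^sub>F n in sequentially. c + \<sigma> * m n \<le> w n"
      by (rule eventually_mono[OF eventually_gt_at_top[of 0] bounds(1)])
    show "\<forall>\<^sub>F n in sequentially. w n \<le> c + \<sigma> * m n + ln (real (Suc n)) / \<beta> n"
      by (rule eventually_mono[OF eventually_gt_at_top[of 0] bounds(2)])
  qed (use l2 in simp)
  then show ?thesis unfolding w_def c_def by (simp only: distrib_left)
qed

text \<open>
  Pathwise convergence holds almost surely, and \<open>f\<close> is bounded and continuous.
\<close>

lemma bm_expectation_tendsto:
  fixes f :: "real \<Rightarrow> real"
  assumes f: "continuous_on UNIV f" "\<And>y. \<bar>f y\<bar> \<le> C"
    and \<sigma>: "\<sigma> \<ge> 0" and \<beta>: "\<And>n. n > 0 \<Longrightarrow> \<beta> n > 0"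
    and \<beta>_lim: "(\<lambda>n. ln (real (Suc n)) / \<beta> n) \<longlonglongrightarrow> 0"
  shows "(\<lambda>n. expectation (\<lambda>\<nu>. f (walk_functional (\<beta> n) n (\<lambda>j. bm_increment \<sigma> n j \<nu>))))
     \<longlonglongrightarrow> expectation (\<lambda>\<nu>. f (\<sigma> * (- (1 / 2) * B 1 \<nu> + (SUP t\<in>{0..1}. B t \<nu>))))"
proof (rule integral_dominated_convergence[where w="\<lambda>_. C"])
  have [measurable]: "f \<in> borel_measurable borel" using f(1) by (rule borel_measurable_continuous_onI)
  have [measurable]: "B 1 \<in> borel_measurable M" by (rule random_variable_B) simp
  note [measurable] = measurable_SUP_B
  show "(\<lambda>\<nu>. f (\<sigma> * (- (1 / 2) * B 1 \<nu> + (SUP t\<in>{0..1}. B t \<nu>)))) \<in> borel_measurable M" by measurable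
  show "(\<lambda>\<nu>. f (walk_functional (\<beta> n) n (\<lambda>j. bm_increment \<sigma> n j \<nu>))) \<in> borel_measurable M" for n
  proof -
    have "(\<lambda>\<nu> j. bm_increment \<sigma> n j \<nu>) \<in> M \<rightarrow>\<^sub>M seq_borel"
      by (rule measurable_seq_borelI) (rule bm_increment_measurable)
    from measurable_compose[OF measurable_compose[OF this walk_functional_measurable] \<open>f \<in> borel_measurable borel\<close>]
    show ?thesis .
  qed
  show "AE \<nu> in M. (\<lambda>n. f (walk_functional (\<beta> n) n (\<lambda>j. bm_increment \<sigma> n j \<nu>)))
     \<longlonglongrightarrow> f (\<sigma> * (- (1 / 2) * B 1 \<nu> + (SUP t\<in>{0..1}. B t \<nu>)))"
    using start_zero AE_space
  proof eventually_elim
    case (elim \<nu>)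
    show ?case
      by (rule continuous_on_tendsto_compose[OF f(1) bm_walk_functional_tendsto[OF \<sigma> \<beta> \<beta>_lim]]) (use elim in auto)
  qed
qed (use f(2) in auto)

end

section \<open>The symmetric two-state chain\<close>

text \<open>
  If one-step prediction multiplies \<open>s\<close> by \<open>q\<close>, the prediction errors \<open>s (Suc j) - q * s j\<close> are
  martingale increments; their sum is \<open>1 - q\<close> times the sum of \<open>s\<close>, up to boundary terms.
\<close>

lemma partial_sum_martingale:
  fixes q c :: real and s :: "nat \<Rightarrow> real"
  shows "partial_sum (\<lambda>j. (s (Suc j) - q * s j) / c) k
    = ((1 - q) * (\<Sum>i=1..k. s i) - q * (s 0 - s k)) / c"
  by (induction k) (simp_all add: partial_sum_def field_simps add_divide_distrib[symmetric])

lemma Max_diff_le: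
  fixes f g :: "nat \<Rightarrow> real"
  assumes "\<And>k. k \<le> n \<Longrightarrow> \<bar>f k - g k\<bar> \<le> d"
  shows "\<bar>Max (f ` {..n}) - Max (g ` {..n})\<bar> \<le> d"
proof -
  have "Max (u ` {..n}) \<le> Max (v ` {..n}) + d" if "\<And>k. k \<le> n \<Longrightarrow> \<bar>u k - v k\<bar> \<le> d" for u v :: "nat \<Rightarrow> real"
  proof (intro Max.boundedI)
    fix y assume "y \<in> u ` {..n}"
    then obtain k where k: "k \<le> n" "y = u k" by auto
    have "v k \<le> Max (v ` {..n})" using k by (intro Max_ge) auto
    then show "y \<le> Max (v ` {..n}) + d" using that[OF k(1)] k(2) by linarith
  qed auto
  from this[of f g, OF assms] this[of g f] have "Max (f ` {..n}) \<le> Max (g ` {..n}) + d" "Max (g ` {..n}) \<le> Max (f ` {..n}) + d"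
    using assms by (simp_all add: abs_minus_commute)
  then show ?thesis by linarith
qed

lemma lipschitz_of_bounded_derivative:
  fixes f f1 :: "real \<Rightarrow> real"
  assumes "\<And>y. (f has_real_derivative f1 y) (at y)" "\<And>y. \<bar>f1 y\<bar> \<le> K"
  shows "\<bar>f x - f y\<bar> \<le> K * \<bar>x - y\<bar>"
  using field_differentiable_bound[of UNIV f f1 K x y] assms by auto

text \<open>
  The exponent \<open>1 / 8\<close> is one of many possible choices: any exponent strictly between \<open>0\<close> and \<open>1 / 4\<close>
  makes both errors vanish.
\<close>

lemma softmax_scale:
  fixes \<beta> :: "nat \<Rightarrow> real"
  defines "\<beta> \<equiv> (\<lambda>n. real n powr (1 / 8))"
  shows "\<And>n. n > 0 \<Longrightarrow> \<beta> n \<ge> 1"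
    and "(\<lambda>n. ln (real (Suc n)) / \<beta> n) \<longlonglongrightarrow> 0"
    and "(\<lambda>n. real n * ((\<beta> n)\<^sup>2 / (real n * sqrt (real n)))) \<longlonglongrightarrow> 0"
proof -
  show "n > 0 \<Longrightarrow> \<beta> n \<ge> 1" for n unfolding \<beta>_def by (intro ge_one_powr_ge_zero) auto
  have "(\<lambda>n. real n powr (- (1 / 8))) \<longlonglongrightarrow> 0"
    by (intro tendsto_neg_powr filterlim_real_sequentially) simp
  from tendsto_mult[OF tendsto_const[of "ln 2"] this]
  have "(\<lambda>n. ln 2 / \<beta> n) \<longlonglongrightarrow> 0" unfolding \<beta>_def by (simp add: powr_minus_divide)
  then have "(\<lambda>n. ln 2 / \<beta> n + ln (real n) / \<beta> n) \<longlonglongrightarrow> 0 + 0"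
    by (intro tendsto_add) (simp_all add: \<beta>_def lim_ln_over_power)
  then have lim: "(\<lambda>n. ln 2 / \<beta> n + ln (real n) / \<beta> n) \<longlonglongrightarrow> 0" by simp
  show "(\<lambda>n. ln (real (Suc n)) / \<beta> n) \<longlonglongrightarrow> 0"
  proof (rule Lim_null_comparison[OF _ lim])
    show "\<forall>\<^sub>F n in sequentially. norm (ln (real (Suc n)) / \<beta> n) \<le> ln 2 / \<beta> n + ln (real n) / \<beta> n"
      using eventually_gt_at_top[of 0]
    proof eventually_elim
      case (elim n)
      have "ln (real (Suc n)) \<le> ln (2 * real n)" using elim by (subst ln_le_cancel_iff) auto
      also have "\<dots> = ln 2 + ln (real n)" using elim by (subst ln_mult) auto
      finally have "ln (real (Suc n)) / \<beta> n \<le> (ln 2 + ln (real n)) / \<beta> n"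
        by (intro divide_right_mono) (auto simp: \<beta>_def)
      then show ?case by (simp add: add_divide_distrib \<beta>_def)
    qed
  qed
  have "(\<lambda>n. real n powr (- (1 / 4))) \<longlonglongrightarrow> 0"
    by (intro tendsto_neg_powr filterlim_real_sequentially) simp
  then show "(\<lambda>n. real n * ((\<beta> n)\<^sup>2 / (real n * sqrt (real n)))) \<longlonglongrightarrow> 0"
  proof (rule Lim_transform_eventually)
    show "\<forall>\<^sub>F n in sequentially. real n powr (- (1 / 4)) = real n * ((\<beta> n)\<^sup>2 / (real n * sqrt (real n)))"
      using eventually_gt_at_top[of 0]
    proof eventually_elim
      case (elim n)
      have "(\<beta> n)\<^sup>2 = real n powr (1 / 4)"
        unfolding \<beta>_def power2_eq_square using elim by (simp add: powr_add[symmetric])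
      moreover have "real n powr (1 / 4) / real n powr (1 / 2) = real n powr (- (1 / 4))"
        by (simp add: powr_diff[symmetric])
      ultimately show ?case using elim by (simp add: powr_half_sqrt)
    qed
  qed
qed

lemma integral_iexp_eq:
  assumes Z: "Z \<in> borel_measurable Q" and Q: "prob_space Q"
  shows "(\<integral>x. iexp (\<theta> * Z x) \<partial>Q) = of_real (\<integral>x. cos (\<theta> * Z x) \<partial>Q) + \<i> * of_real (\<integral>x. sin (\<theta> * Z x) \<partial>Q)"
proof -
  interpret Q: prob_space Q by (rule Q)
  have c: "integrable Q (\<lambda>x. cos (\<theta> * Z x))" and s: "integrable Q (\<lambda>x. sin (\<theta> * Z x))"
    using Z by (auto intro!: Q.integrable_const_bound[where B=1])
  have "iexp r = of_real (cos r) + \<i> * of_real (sin r)" for r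
    by (simp add: cis_conv_exp[symmetric] complex_eq_iff)
  then have "(\<integral>x. iexp (\<theta> * Z x) \<partial>Q) = (\<integral>x. of_real (cos (\<theta> * Z x)) + \<i> * of_real (sin (\<theta> * Z x)) \<partial>Q)" by (simp only:)
  also have "\<dots> = of_real (\<integral>x. cos (\<theta> * Z x) \<partial>Q) + \<i> * of_real (\<integral>x. sin (\<theta> * Z x) \<partial>Q)"
    using c s by (subst Bochner_Integration.integral_add) auto
  finally show ?thesis .
qed

locale symmetric_two_state_chain = two_state_chain M X a a
  for M :: "'w measure" and X :: "nat \<Rightarrow> 'w \<Rightarrow> letter" and a :: real +
  assumes a_pos: "a > 0"
begin

definition sign_correlation :: real where "sign_correlation = 1 - 2 * a"

definition martingale_increment :: "nat \<Rightarrow> nat \<Rightarrow> 'w \<Rightarrow> real" where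
  "martingale_increment n j \<omega> =
     (letter_sign (X (Suc j) \<omega>) - sign_correlation * letter_sign (X j \<omega>)) / (2 * a * sqrt (real n))"

lemma abs_sign_correlation: "\<bar>sign_correlation\<bar> \<le> 1" using a01 unfolding sign_correlation_def by auto

lemma letter_sign_simps: "\<bar>letter_sign s\<bar> = 1" "(letter_sign s)\<^sup>2 = 1"
  unfolding letter_sign_def by auto

lemma letter_sign_transition:
  "(\<Sum>y\<in>UNIV. two_state_trans a a x y *\<^sub>R letter_sign y) = sign_correlation * letter_sign x"
  unfolding sum_UNIV_letter by (cases x) (simp_all add: letter_sign_def sign_correlation_def)

lemma martingale_increment_le: "\<bar>martingale_increment n j \<omega>\<bar> \<le> 1 / (a * sqrt (real n))"
proof -
  have "\<bar>letter_sign (X (Suc j) \<omega>) - sign_correlation * letter_sign (X j \<omega>)\<bar>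
     \<le> \<bar>letter_sign (X (Suc j) \<omega>)\<bar> + \<bar>sign_correlation\<bar> * \<bar>letter_sign (X j \<omega>)\<bar>"
    using abs_triangle_ineq4[of "letter_sign (X (Suc j) \<omega>)" "sign_correlation * letter_sign (X j \<omega>)"] by (simp add: abs_mult)
  also have "\<dots> \<le> 2" using abs_sign_correlation by (simp add: letter_sign_simps)
  finally have le: "\<bar>letter_sign (X (Suc j) \<omega>) - sign_correlation * letter_sign (X j \<omega>)\<bar> \<le> 2" .
  have "\<bar>2 * a * sqrt (real n)\<bar> = 2 * a * sqrt (real n)" using a_pos by simp
  then have "\<bar>martingale_increment n j \<omega>\<bar> \<le> 2 / (2 * a * sqrt (real n))"
    unfolding martingale_increment_def abs_divide using a_pos le by (simp only:) (intro divide_right_mono; simp)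
  then show ?thesis by simp
qed

lemma martingale_increment_measurable: "martingale_increment n j \<in> borel_measurable M"
proof -
  have "past_determined (Suc j) (\<lambda>x. (letter_sign (x (Suc j)) - sign_correlation * letter_sign (x j)) / (2 * a * sqrt (real n)))"
    by (intro past_determinedI) auto
  from past_determined_measurable[OF this] show ?thesis unfolding martingale_increment_def .
qed

text \<open>
  The sign has conditional mean \<open>sign_correlation\<close> times the current sign, and signs square to \<open>1\<close>.
  Hence the conditional variance of the increment is the constant \<open>1 - sign_correlation\<^sup>2\<close>, divided by the
  square of the normalisation; this equals \<open>(1 - a) / (a * n)\<close>.
\<close>

lemma martingale_increment_factorize:
  fixes h :: "(nat \<Rightarrow> real) \<Rightarrow> real" and i :: nat
  assumes n: "n > 0"
  defines "H \<equiv> (\<lambda>\<omega>. h (\<lambda>j. if j < i then martingale_increment n j \<omega> else 0))"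
  shows "expectation (\<lambda>\<omega>. H \<omega> * martingale_increment n i \<omega>) = 0"
    and "expectation (\<lambda>\<omega>. H \<omega> * (martingale_increment n i \<omega>)\<^sup>2) = (sqrt ((1 - a) / a))\<^sup>2 / real n * expectation H"
proof -
  define c where "c = 2 * a * sqrt (real n)"
  have c: "c > 0" "c\<^sup>2 = 4 * a\<^sup>2 * real n" unfolding c_def using a_pos n by (auto simp: power_mult_distrib)
  define k where "k x = h (\<lambda>j. if j < i then (letter_sign (x (Suc j)) - sign_correlation * letter_sign (x j)) / c else 0)" for x :: "nat \<Rightarrow> letter"
  have kH: "k (trajectory \<omega>) = H \<omega>" for \<omega> unfolding k_def H_def martingale_increment_def c_def ..
  have pd: "past_determined i (\<lambda>x. F (k x) (x i))" for F :: "real \<Rightarrow> letter \<Rightarrow> real"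
    unfolding k_def by (intro past_determinedI arg_cong2[where f=F] arg_cong[where f=h] ext) auto
  have pd': "past_determined (Suc i) (\<lambda>x. F (k x) (x i) (x (Suc i)))" for F :: "real \<Rightarrow> letter \<Rightarrow> letter \<Rightarrow> real"
  proof (rule past_determinedI)
    fix x y :: "nat \<Rightarrow> letter" assume *: "\<And>j. j \<le> Suc i \<Longrightarrow> x j = y j"
    have "k x = k y" unfolding k_def using * by (intro arg_cong[where f=h] ext) auto
    then show "F (k x) (x i) (x (Suc i)) = F (k y) (y i) (y (Suc i))" using * by auto
  qed
  note int = past_determined_integrable[OF pd, unfolded kH] and int' = past_determined_integrable[OF pd', unfolded kH]
  let ?s = "\<lambda>j \<omega>. letter_sign (X j \<omega>)"
  have ms: "expectation (\<lambda>\<omega>. F (H \<omega>) (X i \<omega>) * ?s (Suc i) \<omega>) = expectation (\<lambda>\<omega>. F (H \<omega>) (X i \<omega>) * (sign_correlation * ?s i \<omega>))"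
    for F :: "real \<Rightarrow> letter \<Rightarrow> real"
    using expectation_markov_step[OF pd[of F], of letter_sign] unfolding letter_sign_transition kH .
  have "expectation (\<lambda>\<omega>. H \<omega> * (?s (Suc i) \<omega> - sign_correlation * ?s i \<omega>)) = 0"
  proof -
    have "expectation (\<lambda>\<omega>. H \<omega> * (?s (Suc i) \<omega> - sign_correlation * ?s i \<omega>))
       = expectation (\<lambda>\<omega>. H \<omega> * ?s (Suc i) \<omega>) - expectation (\<lambda>\<omega>. H \<omega> * (sign_correlation * ?s i \<omega>))"
      unfolding right_diff_distrib
      by (intro Bochner_Integration.integral_diff int'[of "\<lambda>u x y. u * letter_sign y"] int[of "\<lambda>u x. u * (sign_correlation * letter_sign x)"])
    then show ?thesis using ms[of "\<lambda>u x. u"] by simp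
  qed
  then show "expectation (\<lambda>\<omega>. H \<omega> * martingale_increment n i \<omega>) = 0"
    unfolding martingale_increment_def c_def[symmetric] by simp
  have e: "expectation (\<lambda>\<omega>. H \<omega> * (?s (Suc i) \<omega> - sign_correlation * ?s i \<omega>)\<^sup>2) = (1 - sign_correlation\<^sup>2) * expectation H"
  proof -
    have sq: "(u - sign_correlation * v)\<^sup>2 = 1 + sign_correlation\<^sup>2 - 2 * sign_correlation * v * u" if "u\<^sup>2 = 1" "v\<^sup>2 = 1" for u v :: real
      using that by (simp add: power2_diff power_mult_distrib)
    have "expectation (\<lambda>\<omega>. H \<omega> * (?s (Suc i) \<omega> - sign_correlation * ?s i \<omega>)\<^sup>2)
       = expectation (\<lambda>\<omega>. (1 + sign_correlation\<^sup>2) * H \<omega> - (H \<omega> * (2 * sign_correlation * ?s i \<omega>)) * ?s (Suc i) \<omega>)"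
      unfolding sq[OF letter_sign_simps(2) letter_sign_simps(2)]
      by (intro Bochner_Integration.integral_cong refl) (simp add: algebra_simps)
    also have "\<dots> = expectation (\<lambda>\<omega>. (1 + sign_correlation\<^sup>2) * H \<omega>) - expectation (\<lambda>\<omega>. (H \<omega> * (2 * sign_correlation * ?s i \<omega>)) * ?s (Suc i) \<omega>)"
      by (intro Bochner_Integration.integral_diff int'[of "\<lambda>u x y. (u * (2 * sign_correlation * letter_sign x)) * letter_sign y"] int[of "\<lambda>u x. (1 + sign_correlation\<^sup>2) * u"])
    also have "expectation (\<lambda>\<omega>. (H \<omega> * (2 * sign_correlation * ?s i \<omega>)) * ?s (Suc i) \<omega>) = expectation (\<lambda>\<omega>. (2 * sign_correlation\<^sup>2) * H \<omega>)"
      unfolding ms[of "\<lambda>u x. u * (2 * sign_correlation * letter_sign x)"]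
    proof (intro Bochner_Integration.integral_cong refl)
      show "H \<omega> * (2 * sign_correlation * ?s i \<omega>) * (sign_correlation * ?s i \<omega>) = 2 * sign_correlation\<^sup>2 * H \<omega>" for \<omega>
        by (cases "X i \<omega>") (simp_all add: letter_sign_def power2_eq_square)
    qed
    finally show ?thesis by (simp only: integral_mult_right_zero) (simp add: algebra_simps)
  qed
  have "(1 - sign_correlation\<^sup>2) / c\<^sup>2 = (sqrt ((1 - a) / a))\<^sup>2 / real n"
  proof -
    have "(sqrt ((1 - a) / a))\<^sup>2 = (1 - a) / a" using a01 a_pos by simp
    then show ?thesis unfolding c(2) sign_correlation_def using a_pos n by (simp add: field_simps power2_eq_square)
  qed
  moreover have "expectation (\<lambda>\<omega>. H \<omega> * (martingale_increment n i \<omega>)\<^sup>2)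
     = expectation (\<lambda>\<omega>. H \<omega> * (?s (Suc i) \<omega> - sign_correlation * ?s i \<omega>)\<^sup>2) / c\<^sup>2"
    unfolding martingale_increment_def c_def[symmetric] by (simp add: power_divide)
  ultimately show "expectation (\<lambda>\<omega>. H \<omega> * (martingale_increment n i \<omega>)\<^sup>2) = (sqrt ((1 - a) / a))\<^sup>2 / real n * expectation H"
    unfolding e times_divide_eq_left[symmetric] by simp
qed

definition rescaled_LI :: "nat \<Rightarrow> 'w \<Rightarrow> real" where
  "rescaled_LI n \<omega> = (real (LI (trajectory \<omega>) n) - real n / 2) / sqrt (real n)"

text \<open>
  The first error term comes from the boundary terms of \<open>partial_sum_martingale\<close>, the second one from
  the smoothing of the maximum.
\<close>

lemma rescaled_LI_near_walk_functional:
  assumes n: "n > 0" and \<beta>: "\<beta> > 0"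
  shows "\<bar>rescaled_LI n \<omega> - walk_functional \<beta> n (\<lambda>j. martingale_increment n j \<omega>)\<bar>
     \<le> 2 / (a * sqrt (real n)) + ln (real (Suc n)) / \<beta>"
proof -
  define r where "r = sqrt (real n)"
  have r: "r > 0" unfolding r_def using n by simp
  define S where "S k = (\<Sum>i=1..k. letter_sign (X i \<omega>))" for k
  define d where "d = 1 / (a * r)"
  let ?e = "\<lambda>j. martingale_increment n j \<omega>"
  have ps: "\<bar>S k / r - partial_sum ?e k\<bar> \<le> d" for k
  proof -
    have "partial_sum ?e k = (2 * a * S k - sign_correlation * (letter_sign (X 0 \<omega>) - letter_sign (X k \<omega>))) / (2 * a * r)"
      unfolding martingale_increment_def S_def r_def
      by (subst partial_sum_martingale[where s="\<lambda>i. letter_sign (X i \<omega>)"]) (simp add: sign_correlation_def)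
    then have "S k / r - partial_sum ?e k = sign_correlation * (letter_sign (X 0 \<omega>) - letter_sign (X k \<omega>)) / (2 * a * r)"
      using a_pos r by (simp add: diff_divide_distrib)
    also have "\<bar>\<dots>\<bar> \<le> 1 * 2 / (2 * a * r)"
    proof -
      have "\<bar>letter_sign (X 0 \<omega>) - letter_sign (X k \<omega>)\<bar> \<le> 2"
        using letter_sign_simps(1)[of "X 0 \<omega>"] letter_sign_simps(1)[of "X k \<omega>"] by linarith
      then have "\<bar>sign_correlation\<bar> * \<bar>letter_sign (X 0 \<omega>) - letter_sign (X k \<omega>)\<bar> \<le> 1 * 2" using abs_sign_correlation by (intro mult_mono) auto
      then have "\<bar>sign_correlation\<bar> * \<bar>letter_sign (X 0 \<omega>) - letter_sign (X k \<omega>)\<bar> / (2 * a * r) \<le> 1 * 2 / (2 * a * r)"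
        using a_pos r by (intro divide_right_mono) auto
      moreover have "\<bar>2 * a * r\<bar> = 2 * a * r" using a_pos r by simp
      ultimately show ?thesis unfolding abs_divide abs_mult[of sign_correlation] by (simp only:)
    qed
    finally show ?thesis unfolding d_def by simp
  qed
  have LI: "rescaled_LI n \<omega> = - (S n / r) / 2 + Max ((\<lambda>k. S k / r) ` {..n})"
  proof -
    have "Max ((\<lambda>k. S k / r) ` {..n}) = Max (S ` {..n}) / r"
      using mono_Max_commute[of "\<lambda>y. y / r" "S ` {..n}"] r by (simp add: mono_def divide_right_mono image_image)
    then show ?thesis
      unfolding rescaled_LI_def LI_eq_walk_max S_def[symmetric] r_def[symmetric] by (simp add: add_divide_distrib diff_divide_distrib)
  qed
  have combine: "\<bar>- s / 2 + m1 - (- p / 2 + x)\<bar> \<le> 2 * d + l"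
    if "\<bar>m1 - m2\<bar> \<le> d" "\<bar>s - p\<bar> \<le> d" "m2 \<le> x" "x \<le> m2 + l" for s p x m1 m2 l :: real
    using that by linarith
  have "\<bar>Max ((\<lambda>k. S k / r) ` {..n}) - Max (partial_sum ?e ` {..n})\<bar> \<le> d"
    by (rule Max_diff_le) (rule ps)
  from combine[OF this ps[of n] softmax_bounds[OF \<beta>]]
  have "\<bar>rescaled_LI n \<omega> - walk_functional \<beta> n ?e\<bar> \<le> 2 * d + ln (real (Suc n)) / \<beta>"
    unfolding LI walk_functional_def .
  then show ?thesis unfolding d_def r_def by simp
qed

text \<open>
  The chain of comparisons is \<open>u\<close> (the rescaled \<open>LI\<close>), \<open>v\<close> (smoothed functional of the martingale), \<open>w\<close>
  (smoothed functional of the Brownian increments), and finally the functional of the Brownian motion.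
\<close>

lemma rescaled_LI_smooth_test:
  fixes f f1 f2 f3 :: "real \<Rightarrow> real"
  assumes bm: "standard_brownian_motion N B"
    and d: "\<And>y. (f has_real_derivative f1 y) (at y)" "\<And>y. (f1 has_real_derivative f2 y) (at y)"
      "\<And>y. (f2 has_real_derivative f3 y) (at y)"
    and K: "\<And>y. \<bar>f1 y\<bar> \<le> K" "\<And>y. \<bar>f2 y\<bar> \<le> K" "\<And>y. \<bar>f3 y\<bar> \<le> K"
    and f: "\<And>y. \<bar>f y\<bar> \<le> C"
  shows "(\<lambda>n. expectation (\<lambda>\<omega>. f (rescaled_LI n \<omega>))) \<longlonglongrightarrow>
    (\<integral>\<nu>. f (sqrt ((1 - a) / a) * (- (1 / 2) * B 1 \<nu> + (SUP t\<in>{0..1}. B t \<nu>))) \<partial>N)"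
proof -
  interpret N: standard_brownian_motion N B by (rule bm)
  interpret MN: pair_prob_space M N ..
  define \<sigma> where "\<sigma> = sqrt ((1 - a) / a)"
  have \<sigma>: "\<sigma> \<ge> 0" unfolding \<sigma>_def using a01 a_pos by simp
  define \<beta> where "\<beta> n = real n powr (1 / 8)" for n :: nat
  note \<beta> = softmax_scale[folded \<beta>_def]
  have \<beta>_pos: "n > 0 \<Longrightarrow> \<beta> n > 0" for n using \<beta>(1)[of n] by linarith
  have K0: "K \<ge> 0" using K(1)[of 0] by linarith
  have fc: "continuous_on UNIV f" by (rule DERIV_continuous_on[where D=f1]) (simp add: d)
  have fm: "f \<in> borel_measurable borel" using fc by (rule borel_measurable_continuous_onI)
  let ?D = "\<lambda>n \<omega> j. martingale_increment n j \<omega>"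
  let ?G = "\<lambda>n \<nu> j. N.bm_increment \<sigma> n j \<nu>"
  define u where "u n = expectation (\<lambda>\<omega>. f (rescaled_LI n \<omega>))" for n
  define v where "v n = expectation (\<lambda>\<omega>. f (walk_functional (\<beta> n) n (?D n \<omega>)))" for n
  define w where "w n = N.expectation (\<lambda>\<nu>. f (walk_functional (\<beta> n) n (?G n \<nu>)))" for n
  define m where "m = (1 / a) ^ 3"
  define m' where "m' = 2 * \<bar>\<sigma>\<bar> ^ 3"
  have uv: "\<bar>u n - v n\<bar> \<le> K * (2 / (a * sqrt (real n)) + ln (real (Suc n)) / \<beta> n)" if n: "n > 0" for n
  proof -
    have "(\<lambda>\<omega>. ?D n \<omega>) \<in> M \<rightarrow>\<^sub>M seq_borel"
      by (rule measurable_seq_borelI) (rule martingale_increment_measurable)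
    from measurable_compose[OF measurable_compose[OF this walk_functional_measurable] fm]
    have i1: "integrable M (\<lambda>\<omega>. f (walk_functional (\<beta> n) n (?D n \<omega>)))"
      using f by (intro integrable_const_bound[where B=C]) auto
    have i2: "integrable M (\<lambda>\<omega>. f (rescaled_LI n \<omega>))"
      unfolding rescaled_LI_def by (rule past_determined_integrable[OF past_determined_LI])
    have "u n - v n = expectation (\<lambda>\<omega>. f (rescaled_LI n \<omega>) - f (walk_functional (\<beta> n) n (?D n \<omega>)))"
      unfolding u_def v_def using i1 i2 by simp
    moreover have "norm (expectation (\<lambda>\<omega>. f (rescaled_LI n \<omega>) - f (walk_functional (\<beta> n) n (?D n \<omega>))))
       \<le> K * (2 / (a * sqrt (real n)) + ln (real (Suc n)) / \<beta> n)"
    proof (rule norm_expectation_le)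
      show "integrable M (\<lambda>\<omega>. f (rescaled_LI n \<omega>) - f (walk_functional (\<beta> n) n (?D n \<omega>)))"
        using i1 i2 by simp
      fix \<omega>
      from mult_left_mono[OF rescaled_LI_near_walk_functional[OF n \<beta>_pos[OF n], of \<omega>] K0]
      show "norm (f (rescaled_LI n \<omega>) - f (walk_functional (\<beta> n) n (?D n \<omega>)))
         \<le> K * (2 / (a * sqrt (real n)) + ln (real (Suc n)) / \<beta> n)"
        using lipschitz_of_bounded_derivative[OF d(1) K(1), of "rescaled_LI n \<omega>" "walk_functional (\<beta> n) n (?D n \<omega>)"]
        unfolding real_norm_def by linarith
    qed
    ultimately show ?thesis by simp
  qed
  have vw: "\<bar>v n - w n\<bar> \<le> K * (m + m') * (real n * ((\<beta> n)\<^sup>2 / (real n * sqrt (real n))))" if n: "n > 0" for n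
  proof -
    define R where "R = real n * sqrt (real n)"
    have R: "R > 0" "(sqrt (real n)) ^ 3 = R" unfolding R_def using n by (auto simp: power3_eq_cube)
    have D3: "\<bar>martingale_increment n j \<omega>\<bar> ^ 3 \<le> m / R" for j \<omega>
    proof -
      have "\<bar>martingale_increment n j \<omega>\<bar> ^ 3 \<le> (1 / (a * sqrt (real n))) ^ 3"
        by (rule power_mono[OF martingale_increment_le]) simp
      also have "\<dots> = m / R" unfolding m_def R(2)[symmetric] by (simp add: power_divide power_mult_distrib)
      finally show ?thesis .
    qed
    have iD3: "integrable M (\<lambda>\<omega>. \<bar>martingale_increment n j \<omega>\<bar> ^ 3)" for j
      using D3 martingale_increment_measurable[of n j] by (intro integrable_const_bound[where B="m / R"]) auto
    have "\<bar>(\<integral>\<omega>. f (walk_functional (\<beta> n) n (?D n \<omega>)) \<partial>M) - (\<integral>\<nu>. f (walk_functional (\<beta> n) n (?G n \<nu>)) \<partial>N)\<bar>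
       \<le> real n * ((K * (\<beta> n)\<^sup>2) * (m / R + m' / R))"
    proof (rule MN.lindeberg_exchange[where v="\<sigma>\<^sup>2 / real n" and K=C and \<Phi>="\<lambda>e. f (walk_functional (\<beta> n) n e)"])
      show "(\<integral>\<omega>. \<bar>martingale_increment n i \<omega>\<bar> ^ 3 \<partial>M) \<le> m / R" for i
        by (intro integral_le_const iD3) (use D3 in auto)
      show "integrable N (\<lambda>\<nu>. \<bar>N.bm_increment \<sigma> n i \<nu>\<bar> ^ 3)"
        "(\<integral>\<nu>. \<bar>N.bm_increment \<sigma> n i \<nu>\<bar> ^ 3 \<partial>N) \<le> m' / R" if "i < n" for i
        using N.bm_increment_moments(5,6)[OF that, of \<sigma>] unfolding m'_def R_def by auto
      show "(\<integral>\<omega>. h (\<lambda>j. if j < i then martingale_increment n j \<omega> else 0) * martingale_increment n i \<omega> \<partial>M) = 0 \<and>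
        (\<integral>\<omega>. h (\<lambda>j. if j < i then martingale_increment n j \<omega> else 0) * (martingale_increment n i \<omega>)\<^sup>2 \<partial>M)
          = \<sigma>\<^sup>2 / real n * (\<integral>\<omega>. h (\<lambda>j. if j < i then martingale_increment n j \<omega> else 0) \<partial>M)" for i and h :: "(nat \<Rightarrow> real) \<Rightarrow> real"
        unfolding \<sigma>_def by (intro conjI martingale_increment_factorize[OF n])
      show "(\<integral>\<nu>. h (\<lambda>j. if i < j then N.bm_increment \<sigma> n j \<nu> else 0) * N.bm_increment \<sigma> n i \<nu> \<partial>N) = 0 \<and>
        (\<integral>\<nu>. h (\<lambda>j. if i < j then N.bm_increment \<sigma> n j \<nu> else 0) * (N.bm_increment \<sigma> n i \<nu>)\<^sup>2 \<partial>N)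
          = \<sigma>\<^sup>2 / real n * (\<integral>\<nu>. h (\<lambda>j. if i < j then N.bm_increment \<sigma> n j \<nu> else 0) \<partial>N)"
        if "i < n" "h \<in> borel_measurable seq_borel" "\<And>e. \<bar>h e\<bar> \<le> C'" for i h C'
        by (rule N.bm_increment_factorize[OF that])
      show "(\<lambda>e. f (walk_functional (\<beta> n) n e)) \<in> borel_measurable seq_borel"
        by (rule measurable_compose[OF walk_functional_measurable fm])
      show "f (walk_functional (\<beta> n) n e) = f (walk_functional (\<beta> n) n e')" if "\<And>j. j < n \<Longrightarrow> e j = e' j" for e e'
      proof -
        have "partial_sum e k = partial_sum e' k" if "k \<le> n" for k
          unfolding partial_sum_def using that \<open>\<And>j. j < n \<Longrightarrow> e j = e' j\<close> by (intro sum.cong) auto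
        then show ?thesis unfolding walk_functional_def softmax_def by simp
      qed
      show "\<exists>T1 T2 C. T1 \<in> borel_measurable seq_borel \<and> T2 \<in> borel_measurable seq_borel \<and>
         (\<forall>e. \<bar>T1 e\<bar> \<le> C \<and> \<bar>T2 e\<bar> \<le> C) \<and>
         (\<forall>e x. \<bar>f (walk_functional (\<beta> n) n (e(i := x))) - f (walk_functional (\<beta> n) n (e(i := 0)))
            - T1 (e(i := 0)) * x - T2 (e(i := 0)) * x\<^sup>2 / 2\<bar> \<le> K * (\<beta> n)\<^sup>2 * \<bar>x\<bar> ^ 3)" if "i < n" for i
        by (rule walk_functional_taylor[OF d K \<beta>(1)[OF n] that])
      show "K * (\<beta> n)\<^sup>2 \<ge> 0" using K0 by simp
    qed (rule iD3 f martingale_increment_measurable N.bm_increment_measurable)+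
    also have "real n * ((K * (\<beta> n)\<^sup>2) * (m / R + m' / R)) = K * (m + m') * (real n * ((\<beta> n)\<^sup>2 / R))"
      by (simp add: add_divide_distrib[symmetric])
    finally show ?thesis unfolding v_def w_def R_def .
  qed
  have "(\<lambda>n. 2 / (a * sqrt (real n))) \<longlonglongrightarrow> 0"
    by (intro real_tendsto_divide_at_top[OF tendsto_const] filterlim_tendsto_pos_mult_at_top[OF tendsto_const a_pos]
        filterlim_compose[OF sqrt_at_top filterlim_real_sequentially])
  from tendsto_mult[OF tendsto_const[of K] tendsto_add[OF this \<beta>(2)]]
  have l1: "(\<lambda>n. K * (2 / (a * sqrt (real n)) + ln (real (Suc n)) / \<beta> n)) \<longlonglongrightarrow> 0" by simp
  from tendsto_mult[OF tendsto_const[of "K * (m + m')"] \<beta>(3)]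
  have l2: "(\<lambda>n. K * (m + m') * (real n * ((\<beta> n)\<^sup>2 / (real n * sqrt (real n))))) \<longlonglongrightarrow> 0" by simp
  have uv0: "(\<lambda>n. u n - v n) \<longlonglongrightarrow> 0"
    by (rule Lim_null_comparison[OF eventually_mono[OF eventually_gt_at_top[of 0]] l1]) (use uv in simp)
  have vw0: "(\<lambda>n. v n - w n) \<longlonglongrightarrow> 0"
    by (rule Lim_null_comparison[OF eventually_mono[OF eventually_gt_at_top[of 0]] l2]) (use vw in simp)
  have w: "w \<longlonglongrightarrow> N.expectation (\<lambda>\<nu>. f (\<sigma> * (- (1 / 2) * B 1 \<nu> + (SUP t\<in>{0..1}. B t \<nu>))))"
    unfolding w_def by (rule N.bm_expectation_tendsto[OF fc f \<sigma> \<beta>_pos \<beta>(2)])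
  from tendsto_add[OF uv0 tendsto_add[OF vw0 w]] show ?thesis
    unfolding u_def[symmetric] \<sigma>_def[symmetric] by simp
qed

text \<open>
  The functions \<open>cos (\<theta> * y)\<close> and \<open>sin (\<theta> * y)\<close> are smooth test functions with bounded derivatives, and
  they determine characteristic functions.
\<close>

lemma LI_symmetric_limit:
  assumes bm: "standard_brownian_motion N B"
  shows "weak_conv_m
            (\<lambda>n. distr M borel (\<lambda>\<omega>. (real (LI (\<lambda>i. X i \<omega>) n) - real n / 2) / sqrt (real n)))
            (distr N borel (\<lambda>\<omega>. sqrt ((1 - a) / a) * (- (1 / 2) * B 1 \<omega> + (SUP t\<in>{0..1}. B t \<omega>))))"
proof -
  interpret N: standard_brownian_motion N B by (rule bm)
  define Z where "Z \<nu> = sqrt ((1 - a) / a) * (- (1 / 2) * B 1 \<nu> + (SUP t\<in>{0..1}. B t \<nu>))" for \<nu>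
  have [measurable]: "B 1 \<in> borel_measurable N" by (rule N.random_variable_B) simp
  note [measurable] = N.measurable_SUP_B
  have Zm: "Z \<in> borel_measurable N" unfolding Z_def[abs_def] by measurable
  have Rm: "rescaled_LI n \<in> borel_measurable M" for n
    unfolding rescaled_LI_def[abs_def] by (rule past_determined_measurable[OF past_determined_LI])
  have "(\<lambda>n. expectation (\<lambda>\<omega>. iexp (\<theta> * rescaled_LI n \<omega>))) \<longlonglongrightarrow> char (distr N borel Z) \<theta>" for \<theta>
  proof -
    define K where "K = \<bar>\<theta>\<bar> + \<theta>\<^sup>2 + \<bar>\<theta>\<bar> ^ 3"
    have K: "\<bar>\<theta> * t\<bar> \<le> K" "\<bar>\<theta>\<^sup>2 * t\<bar> \<le> K" "\<bar>\<theta> ^ 3 * t\<bar> \<le> K" if "\<bar>t\<bar> \<le> 1" for t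
    proof -
      have "\<bar>\<theta>\<bar> * \<bar>t\<bar> \<le> \<bar>\<theta>\<bar> * 1" "\<theta>\<^sup>2 * \<bar>t\<bar> \<le> \<theta>\<^sup>2 * 1" "\<bar>\<theta>\<bar> ^ 3 * \<bar>t\<bar> \<le> \<bar>\<theta>\<bar> ^ 3 * 1"
        using that by (intro mult_left_mono; simp)+
      moreover have "0 \<le> \<bar>\<theta>\<bar>" "0 \<le> \<theta>\<^sup>2" "0 \<le> \<bar>\<theta>\<bar> ^ 3" by simp_all
      ultimately show "\<bar>\<theta> * t\<bar> \<le> K" "\<bar>\<theta>\<^sup>2 * t\<bar> \<le> K" "\<bar>\<theta> ^ 3 * t\<bar> \<le> K"
        unfolding K_def abs_mult power_abs power2_abs by linarith+
    qed
    have c: "(\<lambda>n. expectation (\<lambda>\<omega>. cos (\<theta> * rescaled_LI n \<omega>))) \<longlonglongrightarrow> N.expectation (\<lambda>\<nu>. cos (\<theta> * Z \<nu>))"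
      unfolding Z_def
      by (rule rescaled_LI_smooth_test[OF bm, where f="\<lambda>y. cos (\<theta> * y)" and ?f1.0="\<lambda>y. \<theta> * - sin (\<theta> * y)"
            and ?f2.0="\<lambda>y. \<theta>\<^sup>2 * - cos (\<theta> * y)" and ?f3.0="\<lambda>y. \<theta> ^ 3 * sin (\<theta> * y)" and K=K and C=1])
         (rule K abs_cos_le_one | simp; fail
          | auto intro!: derivative_eq_intros simp: power2_eq_square power3_eq_cube; fail)+
    have s: "(\<lambda>n. expectation (\<lambda>\<omega>. sin (\<theta> * rescaled_LI n \<omega>))) \<longlonglongrightarrow> N.expectation (\<lambda>\<nu>. sin (\<theta> * Z \<nu>))"
      unfolding Z_def
      by (rule rescaled_LI_smooth_test[OF bm, where f="\<lambda>y. sin (\<theta> * y)" and ?f1.0="\<lambda>y. \<theta> * cos (\<theta> * y)"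
            and ?f2.0="\<lambda>y. \<theta>\<^sup>2 * - sin (\<theta> * y)" and ?f3.0="\<lambda>y. \<theta> ^ 3 * - cos (\<theta> * y)" and K=K and C=1])
         (rule K abs_sin_le_one | simp; fail
          | auto intro!: derivative_eq_intros simp: power2_eq_square power3_eq_cube; fail)+
    have "char (distr N borel Z) \<theta> = (\<integral>\<nu>. iexp (\<theta> * Z \<nu>) \<partial>N)"
      unfolding char_def by (subst integral_distr) (auto simp: Zm)
    then show ?thesis
      unfolding integral_iexp_eq[OF Rm prob_space_axioms] integral_iexp_eq[OF Zm N.prob_space_axioms]
      using c s by (auto intro!: tendsto_intros)
  qed
  from weak_conv_by_expectation_iexp[OF Rm _ this] N.real_distribution_distr[OF Zm]
  show ?thesis unfolding rescaled_LI_def Z_def by simp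
qed

end

section \<open>The limit theorem\<close>

theorem theorem3p1:
  fixes a b :: real
    and M :: "'w measure"
    and X :: "nat \<Rightarrow> 'w \<Rightarrow> letter"
  assumes "a \<in> {0..1}" and "b \<in> {0..1}"
    and "homogeneous_markov_chain M X (two_state_trans a b)"
    and "\<And>s. \<P>(\<omega> in M. X 0 \<omega> = s) = invariant_dist a b s"
  shows
    "(a = b \<and> a > 0 \<longrightarrow>
        (\<forall>(N :: 'v measure) B. standard_brownian_motion N B \<longrightarrow>
          weak_conv_m
            (\<lambda>n. distr M borel
              (\<lambda>\<omega>. (real (LI (\<lambda>i. X i \<omega>) n) - real n / 2) / sqrt (real n)))
            (distr N borel
              (\<lambda>\<omega>. sqrt ((1 - a) / a) * (- (1 / 2) * B 1 \<omega> + (SUP t\<in>{0..1}. B t \<omega>)))))) \<and>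
     (a \<noteq> b \<or> (a = 0 \<and> b = 0) \<longrightarrow>
        weak_conv_m
          (\<lambda>n. distr M borel
            (\<lambda>\<omega>. (real (LI (\<lambda>i. X i \<omega>) n)
                    - real n * max (invariant_dist a b Alpha1) (invariant_dist a b Alpha2))
                  / sqrt (real n)))
          (normal_law 0 (sigma_tilde_sq a b / 4)))"
proof -
  interpret homogeneous_markov_chain M X "two_state_trans a b" by (rule assms(3))
  interpret two_state_chain M X a b
    by unfold_locales (use assms(1,2) in \<open>auto simp: UNIV_letter\<close>)
  show ?thesis
  proof (intro conjI impI allI)
    fix N :: "'v measure" and B
    assume ab: "a = b \<and> a > 0" and bm: "standard_brownian_motion N B"
    interpret sym: symmetric_two_state_chain M X a
      using ab two_state_chain_axioms by (auto simp: symmetric_two_state_chain_def symmetric_two_state_chain_axioms_def)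
    show "weak_conv_m
            (\<lambda>n. distr M borel (\<lambda>\<omega>. (real (LI (\<lambda>i. X i \<omega>) n) - real n / 2) / sqrt (real n)))
            (distr N borel
              (\<lambda>\<omega>. sqrt ((1 - a) / a) * (- (1 / 2) * B 1 \<omega> + (SUP t\<in>{0..1}. B t \<omega>))))"
      by (rule sym.LI_symmetric_limit[OF bm])
  next
    assume "a \<noteq> b \<or> (a = 0 \<and> b = 0)"
    then show "weak_conv_m
          (\<lambda>n. distr M borel
            (\<lambda>\<omega>. (real (LI (\<lambda>i. X i \<omega>) n)
                    - real n * max (invariant_dist a b Alpha1) (invariant_dist a b Alpha2))
                  / sqrt (real n)))
          (normal_law 0 (sigma_tilde_sq a b / 4))"
    proof
      assume "a = 0 \<and> b = 0"
      then show ?thesis using LI_frozen_limit assms(4)[of Alpha1] by (simp add: sigma_tilde_sq_def)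
    qed (rule LI_asymmetric_limit)
  qed
qed

end
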